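(* Fix $0<\delta<1$, let $s=(1-\delta)n$, and let $\varepsilon=\varepsilon(n)$ be any function with $\varepsilon\log n/\log\log n\to\infty$ as $n\to\infty$. Let $M_{n,d}$ denote the random $n\times d$ matrix whose entries are independent and uniform on $\{-1,+1\}$. Then: (1) if $d=d(n)\le n^{1+1/(2-2\delta)-\varepsilon}$, then $\Pr[M_{n,d}\text{ is } s\text{-robust}]\to 1$ as $n\to\infty$; (2) if $d=d(n)\ge n^{1+1/(2-2\delta)+\varepsilon}$, then $\Pr[M_{n,d}\text{ is not } s\text{-robust}]\to 1$ as $n\to\infty$.
   Context: A matrix is called $s$-robust if every $s$ of its columns are linearly independent (over $\mathbb{R}$). *)

theory Defs
  imports "HOL-Probability.Probability" "Jordan_Normal_Form.VS_Connect"
begin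

text \<open>Linear independence over the reals of the family of columns of \<open>M\<close> with index set \<open>S\<close>.
  The library's independence predicate takes a set of vectors, so injectivity is required
  separately: a family with a repeated column is dependent.\<close>

definition cols_indep :: "real mat \<Rightarrow> nat set \<Rightarrow> bool" where
  "cols_indep M S \<longleftrightarrow> inj_on (col M) S \<and>
     LinearCombinations.module.lin_indpt class_ring (module_vec TYPE(real) (dim_row M)) (col M ` S)"

definition robust :: "nat \<Rightarrow> real mat \<Rightarrow> bool" where
  "robust s M \<longleftrightarrow> (\<forall>S \<subseteq> {..<dim_col M}. card S = s \<longrightarrow> cols_indep M S)"

text \<open>The third argument of \<^const>\<open>Pi_pmf\<close> is the value outside the index set; no matrix entry
  reads it.\<close>

definition random_sign_mat :: "nat \<Rightarrow> nat \<Rightarrow> real mat pmf" where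
  "random_sign_mat n d =
     map_pmf (mat n d) (Pi_pmf ({..<n} \<times> {..<d}) 0 (\<lambda>_. pmf_of_set {-1, 1}))"

end

theory Submission
  imports Defs "HOL-Number_Theory.Number_Theory" "HOL-Real_Asymp.Real_Asymp"
begin

text \<open>
  Below the threshold, a dependence among \<open>s\<close> columns yields a nonzero kernel vector of the integer
  matrix modulo a prime \<open>p\<close> of polynomial size, so it suffices to take a union bound over the supports
  and the vectors \<open>v\<close> with nonzero entries modulo \<open>p\<close>. Each row is orthogonal to \<open>v\<close> with probability
  \<open>\<rho>(v)\<close>, and Halasz's argument (Fourier analysis together with Cauchy--Davenport for the level sets)
  bounds \<open>\<rho>(v)\<close> by \<open>O(1/p)\<close> plus \<open>n\<^bsup>-1/2\<^esup>\<close> times logarithms times the probability \<open>\<tau>(v)\<close> that a sparse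
  random relation with coefficients in \<open>{-1, 0, 1}\<close> annihilates a large part of \<open>v\<close>. Since every nontrivial
  relation determines one coordinate from the others, \<open>\<Sum> \<tau>(v)\<^bsup>k\<^esup>\<close> over all vectors of length \<open>k\<close> is
  essentially bounded, which gives an expected number of kernel vectors of about \<open>n\<^bsup>-n/2\<^esup>\<close>. This beats the
  number of supports.

  Above the threshold, consider the sets of \<open>k\<close> columns, \<open>k\<close> even and close to \<open>s\<close>, which contain one column
  of each of \<open>k\<close> blocks and whose sum vanishes. Their number has second moment asymptotic to the square of
  its mean: the joint probability for two sets sharing \<open>j\<close> columns has the Fourier expansion
  \<open>\<Sum>\<^sub>r (j choose r) c\<^sub>r\<^sup>2\<close>, whose coefficients satisfy a two-term recursion, and exceeds the product of the
  probabilities at most by the factor \<open>(1 - (j/(k-1))\<^sup>2)\<^bsup>-1/2\<^esup>\<close>.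
\<close>

text \<open>The number of supports is balanced against three losses. As supports have at most
  \<open>(1 - \<delta>) * n\<close> elements, the part \<open>O(1/p)\<close> of
  \<open>\<rho>\<close> contributes at most \<open>p\<close> to the power
  \<open>- \<delta> * n\<close>; a large enough constant power of \<open>n\<close> as size of
  \<open>p\<close> beats all supports, so a crude existence result for primes is enough. The level
  sets need every coordinate nonzero modulo \<open>p\<close>, hence the sum over supports. The
  choice of \<open>m\<close> near \<open>n / (ln n)^2\<close> makes the \<open>m\<close> leftover
  coordinates cost only \<open>exp (O(n / ln n))\<close>, while \<open>m\<close> in place of
  \<open>n\<close> under the square root costs one logarithm. Since \<open>n powr \<epsilon>\<close>
  exceeds every power of \<open>ln n\<close>, all logarithms can be absorbed.

  Above the threshold \<open>k\<close> is even because an odd number of signs never sums to zero.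
  Blocks give the column sets a product structure, so that at most
  \<open>(k choose j) * m ^ (k - j)\<close> of them share \<open>j\<close> columns with a given one.
  The factor for the joint probability, taken to the power \<open>n\<close>, is close to 1 only for
  \<open>j\<close> well below \<open>sqrt n\<close>; larger overlaps must be outweighed by their
  rarity, and near \<open>j = k\<close> the factor blows up and is replaced by a trivial
  bound.\<close>

section \<open>Primes between \<open>X\<close> and \<open>2 * X\<^sup>2 + 1\<close>\<close>

text \<open>The numbers \<open>1 / ((n + 1) * (n choose m))\<close> form Leibniz's harmonic
  triangle: its edge is \<open>1 / (n + 1)\<close> and every further entry is a difference of two
  entries one place to the left, so the lcm clears all denominators.\<close>

lemma Lcm_leibniz_triangle:
  fixes n m N :: nat
  assumes "n < N" "m \<le> n"
  shows "real (Lcm {1..N}) / (real (Suc n) * real (n choose m)) \<in> \<int>"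
  using assms
proof (induction m arbitrary: n)
  case 0
  have "Suc n dvd Lcm {1..N}" using 0 by (intro dvd_Lcm) auto
  then obtain q where "Lcm {1..N} = Suc n * q" by (auto elim: dvdE)
  then have "real (Lcm {1..N}) = real (Suc n) * real q" by (metis of_nat_mult)
  then show ?case by simp
next
  case (Suc m)
  then obtain n' where n': "n = Suc n'" by (cases n) auto
  have "real (Lcm {1..N}) / (real (Suc n') * real (n' choose m)) \<in> \<int>"
    "real (Lcm {1..N}) / (real (Suc n) * real (n choose m)) \<in> \<int>"
    using Suc.IH[of n'] Suc.IH[of n] Suc.prems n' by (auto simp del: of_nat_Suc)
  moreover have "1 / (real (Suc n) * real (n choose Suc m)) =
      1 / (real (Suc n') * real (n' choose m)) - 1 / (real (Suc n) * real (n choose m))"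
  proof -
    define a where "a = real (n' choose m)"
    have m: "m \<le> n'" using Suc n' by auto
    have a: "a > 0" unfolding a_def using m by simp
    have "Suc m * (n choose Suc m) = n * (n' choose m)"
      unfolding n' by (rule Suc_times_binomial)
    then have e1: "real (Suc m) * real (n choose Suc m) = real n * a"
      unfolding a_def by (metis of_nat_mult)
    have "(n - m) * (n choose m) = n * (n' choose m)"
      using binomial_absorb_comp[of n m] n' by simp
    then have "real (n - m) * real (n choose m) = real n * a"
      unfolding a_def by (metis of_nat_mult)
    then have e2: "(real n - real m) * real (n choose m) = real n * a"
      using m n' by (simp add: of_nat_diff)
    have nm: "real n - real m > 0" using m n' by simp
    have b: "real (n choose Suc m) = real n * a / real (Suc m)" "real (n choose m) = real n * a / (real n - real m)"
      using e1 e2 nm by (auto simp: field_simps)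
    have "real n > 0" using n' by simp
    moreover have "real (Suc n') = real n" using n' by simp
    ultimately show ?thesis unfolding b a_def[symmetric] using a nm
      by (simp add: divide_simps)
  qed
  then have "real (Lcm {1..N}) / (real (Suc n) * real (n choose Suc m)) =
     real (Lcm {1..N}) / (real (Suc n') * real (n' choose m)) - real (Lcm {1..N}) / (real (Suc n) * real (n choose m))"
    by (metis (no_types, lifting) divide_inverse inverse_eq_divide mult.commute mult_1 right_diff_distrib)
  ultimately show ?case by (metis Ints_diff)
qed

text \<open>The central entry of row \<open>2 * N\<close> makes the quotient a positive integer,
  hence at least 1; the factor \<open>2 * N + 1\<close> pays for the loss in the lower bound on the
  central binomial coefficient.\<close>

lemma Lcm_ge_power4: "4 ^ N \<le> Lcm {1..2 * N + 1 :: nat}"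
proof -
  let ?L = "Lcm {1..2 * N + 1 :: nat}"
  let ?b = "Suc (2 * N) * ((2 * N) choose N)"
  have L0: "?L \<noteq> 0" by (auto simp: Lcm_0_iff)
  have b0: "?b > 0" by (simp add: zero_less_binomial)
  have "real ?L / (real (Suc (2*N)) * real ((2*N) choose N)) \<in> \<int>"
    by (rule Lcm_leibniz_triangle) auto
  then have "real ?L / real ?b \<in> \<int>" by (metis of_nat_mult)
  moreover have "real ?L / real ?b > 0" using L0 b0 by (metis divide_pos_pos not_gr0 of_nat_0_less_iff)
  ultimately have "real ?L / real ?b \<ge> 1" using Ints_nonzero_abs_ge1 by fastforce
  then have "real ?b \<le> real ?L" using b0 by (simp add: le_divide_eq del: mult_Suc of_nat_mult)
  then have 1: "?b \<le> ?L" by (simp only: of_nat_le_iff)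
  have "(4::real) ^ N / (2 * real N + 1) \<le> real ((2*N) choose N)"
    by (cases "N = 0") (use central_binomial_lower_bound[of N] in \<open>auto intro!: order_trans[OF _ central_binomial_lower_bound] divide_left_mono\<close>)
  then have "(4::real) ^ N \<le> real ?b" by (simp add: divide_simps mult.commute algebra_simps)
  then have "4 ^ N \<le> ?b" by (metis of_nat_le_iff of_nat_numeral of_nat_power)
  with 1 show ?thesis by simp
qed

text \<open>Each maximal prime power in the lcm is at most \<open>n\<close>, and at most
  \<open>X\<close> primes occur.\<close>

lemma Lcm_le_power_primes:
  fixes n X :: nat
  assumes "\<And>p. prime p \<Longrightarrow> p \<le> n \<Longrightarrow> p \<le> X" "n \<ge> 1"
  shows "Lcm {1..n} \<le> n ^ X"
proof -
  let ?L = "Lcm {1..n}"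
  have L0: "?L \<noteq> 0" by (auto simp: Lcm_0_iff)
  have key: "p \<le> n \<and> p ^ multiplicity p ?L \<le> n" if p: "p \<in> prime_factors ?L" for p
  proof -
    let ?e = "multiplicity p ?L"
    have pp: "prime p" and e: "?e > 0" using p L0 by (auto simp: prime_factors_multiplicity)
    \<comment> \<open>Otherwise \<open>?L div p\<close> would be a smaller common multiple.\<close>
    have "\<exists>k\<in>{1..n}. p ^ ?e dvd k"
    proof (rule ccontr)
      assume "\<not> ?thesis"
      then have nd: "\<not> p ^ ?e dvd k" if "k \<in> {1..n}" for k using that by blast
      have "?L dvd ?L div p"
      proof (rule Lcm_least)
        fix k assume k: "k \<in> {1..n}"
        have "multiplicity p k < ?e" using nd[OF k] k pp
          by (metis multiplicity_dvd' not_le) 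
        have pL: "p dvd ?L" using p by auto
        have "multiplicity q k \<le> multiplicity q (?L div p)" if q: "prime q" for q
        proof -
          have kL: "k dvd ?L" using k by (rule dvd_Lcm)
          have L: "?L = p * (?L div p)" using pL by simp
          have z: "?L div p \<noteq> 0" using L0 L by (metis mult_0_right)
          have "multiplicity q ?L = multiplicity q p + multiplicity q (?L div p)"
            using q pp z L by (metis prime_elem_multiplicity_mult_distrib prime_imp_prime_elem prime_gt_0_nat not_gr0)
          moreover have "multiplicity q p = (if q = p then 1 else 0)" using q pp
            by (simp add: prime_multiplicity_other)
          moreover have "multiplicity q k \<le> multiplicity q ?L" using kL L0 by (simp add: dvd_imp_multiplicity_le)
          ultimately show ?thesis using \<open>multiplicity p k < ?e\<close> by (auto split: if_splits)
        qed
        moreover have "k \<noteq> 0" using k by auto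
        moreover have "?L div p \<noteq> 0" using pL L0 by (metis dvd_div_eq_0_iff)
        ultimately show "k dvd ?L div p" by (intro multiplicity_le_imp_dvd) auto
      qed
      moreover have "?L div p < ?L" using L0 pp by (metis bot_nat_0.not_eq_extremum div_less_dividend prime_gt_1_nat)
      moreover have "?L div p > 0" using p L0 by (metis calculation(1) dvd_0_left_iff gr0I in_prime_factors_imp_dvd dvd_div_eq_0_iff)
      ultimately show False by (meson dvd_imp_le not_le)
    qed
    then obtain k where k: "k \<in> {1..n}" "p ^ ?e dvd k" by blast
    then have "p ^ ?e \<le> n" by (metis atLeastAtMost_iff dvd_imp_le le_trans not_one_le_zero not_gr0)
    moreover have "p \<le> p ^ ?e" using e pp by (intro self_le_power) (auto dest: prime_ge_1_nat)
    ultimately show ?thesis by linarith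
  qed
  have "?L = (\<Prod>p\<in>prime_factors ?L. p ^ multiplicity p ?L)"
    using L0 by (simp add: prod_prime_factors)
  also have "\<dots> \<le> (\<Prod>p\<in>prime_factors ?L. n)" 
  proof (rule prod_mono)
    fix p assume "p \<in> prime_factors ?L"
    from key[OF this] show "0 \<le> p ^ multiplicity p ?L \<and> p ^ multiplicity p ?L \<le> n" by simp
  qed
  also have "\<dots> = n ^ card (prime_factors ?L)" by simp
  also have "\<dots> \<le> n ^ X"
  proof (rule power_increasing)
    have "prime_factors ?L \<subseteq> {1..X}"
    proof
      fix p assume p: "p \<in> prime_factors ?L"
      then have "prime p" by (rule in_prime_factors_imp_prime)
      with key[OF p] assms(1) show "p \<in> {1..X}" using prime_ge_1_nat[of p] by auto
    qed
    from card_mono[OF _ this] show "card (prime_factors ?L) \<le> X" by simp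
  qed (use assms in auto)
  finally show ?thesis .
qed

text \<open>A weak form of Bertrand's postulate; Nair's bound on the least common multiple suffices.\<close>
lemma eventually_prime_between_square:
  "\<forall>\<^sub>F X :: nat in sequentially. \<exists>p. prime p \<and> X < p \<and> p \<le> 2 * X ^ 2 + 1"
proof -
  have "\<forall>\<^sub>F X :: nat in sequentially. real X * ln (2 * real X ^ 2 + 1) < real X ^ 2 * ln 4"
    by real_asymp
  then show ?thesis
  proof (eventually_elim)
    case (elim X)
    show ?case
    proof (rule ccontr)
      assume "\<not> ?case"
      then have "Lcm {1..2 * X^2 + 1} \<le> (2 * X^2 + 1) ^ X"
        by (intro Lcm_le_power_primes) (auto simp: not_less)
      with Lcm_ge_power4[of "X^2"] have "4 ^ (X^2) \<le> (2 * X^2 + 1) ^ X" by linarith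
      then have "real (4 ^ (X^2)) \<le> real ((2 * X^2 + 1) ^ X)" by (simp only: of_nat_le_iff)
      then have "4 ^ (X^2) \<le> (2 * real X^2 + 1) ^ X" by (simp add: add.commute)
      then have "ln (4 ^ (X^2) :: real) \<le> ln ((2 * real X^2 + 1) ^ X)"
        by (subst ln_le_cancel_iff) (auto intro!: zero_less_power add_nonneg_pos)
      then have "real X ^ 2 * ln 4 \<le> real X * ln (2 * real X ^ 2 + 1)"
        by (simp add: ln_realpow add_nonneg_pos)
      with elim show False by linarith
    qed
  qed
qed

section \<open>The Cauchy--Davenport theorem\<close>

definition mod_sumset :: "int \<Rightarrow> int set \<Rightarrow> int set \<Rightarrow> int set" where
  "mod_sumset p A B = (\<lambda>(a, b). (a + b) mod p) ` (A \<times> B)"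

text \<open>A set closed under adding \<open>b\<close> is closed under adding its multiples, and
  these run through all residues modulo the prime.\<close>

lemma exists_shift_outside:
  fixes p b :: int
  assumes p: "prime p" and A: "A \<subseteq> {0..<p}" "A \<noteq> {}" "A \<noteq> {0..<p}" and b: "b \<in> {1..<p}"
  shows "\<exists>a\<in>A. (a + b) mod p \<notin> A"
proof (rule ccontr)
  assume "\<not> ?thesis"
  then have step: "(a + b) mod p \<in> A" if "a \<in> A" for a using that by blast
  obtain a where a: "a \<in> A" using A by auto
  have it: "(a + int k * b) mod p \<in> A" for k
  proof (induction k)
    case 0
    then show ?case using a A by (auto simp: subset_eq)
  next
    case (Suc k)
    have "(a + int (Suc k) * b) mod p = ((a + int k * b) mod p + b) mod p"
      unfolding mod_add_left_eq by (simp add: algebra_simps)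
    then show ?case using step[OF Suc] by simp
  qed
  have "x \<in> A" if x: "x \<in> {0..<p}" for x
  proof -
    have "\<not> p dvd b" using b by (auto dest: zdvd_imp_le)
    then have "coprime b p" using p by (metis coprime_commute prime_imp_coprime)
    then obtain c where c: "[b * c = 1] (mod p)" using cong_solve_coprime_int by blast
    define k where "k = nat ((c * (x - a)) mod p)"
    have "int k = (c * (x - a)) mod p" unfolding k_def using p by (simp add: prime_gt_0_int)
    then have "[int k = c * (x - a)] (mod p)" by (simp add: cong_def)
    then have "[a + int k * b = a + (c * (x - a)) * b] (mod p)" by (intro cong_add cong_mult cong_refl)
    moreover have "[a + (b * c) * (x - a) = a + 1 * (x - a)] (mod p)"
      using c by (intro cong_add cong_mult cong_refl)
    moreover have "a + (c * (x - a)) * b = a + (b * c) * (x - a)" by (simp add: algebra_simps)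
    ultimately have "[a + int k * b = x] (mod p)" by (metis cong_trans add_diff_cancel_left' diff_add_cancel add.commute mult_1)
    then have "(a + int k * b) mod p = x mod p" by (simp add: cong_def)
    also have "\<dots> = x" using x by simp
    finally show ?thesis using it[of k] by simp
  qed
  then show False using A by auto
qed

text \<open>Induction by the Dyson transform: \<open>(A, B)\<close> becomes
  \<open>(A \<union> (a + B), B \<inter> (A - a))\<close>, which keeps the total size and does not
  enlarge the sumset. An \<open>a\<close> with \<open>a + b\<close> outside \<open>A\<close> shrinks
  \<open>B\<close> strictly, and \<open>0\<close> survives in \<open>B\<close> because
  \<open>a\<close> is in \<open>A\<close>.\<close>

theorem Cauchy_Davenport:
  fixes p :: int
  assumes p: "prime p"
  assumes "A \<subseteq> {0..<p}" "B \<subseteq> {0..<p}" "A \<noteq> {}" "0 \<in> B"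
  shows "int (card (mod_sumset p A B)) \<ge> min p (int (card A) + int (card B) - 1)"
  using assms(2-)
proof (induction "card B" arbitrary: A B rule: less_induct)
  case less
  have p0: "p > 0" using p by (simp add: prime_gt_0_int)
  have fin: "finite A" "finite B" using less.prems by (auto intro: finite_subset)
  have finS: "finite (mod_sumset p A B)" unfolding mod_sumset_def using fin by auto
  have sub: "A \<subseteq> mod_sumset p A B"
  proof
    fix a assume "a \<in> A"
    then have "a = (a + 0) mod p" using less.prems by auto
    then show "a \<in> mod_sumset p A B" unfolding mod_sumset_def using \<open>a \<in> A\<close> less.prems by force
  qed
  consider "B = {0}" | "A = {0..<p}" | b where "b \<in> B" "b \<noteq> 0" "A \<noteq> {0..<p}"
    using less.prems by blast
  then show ?case
  proof cases
    case 1
    then show ?thesis using card_mono[OF finS sub] by simp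
  next
    case 2
    then show ?thesis using card_mono[OF finS sub] p0 by simp
  next
    case 3
    then have "b \<in> {1..<p}" using less.prems by force
    then obtain a where a: "a \<in> A" "(a + b) mod p \<notin> A"
      using exists_shift_outside[OF p less.prems(1,3) 3(3)] by blast
    define Ba where "Ba = (\<lambda>x. (a + x) mod p) ` B"
    define B' where "B' = {x \<in> B. (a + x) mod p \<in> A}"
    have inj: "inj_on (\<lambda>x. (a + x) mod p) B"
    proof (rule inj_onI)
      fix x y assume xy: "x \<in> B" "y \<in> B" "(a + x) mod p = (a + y) mod p"
      then have "[a + x = a + y] (mod p)" by (simp add: cong_def)
      then have "[x = y] (mod p)" by (simp add: cong_add_lcancel)
      then show "x = y" using xy less.prems by (auto simp: cong_def subset_eq)
    qed
    have c1: "card Ba = card B" unfolding Ba_def using inj by (rule card_image)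
    have "(\<lambda>x. (a + x) mod p) ` B' = A \<inter> Ba" unfolding B'_def Ba_def by auto
    moreover have "inj_on (\<lambda>x. (a + x) mod p) B'" using inj unfolding B'_def by (rule inj_on_subset) auto
    ultimately have c2: "card B' = card (A \<inter> Ba)" by (metis card_image)
    have finBa: "finite Ba" unfolding Ba_def using fin by simp
    have tot: "card (A \<union> Ba) + card B' = card A + card B"
      using card_Un_Int[OF fin(1) finBa] c1 c2 by simp
    have lt: "card B' < card B"
      by (rule psubset_card_mono) (use fin 3 a in \<open>auto simp: B'_def\<close>)
    have IH: "int (card (mod_sumset p (A \<union> Ba) B')) \<ge> min p (int (card (A \<union> Ba)) + int (card B') - 1)"
    proof (rule less.hyps[OF lt])
      show "A \<union> Ba \<subseteq> {0..<p}" using less.prems p0 by (auto simp: Ba_def)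
      show "B' \<subseteq> {0..<p}" using less.prems by (auto simp: B'_def)
      show "A \<union> Ba \<noteq> {}" using less.prems by auto
      show "0 \<in> B'" using less.prems a by (auto simp: B'_def)
    qed
    have "mod_sumset p (A \<union> Ba) B' \<subseteq> mod_sumset p A B"
    proof
      fix z assume "z \<in> mod_sumset p (A \<union> Ba) B'"
      then obtain x y where xy: "x \<in> A \<union> Ba" "y \<in> B'" "z = (x + y) mod p"
        unfolding mod_sumset_def by auto
      show "z \<in> mod_sumset p A B"
      proof (cases "x \<in> A")
        case True
        then show ?thesis using xy unfolding mod_sumset_def B'_def by auto
      next
        case False
        then obtain t where t: "t \<in> B" "x = (a + t) mod p" using xy unfolding Ba_def by auto
        then have "z = ((a + y) mod p + t) mod p" using xy by (simp add: mod_simps algebra_simps)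
        moreover have "(a + y) mod p \<in> A" using xy unfolding B'_def by auto
        ultimately show ?thesis using t unfolding mod_sumset_def by auto
      qed
    qed
    then have "card (mod_sumset p (A \<union> Ba) B') \<le> card (mod_sumset p A B)" using finS by (rule card_mono[rotated])
    moreover have "int (card (A \<union> Ba)) + int (card B') = int (card A) + int (card B)"
      using tot by (metis of_nat_add)
    ultimately show ?thesis using IH by linarith
  qed
qed

section \<open>Concentration of sign sums modulo a prime\<close>

text \<open>\<open>\<mu>\<close> is the probability of a nonzero step. One family serves both the
  matrix entries (\<open>\<mu> = 1\<close>) and the sparse random relations (\<open>\<mu>\<close>
  small).\<close>

definition lazy_sign :: "real \<Rightarrow> int pmf" where
  "lazy_sign \<mu> = bind_pmf (bernoulli_pmf \<mu>) (\<lambda>b. if b then pmf_of_set {-1, 1} else return_pmf 0)"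

lemma pmf_lazy_sign:
  assumes "0 \<le> \<mu>" "\<mu> \<le> 1"
  shows "pmf (lazy_sign \<mu>) 1 = \<mu> / 2" "pmf (lazy_sign \<mu>) (-1) = \<mu> / 2" "pmf (lazy_sign \<mu>) 0 = 1 - \<mu>"
proof -
  have "pmf (lazy_sign \<mu>) x = \<mu> * pmf (pmf_of_set {-1, 1}) x + (1 - \<mu>) * pmf (return_pmf 0) x" for x
    unfolding lazy_sign_def pmf_bind using assms by (subst integral_bernoulli_pmf) auto
  then show "pmf (lazy_sign \<mu>) 1 = \<mu> / 2" "pmf (lazy_sign \<mu>) (-1) = \<mu> / 2" "pmf (lazy_sign \<mu>) 0 = 1 - \<mu>"
    by (simp_all add: pmf_of_set indicator_def)
qed

lemma set_lazy_sign: "set_pmf (lazy_sign \<mu>) \<subseteq> {-1, 0, 1}"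
  by (auto simp: lazy_sign_def set_pmf_of_set split: if_splits)

lemma lazy_sign_1: "lazy_sign 1 = pmf_of_set {-1, 1}"
proof -
  have "bernoulli_pmf 1 = return_pmf True"
    by (rule pmf_eqI) (auto simp: indicator_def split: bool.splits)
  then show ?thesis by (simp add: lazy_sign_def bind_return_pmf)
qed

definition lazy_vec :: "real \<Rightarrow> 'i set \<Rightarrow> ('i \<Rightarrow> int) pmf" where
  "lazy_vec \<mu> I = Pi_pmf I 0 (\<lambda>_. lazy_sign \<mu>)"

lemma finite_set_lazy_vec [simp]: "finite I \<Longrightarrow> finite (set_pmf (lazy_vec \<mu> I))"
  unfolding lazy_vec_def
  by (subst set_Pi_pmf) (auto intro!: finite_PiE_dflt finite_subset[OF set_lazy_sign])

lemma expectation_lazy_vec_insert: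
  fixes h :: "('i \<Rightarrow> int) \<Rightarrow> real"
  assumes "finite I" "x \<notin> I" "0 \<le> \<mu>" "\<mu> \<le> 1"
  shows "measure_pmf.expectation (lazy_vec \<mu> (insert x I)) h =
     \<mu> / 2 * measure_pmf.expectation (lazy_vec \<mu> I) (\<lambda>c. h (c(x := 1))) +
     \<mu> / 2 * measure_pmf.expectation (lazy_vec \<mu> I) (\<lambda>c. h (c(x := -1))) +
     (1 - \<mu>) * measure_pmf.expectation (lazy_vec \<mu> I) (\<lambda>c. h (c(x := 0)))"
proof -
  have "lazy_vec \<mu> (insert x I) = lazy_sign \<mu> \<bind> (\<lambda>y. map_pmf (\<lambda>c. c(x := y)) (lazy_vec \<mu> I))"
    unfolding lazy_vec_def using assms by (subst Pi_pmf_insert') (auto simp: map_pmf_def)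
  then have "measure_pmf.expectation (lazy_vec \<mu> (insert x I)) h =
    (\<Sum>y\<in>{-1, 0, 1}. pmf (lazy_sign \<mu>) y *\<^sub>R measure_pmf.expectation (map_pmf (\<lambda>c. c(x := y)) (lazy_vec \<mu> I)) h)"
    using assms set_lazy_sign by (simp only:) (subst pmf_expectation_bind[where A = "{-1, 0, 1}"], auto)
  then show ?thesis using assms by (simp add: pmf_lazy_sign)
qed

text \<open>Multiplicativity of characteristic functions in real form. The free phase takes up one
  coordinate at a time, and the sine terms of \<open>1\<close> and \<open>-1\<close> cancel.\<close>

lemma expectation_cos_lazy_vec:
  fixes \<theta> :: "'i \<Rightarrow> real"
  assumes "finite I" "0 \<le> \<mu>" "\<mu> \<le> 1"
  shows "measure_pmf.expectation (lazy_vec \<mu> I) (\<lambda>c. cos (\<phi> + (\<Sum>j\<in>I. real_of_int (c j) * \<theta> j))) =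
    cos \<phi> * (\<Prod>j\<in>I. 1 - \<mu> + \<mu> * cos (\<theta> j))"
  using assms(1)
proof (induction I arbitrary: \<phi> rule: finite_induct)
  case empty
  then show ?case by (simp add: lazy_vec_def)
next
  case (insert x I)
  have upd: "(\<Sum>j\<in>I. real_of_int ((c(x := y)) j) * \<theta> j) = (\<Sum>j\<in>I. real_of_int (c j) * \<theta> j)" for c y
    using insert.hyps by (intro sum.cong) auto
  have E: "measure_pmf.expectation (lazy_vec \<mu> I) (\<lambda>c. cos (\<phi> + (\<Sum>j\<in>insert x I. real_of_int ((c(x := y)) j) * \<theta> j)))
      = cos (\<phi> + real_of_int y * \<theta> x) * (\<Prod>j\<in>I. 1 - \<mu> + \<mu> * cos (\<theta> j))" for y
    using insert.IH[of "\<phi> + real_of_int y * \<theta> x"] insert.hyps upd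
    by (simp add: algebra_simps)
  show ?case
    unfolding expectation_lazy_vec_insert[OF insert.hyps(1,2) assms(2,3)] prod.insert[OF insert.hyps(1,2)]
    by (simp only: E) (simp add: cos_add cos_diff algebra_simps)
qed

text \<open>Orthogonality of characters modulo \<open>p\<close>: the real part of a geometric sum of
  powers of a root of unity.\<close>

lemma sum_cos_multiples:
  fixes p x :: int
  assumes "p > 0"
  shows "(\<Sum>\<xi>\<in>{0..<p}. cos (2 * pi * real_of_int (\<xi> * x) / real_of_int p)) =
    (if p dvd x then real_of_int p else 0)"
proof -
  define t where "t = 2 * pi * real_of_int x / real_of_int p"
  define P where "P = nat p"
  have P: "p = int P" "P > 0" using assms by (auto simp: P_def)
  have "(\<Sum>\<xi>\<in>{0..<p}. cos (2 * pi * real_of_int (\<xi> * x) / real_of_int p)) =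
    (\<Sum>k<P. cos (real k * t))"
    by (rule sum.reindex_bij_witness[of _ int nat]) (use P in \<open>auto simp: t_def field_simps\<close>)
  also have "\<dots> = Re (\<Sum>k<P. cis t ^ k)" by (simp only: Complex.DeMoivre Re_sum cis.simps)
  also have "\<dots> = (if p dvd x then real_of_int p else 0)"
  proof (cases "p dvd x")
    case True
    then obtain y where "x = p * y" by auto
    then have "t = 2 * pi * real_of_int y" using assms by (simp add: t_def)
    then have "cis t = 1" by (metis cis_multiple_2pi Ints_of_int)
    then show ?thesis using True P by simp
  next
    case False
    have "cis t \<noteq> 1"
    proof
      assume "cis t = 1"
      then have "cos t = 1" by (metis cis.simps(1) one_complex.simps(1))
      then obtain y where "t = real_of_int y * 2 * pi" using cos_one_2pi_int by auto
      then have "real_of_int x = real_of_int (y * p)" using assms by (simp add: t_def field_simps)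
      then have "x = y * p" by (simp only: of_int_eq_iff)
      with False show False by simp
    qed
    moreover have "cis t ^ P = 1"
    proof -
      have "real P * t = 2 * pi * real_of_int x" using P by (simp add: t_def)
      then show ?thesis by (simp add: Complex.DeMoivre)
    qed
    ultimately show ?thesis using False by (simp add: geometric_sum)
  qed
  finally show ?thesis .
qed

text \<open>With \<open>\<mu> = 1\<close> and \<open>b\<close> in the role of \<open>v\<close>, this
  is the \<open>\<rho>\<close> of the overview.\<close>

definition hit :: "int \<Rightarrow> real \<Rightarrow> 'i set \<Rightarrow> ('i \<Rightarrow> int) \<Rightarrow> real" where
  "hit p \<mu> I b = measure_pmf.prob (lazy_vec \<mu> I) {c. p dvd (\<Sum>j\<in>I. c j * b j)}"

text \<open>The freedom in \<open>k\<close> is used with \<open>k = 2\<close> for the lazy walk and \<open>k = 1\<close> for the sign walk: then the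
  sizes of both Fourier transforms are governed by the same function \<open>sin_energy\<close>.\<close>
lemma hit_Fourier:
  assumes I: "finite I" and p: "prime p" "coprime p k" and mu: "0 \<le> \<mu>" "\<mu> \<le> 1"
  shows "hit p \<mu> I b = (\<Sum>\<xi>\<in>{0..<p}. \<Prod>j\<in>I. 1 - \<mu> + \<mu> * cos (real_of_int k * (2 * pi * real_of_int (\<xi> * b j) / real_of_int p))) / real_of_int p"
proof -
  let ?a = "\<lambda>\<xi> j. real_of_int k * (2 * pi * real_of_int (\<xi> * b j) / real_of_int p)"
  have p0: "p > 0" using p by (simp add: prime_gt_0_int)
  have dvd2: "p dvd k * x \<longleftrightarrow> p dvd x" for x using p by (simp add: coprime_dvd_mult_right_iff)
  have ind: "indicator {c. p dvd (\<Sum>j\<in>I. c j * b j)} c =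
       (\<Sum>\<xi>\<in>{0..<p}. cos (0 + (\<Sum>j\<in>I. real_of_int (c j) * ?a \<xi> j))) / real_of_int p" for c
  proof -
    have "(\<Sum>j\<in>I. real_of_int (c j) * ?a \<xi> j) = 2 * pi * real_of_int (\<xi> * (k * (\<Sum>j\<in>I. c j * b j))) / real_of_int p" for \<xi>
      by (simp add: sum_distrib_left sum_divide_distrib mult_ac)
    then have "(\<Sum>\<xi>\<in>{0..<p}. cos (0 + (\<Sum>j\<in>I. real_of_int (c j) * ?a \<xi> j))) =
        (if p dvd k * (\<Sum>j\<in>I. c j * b j) then real_of_int p else 0)"
      using sum_cos_multiples[OF p0] by (simp only: add_0)
    then show ?thesis using p0 by (simp only: dvd2) (simp add: indicator_def)
  qed
  have "hit p \<mu> I b = measure_pmf.expectation (lazy_vec \<mu> I) (indicator {c. p dvd (\<Sum>j\<in>I. c j * b j)})"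
    unfolding hit_def by simp
  also have "\<dots> = measure_pmf.expectation (lazy_vec \<mu> I)
      (\<lambda>c. (\<Sum>\<xi>\<in>{0..<p}. cos (0 + (\<Sum>j\<in>I. real_of_int (c j) * ?a \<xi> j))) / real_of_int p)"
    by (intro Bochner_Integration.integral_cong refl ind)
  also have "\<dots> = (\<Sum>\<xi>\<in>{0..<p}. measure_pmf.expectation (lazy_vec \<mu> I) (\<lambda>c. cos (0 + (\<Sum>j\<in>I. real_of_int (c j) * ?a \<xi> j)))) / real_of_int p"
    using I by (subst integral_divide_zero, subst Bochner_Integration.integral_sum)
      (auto intro: integrable_measure_pmf_finite)
  also have "\<dots> = (\<Sum>\<xi>\<in>{0..<p}. \<Prod>j\<in>I. 1 - \<mu> + \<mu> * cos (?a \<xi> j)) / real_of_int p"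
    by (subst expectation_cos_lazy_vec[OF I mu]) simp
  finally show ?thesis .
qed

text \<open>Small energy marks the frequencies with a large Fourier transform: the factors of the
  sign walk satisfy \<open>|cos x| \<le> exp (- (sin x)^2 / 2)\<close>, and those of the lazy walk,
  taken at twice the angle, equal \<open>1 - 2 * \<mu> * (sin x)^2\<close>.\<close>

definition sin_energy :: "int \<Rightarrow> 'i set \<Rightarrow> ('i \<Rightarrow> int) \<Rightarrow> int \<Rightarrow> real" where
  "sin_energy p J b \<xi> = (\<Sum>j\<in>J. (sin (2 * pi * real_of_int (\<xi> * b j) / real_of_int p))\<^sup>2)"

definition level_set :: "int \<Rightarrow> 'i set \<Rightarrow> ('i \<Rightarrow> int) \<Rightarrow> real \<Rightarrow> int set" where
  "level_set p J b t = {\<xi>\<in>{0..<p}. sin_energy p J b \<xi> \<le> t}"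

lemma finite_level_set [simp]: "finite (level_set p J b t)"
  by (rule finite_subset[of _ "{0..<p}"]) (auto simp: level_set_def)

lemma sin_energy_mod:
  assumes "p > 0"
  shows "sin_energy p J b (x mod p) = sin_energy p J b x"
proof -
  have "sin (2 * pi * real_of_int (x mod p * b j) / real_of_int p) = sin (2 * pi * real_of_int (x * b j) / real_of_int p)" for j
  proof -
    have "real_of_int x = real_of_int (x mod p) + real_of_int p * real_of_int (x div p)"
      by (metis mod_mult_div_eq of_int_add of_int_mult)
    then have "2 * pi * real_of_int (x * b j) / real_of_int p =
      2 * pi * real_of_int (x mod p * b j) / real_of_int p + 2 * pi * real_of_int (x div p * b j)"
      using assms by (simp add: field_simps)
    then show ?thesis by (simp add: sin_add cos_int_2pin sin_int_2pin del: of_int_mult)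
  qed
  then show ?thesis unfolding sin_energy_def by simp
qed

text \<open>\<open>|sin|\<close> is subadditive, and squaring costs a factor 2. Two frequencies of
  level \<open>t\<close> thus add up to one of level \<open>4 * t\<close>.\<close>

lemma sin_energy_add: "sin_energy p J b (x + y) \<le> 2 * sin_energy p J b x + 2 * sin_energy p J b y"
proof -
  have aux: "(sin (u + v))\<^sup>2 \<le> 2 * (sin u)\<^sup>2 + 2 * (sin v)\<^sup>2" for u v :: real
  proof -
    have "\<bar>sin (u + v)\<bar> \<le> \<bar>sin u * cos v\<bar> + \<bar>cos u * sin v\<bar>" unfolding sin_add by (rule abs_triangle_ineq)
    also have "\<dots> \<le> \<bar>sin u\<bar> + \<bar>sin v\<bar>"
      unfolding abs_mult by (intro add_mono mult_left_le mult_left_le_one_le) auto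
    finally have "(sin (u + v))\<^sup>2 \<le> (\<bar>sin u\<bar> + \<bar>sin v\<bar>)\<^sup>2" by (metis abs_ge_zero power2_abs power_mono)
    also have "\<dots> \<le> 2 * (sin u)\<^sup>2 + 2 * (sin v)\<^sup>2"
      using sum_squares_bound[of "\<bar>sin u\<bar>" "\<bar>sin v\<bar>"] by (simp add: power2_sum)
    finally show ?thesis .
  qed
  have "2 * pi * real_of_int ((x + y) * b j) / real_of_int p =
     2 * pi * real_of_int (x * b j) / real_of_int p + 2 * pi * real_of_int (y * b j) / real_of_int p" for j
    by (simp add: algebra_simps add_divide_distrib)
  then show ?thesis unfolding sin_energy_def sum_distrib_left sum.distrib[symmetric]
    by (intro sum_mono) (simp only: aux)
qed

text \<open>By Cauchy--Davenport the sumset of a level set with itself is about twice as large,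
  while the level rises by the factor 4. The size grows at least like the square root of the level,
  which is the source of \<open>n\<close> to the power \<open>-1/2\<close>.\<close>

lemma card_level_set_growth:
  assumes p: "prime p" and t: "t \<ge> 0"
  shows "int (card (level_set p J b (4 ^ a * t))) \<ge> min p (2 ^ a * (int (card (level_set p J b t)) - 1) + 1)"
proof (induction a)
  case (Suc a)
  have p0: "p > 0" using p by (simp add: prime_gt_0_int)
  let ?T = "level_set p J b (4 ^ a * t)"
  have z: "0 \<in> ?T" using t p0 by (simp add: level_set_def sin_energy_def)
  have "mod_sumset p ?T ?T \<subseteq> level_set p J b (4 ^ Suc a * t)"
  proof
    fix z assume "z \<in> mod_sumset p ?T ?T"
    then obtain x y where xy: "x \<in> ?T" "y \<in> ?T" "z = (x + y) mod p" unfolding mod_sumset_def by auto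
    then have "sin_energy p J b x \<le> 4 ^ a * t" "sin_energy p J b y \<le> 4 ^ a * t"
      by (auto simp: level_set_def)
    then have "sin_energy p J b (x + y) \<le> 2 * (4 ^ a * t) + 2 * (4 ^ a * t)"
      using sin_energy_add[of p J b x y] by linarith
    then have "sin_energy p J b z \<le> 2 * (4 ^ a * t) + 2 * (4 ^ a * t)"
      using xy(3) p0 by (simp only: sin_energy_mod)
    moreover have "2 * (4 ^ a * t) + 2 * (4 ^ a * t) = 4 ^ Suc a * t" by simp
    moreover have "z \<in> {0..<p}" using xy p0 by simp
    ultimately show "z \<in> level_set p J b (4 ^ Suc a * t)" unfolding level_set_def by simp
  qed
  then have "card (mod_sumset p ?T ?T) \<le> card (level_set p J b (4 ^ Suc a * t))" by (intro card_mono) auto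
  moreover have "int (card (mod_sumset p ?T ?T)) \<ge> min p (int (card ?T) + int (card ?T) - 1)"
    using z by (intro Cauchy_Davenport p) (auto simp: level_set_def)
  moreover have "2 ^ Suc a * (int (card (level_set p J b t)) - 1) = 2 * (2 ^ a * (int (card (level_set p J b t)) - 1))"
    by simp
  ultimately show ?case using Suc by linarith
qed (use p in \<open>auto simp: prime_gt_0_int\<close>)

lemma sum_sin_squared_multiples:
  assumes p: "prime p" "odd p" and x: "\<not> p dvd x"
  shows "(\<Sum>\<xi>\<in>{0..<p}. (sin (2 * pi * real_of_int (\<xi> * x) / real_of_int p))\<^sup>2) = real_of_int p / 2"
proof -
  have p0: "p > 0" using p by (simp add: prime_gt_0_int)
  have "coprime p 2" using p by simp
  then have nd: "\<not> p dvd 2 * x" using x by (simp add: coprime_dvd_mult_right_iff)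
  have "(sin (2 * pi * real_of_int (\<xi> * x) / real_of_int p))\<^sup>2 = (1 - cos (2 * pi * real_of_int (\<xi> * (2 * x)) / real_of_int p)) / 2" for \<xi>
  proof -
    have "2 * pi * real_of_int (\<xi> * (2 * x)) / real_of_int p = 2 * (2 * pi * real_of_int (\<xi> * x) / real_of_int p)" by simp
    then show ?thesis by (simp only: cos_double_sin) simp
  qed
  then have "(\<Sum>\<xi>\<in>{0..<p}. (sin (2 * pi * real_of_int (\<xi> * x) / real_of_int p))\<^sup>2) =
     ((\<Sum>\<xi>\<in>{0..<p}. 1) - (\<Sum>\<xi>\<in>{0..<p}. cos (2 * pi * real_of_int (\<xi> * (2 * x)) / real_of_int p))) / 2"
    by (simp only: sum_subtractf[symmetric] sum_divide_distrib)
  then show ?thesis unfolding sum_cos_multiples[OF p0] using nd p0 by simp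
qed

text \<open>The energy has mean \<open>card J / 2\<close> over all frequencies. This excludes the
  saturated alternative \<open>p\<close> in the growth estimate.\<close>

lemma level_set_not_full:
  assumes p: "prime p" "odd p" and b: "\<And>j. j \<in> J \<Longrightarrow> \<not> p dvd b j" and J: "finite J" and t: "t < real (card J) / 2"
  shows "int (card (level_set p J b t)) < p"
proof (rule ccontr)
  have p0: "p > 0" using p by (simp add: prime_gt_0_int)
  assume "\<not> ?thesis"
  moreover have "level_set p J b t \<subseteq> {0..<p}" by (auto simp: level_set_def)
  ultimately have "level_set p J b t = {0..<p}" using p0 by (intro card_seteq) auto
  then have "sin_energy p J b \<xi> \<le> t" if "\<xi> \<in> {0..<p}" for \<xi>
    using that unfolding level_set_def by blast
  then have "(\<Sum>\<xi>\<in>{0..<p}. sin_energy p J b \<xi>) \<le> (\<Sum>\<xi>\<in>{0..<p}. t)" by (intro sum_mono) auto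
  moreover have "(\<Sum>\<xi>\<in>{0..<p}. sin_energy p J b \<xi>) = (\<Sum>j\<in>J. real_of_int p / 2)"
    unfolding sin_energy_def using b by (subst sum.swap) (intro sum.cong refl sum_sin_squared_multiples p b)
  ultimately have "real (card J) * (real_of_int p / 2) \<le> real_of_int p * t" using p0 by simp
  then have "real (card J) / 2 \<le> t" using p0 by (simp add: field_simps)
  with t show False by simp
qed

lemma exp_minus_double_le:
  fixes x :: real
  assumes "0 \<le> x" "x \<le> 1 / 2"
  shows "exp (- (2 * x)) \<le> 1 - x"
proof -
  have "1 \<le> (1 - x) * (1 + 2 * x)"
    using mult_nonneg_nonneg[of x "1 - 2 * x"] assms by (simp add: algebra_simps)
  also have "\<dots> \<le> (1 - x) * exp (2 * x)"
    using assms exp_ge_add_one_self[of "2 * x"] by (intro mult_left_mono) auto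
  finally show ?thesis by (simp add: exp_minus field_simps)
qed

text \<open>For \<open>\<mu> \<le> 1 / 4\<close> all factors of the lazy transform are positive, so
  nothing cancels in the Fourier sum and each frequency of the level set contributes at least
  \<open>exp (- 4 * \<mu> * t)\<close>.\<close>

lemma card_level_set_le_hit:
  assumes J: "finite J" and p: "prime p" "odd p" and mu: "0 \<le> \<mu>" "\<mu> \<le> 1 / 4"
  shows "real (card (level_set p J b t)) \<le> exp (4 * \<mu> * t) * (real_of_int p * hit p \<mu> J b)"
proof -
  let ?a = "\<lambda>\<xi> j. 2 * pi * real_of_int (\<xi> * b j) / real_of_int p"
  have p0: "p > 0" using p by (simp add: prime_gt_0_int)
  have "hit p \<mu> J b = (\<Sum>\<xi>\<in>{0..<p}. \<Prod>j\<in>J. 1 - \<mu> + \<mu> * cos (real_of_int 2 * ?a \<xi> j)) / real_of_int p"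
    using p mu by (intro hit_Fourier J) auto
  then have ph: "real_of_int p * hit p \<mu> J b = (\<Sum>\<xi>\<in>{0..<p}. \<Prod>j\<in>J. 1 - \<mu> + \<mu> * cos (2 * ?a \<xi> j))"
    using p0 by simp
  have "exp (- (4 * \<mu> * sin_energy p J b \<xi>)) \<le> (\<Prod>j\<in>J. 1 - \<mu> + \<mu> * cos (2 * ?a \<xi> j))" for \<xi>
  proof -
    have "exp (- (4 * \<mu> * sin_energy p J b \<xi>)) = (\<Prod>j\<in>J. exp (- (2 * (2 * \<mu> * (sin (?a \<xi> j))\<^sup>2))))"
      unfolding sin_energy_def using J by (simp add: exp_sum[symmetric] sum_distrib_left sum_negf mult.assoc)
    also have "\<dots> \<le> (\<Prod>j\<in>J. 1 - 2 * \<mu> * (sin (?a \<xi> j))\<^sup>2)"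
    proof (intro prod_mono conjI exp_minus_double_le)
      fix j
      have "(sin (?a \<xi> j))\<^sup>2 \<le> 1" by (simp add: abs_square_le_1)
      then have "\<mu> * (sin (?a \<xi> j))\<^sup>2 \<le> \<mu>" using mu by (simp add: mult_left_le)
      then show "2 * \<mu> * (sin (?a \<xi> j))\<^sup>2 \<le> 1 / 2" using mu by linarith
    qed (use mu in auto)
    also have "\<dots> = (\<Prod>j\<in>J. 1 - \<mu> + \<mu> * cos (2 * ?a \<xi> j))"
      by (intro prod.cong refl) (simp only: cos_double_sin, simp add: algebra_simps)
    finally show ?thesis .
  qed
  note low = this
  have "real (card (level_set p J b t)) * exp (- (4 * \<mu> * t)) = (\<Sum>\<xi>\<in>level_set p J b t. exp (- (4 * \<mu> * t)))" by simp
  also have "\<dots> \<le> (\<Sum>\<xi>\<in>level_set p J b t. \<Prod>j\<in>J. 1 - \<mu> + \<mu> * cos (2 * ?a \<xi> j))"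
  proof (rule sum_mono)
    fix \<xi> assume "\<xi> \<in> level_set p J b t"
    then have "sin_energy p J b \<xi> \<le> t" by (simp add: level_set_def)
    then have "\<mu> * sin_energy p J b \<xi> \<le> \<mu> * t" using mu by (simp add: mult_left_mono)
    then have "exp (- (4 * \<mu> * t)) \<le> exp (- (4 * \<mu> * sin_energy p J b \<xi>))" by simp
    with low[of \<xi>] show "exp (- (4 * \<mu> * t)) \<le> (\<Prod>j\<in>J. 1 - \<mu> + \<mu> * cos (2 * ?a \<xi> j))" by linarith
  qed
  also have "\<dots> \<le> real_of_int p * hit p \<mu> J b" unfolding ph
  proof (rule sum_mono2)
    fix \<xi>
    show "0 \<le> (\<Prod>j\<in>J. 1 - \<mu> + \<mu> * cos (2 * ?a \<xi> j))"
      using low[of \<xi>] exp_ge_zero order_trans by blast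
  qed (auto simp: level_set_def)
  finally show ?thesis by (simp add: exp_minus field_simps)
qed

text \<open>With absolute values, dropping coordinates can only increase the mean, so the sign walk
  on \<open>I\<close> may be bounded through any convenient subset \<open>J\<close>.\<close>

definition abs_cos_mean :: "int \<Rightarrow> 'i set \<Rightarrow> ('i \<Rightarrow> int) \<Rightarrow> real" where
  "abs_cos_mean p J b = (\<Sum>\<xi>\<in>{0..<p}. \<Prod>j\<in>J. \<bar>cos (2 * pi * real_of_int (\<xi> * b j) / real_of_int p)\<bar>) / real_of_int p"

lemma hit_le_abs_cos_mean:
  assumes I: "finite I" and p: "prime p" and J: "J \<subseteq> I"
  shows "hit p 1 I b \<le> abs_cos_mean p J b"
proof -
  let ?a = "\<lambda>\<xi> j. 2 * pi * real_of_int (\<xi> * b j) / real_of_int p"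
  have p0: "p > 0" using p by (simp add: prime_gt_0_int)
  have "hit p 1 I b = (\<Sum>\<xi>\<in>{0..<p}. \<Prod>j\<in>I. 1 - 1 + 1 * cos (real_of_int 1 * ?a \<xi> j)) / real_of_int p"
    using p by (intro hit_Fourier I) auto
  also have "\<dots> \<le> abs_cos_mean p J b"
    unfolding abs_cos_mean_def
  proof (intro divide_right_mono sum_mono)
    fix \<xi>
    have "(\<Prod>j\<in>I. 1 - 1 + 1 * cos (real_of_int 1 * ?a \<xi> j)) \<le> \<bar>\<Prod>j\<in>I. cos (?a \<xi> j)\<bar>" by simp
    also have "\<dots> = (\<Prod>j\<in>I - J. \<bar>cos (?a \<xi> j)\<bar>) * (\<Prod>j\<in>J. \<bar>cos (?a \<xi> j)\<bar>)"
      using prod.subset_diff[OF J I] by (simp only: abs_prod)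
    also have "\<dots> \<le> 1 * (\<Prod>j\<in>J. \<bar>cos (?a \<xi> j)\<bar>)"
      by (intro mult_right_mono prod_le_1 prod_nonneg) auto
    finally show "(\<Prod>j\<in>I. 1 - 1 + 1 * cos (real_of_int 1 * ?a \<xi> j)) \<le> (\<Prod>j\<in>J. \<bar>cos (?a \<xi> j)\<bar>)" by simp
  qed (use p0 in auto)
  finally show ?thesis .
qed

text \<open>Frequencies outside the level set contribute at most \<open>exp (- M / 2)\<close> each;
  those inside get the trivial bound 1.\<close>

lemma abs_cos_mean_le_level_set:
  assumes J: "finite J" and p: "prime p"
  shows "abs_cos_mean p J b \<le> exp (- M / 2) + real (card (level_set p J b M)) / real_of_int p"
proof -
  let ?a = "\<lambda>\<xi> j. 2 * pi * real_of_int (\<xi> * b j) / real_of_int p"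
  have p0: "p > 0" using p by (simp add: prime_gt_0_int)
  have "(\<Prod>j\<in>J. \<bar>cos (?a \<xi> j)\<bar>) \<le> exp (- M / 2) + indicator (level_set p J b M) \<xi>" if "\<xi> \<in> {0..<p}" for \<xi>
  proof (cases "\<xi> \<in> level_set p J b M")
    case True
    have "(\<Prod>j\<in>J. \<bar>cos (?a \<xi> j)\<bar>) \<le> 1" by (intro prod_le_1) auto
    then show ?thesis using True by (simp add: add_increasing)
  next
    case False
    have "\<bar>cos x\<bar> \<le> exp (- (sin x)\<^sup>2 / 2)" for x :: real
    proof (rule power2_le_imp_le)
      have "\<bar>cos x\<bar>\<^sup>2 = 1 + (- (sin x)\<^sup>2)" by (simp add: cos_squared_eq)
      also have "\<dots> \<le> exp (- (sin x)\<^sup>2)" by (rule exp_ge_add_one_self)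
      also have "\<dots> = (exp (- (sin x)\<^sup>2 / 2))\<^sup>2" by (simp add: exp_double[symmetric])
      finally show "\<bar>cos x\<bar>\<^sup>2 \<le> (exp (- (sin x)\<^sup>2 / 2))\<^sup>2" .
    qed simp
    then have "(\<Prod>j\<in>J. \<bar>cos (?a \<xi> j)\<bar>) \<le> (\<Prod>j\<in>J. exp (- (sin (?a \<xi> j))\<^sup>2 / 2))" by (intro prod_mono) auto
    also have "\<dots> = exp (- sin_energy p J b \<xi> / 2)"
      unfolding sin_energy_def using J by (simp add: exp_sum[symmetric] sum_negf sum_divide_distrib)
    also have "\<dots> \<le> exp (- M / 2)" using False that by (simp add: level_set_def)
    finally show ?thesis using False by simp
  qed
  then have "(\<Sum>\<xi>\<in>{0..<p}. \<Prod>j\<in>J. \<bar>cos (?a \<xi> j)\<bar>) \<le> (\<Sum>\<xi>\<in>{0..<p}. exp (- M / 2) + indicator (level_set p J b M) \<xi>)"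
    by (rule sum_mono)
  also have "\<dots> = real_of_int p * exp (- M / 2) + real (card (level_set p J b M))"
  proof -
    have "{0..<p} \<inter> level_set p J b M = level_set p J b M" by (auto simp: level_set_def)
    moreover have "sum (indicat_real (level_set p J b M)) {0..<p} = real (card ({0..<p} \<inter> level_set p J b M))"
      unfolding indicator_def of_bool_def by (simp add: sum.If_cases)
    ultimately show ?thesis using p0 by (simp add: sum.distrib)
  qed
  finally show ?thesis unfolding abs_cos_mean_def using p0 by (simp add: field_simps)
qed

text \<open>A version of Halasz's inequality; \<open>2 ^ a\<close> may be as large as \<open>sqrt (card J)\<close> up to logarithms.\<close>
lemma abs_cos_mean_le_hit:
  assumes J: "finite J" and p: "prime p" "odd p" and b: "\<And>j. j \<in> J \<Longrightarrow> \<not> p dvd b j"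
    and mu: "0 \<le> \<mu>" "\<mu> \<le> 1 / 4" and M: "M \<ge> 0" "4 ^ a * M < real (card J) / 2"
  shows "abs_cos_mean p J b \<le> exp (- M / 2) + 1 / real_of_int p + exp (4 * \<mu> * (4 ^ a * M)) / 2 ^ a * hit p \<mu> J b"
proof -
  have p0: "p > 0" using p by (simp add: prime_gt_0_int)
  let ?c = "\<lambda>t. card (level_set p J b t)"
  have "int (?c (4 ^ a * M)) < p" by (rule level_set_not_full[OF p b J M(2)])
  with card_level_set_growth[OF p(1) M(1), where J = J and b = b and a = a]
  have "2 ^ a * (int (?c M) - 1) + 1 \<le> int (?c (4 ^ a * M))" by linarith
  then have "real_of_int (2 ^ a * (int (?c M) - 1)) \<le> real_of_int (int (?c (4 ^ a * M)))"
    by (simp only: of_int_le_iff)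
  then have "2 ^ a * (real (?c M) - 1) \<le> real (?c (4 ^ a * M))" by simp
  also have "\<dots> \<le> exp (4 * \<mu> * (4 ^ a * M)) * (real_of_int p * hit p \<mu> J b)"
    by (rule card_level_set_le_hit[OF J p mu])
  finally have "real (?c M) / real_of_int p \<le> 1 / real_of_int p + exp (4 * \<mu> * (4 ^ a * M)) / 2 ^ a * hit p \<mu> J b"
    using p0 by (simp add: field_simps)
  with abs_cos_mean_le_level_set[OF J p(1), of b M] show ?thesis by linarith
qed

lemma abs_cos_mean_singleton_le:
  assumes p: "prime p" "odd p" and b: "\<not> p dvd b j"
  shows "abs_cos_mean p {j} b \<le> 3 / 4"
proof -
  let ?a = "\<lambda>\<xi>. 2 * pi * real_of_int (\<xi> * b j) / real_of_int p"
  have p0: "p > 0" using p by (simp add: prime_gt_0_int)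
  \<comment> \<open>The expanded square of \<open>|cos x| - 3 / 4\<close>. As the squared sine has
    mean \<open>1 / 2\<close>, the resulting mean is at most
    \<open>25 / 24 - 1 / 3 = 17 / 24\<close>.\<close>
  have "\<bar>cos x\<bar> \<le> 25 / 24 - 2 / 3 * (sin x)\<^sup>2" for x :: real
    using zero_le_power2[of "\<bar>cos x\<bar> - 3 / 4"] cos_squared_eq[of x] by (simp add: power2_diff power_divide)
  then have "(\<Sum>\<xi>\<in>{0..<p}. \<bar>cos (?a \<xi>)\<bar>) \<le> (\<Sum>\<xi>\<in>{0..<p}. 25 / 24 - 2 / 3 * (sin (?a \<xi>))\<^sup>2)"
    by (rule sum_mono)
  also have "\<dots> = 25 / 24 * real_of_int p - 2 / 3 * (real_of_int p / 2)"
    using sum_sin_squared_multiples[OF p b] p0 by (simp only: sum_subtractf sum_distrib_left[symmetric]) simp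
  finally show ?thesis unfolding abs_cos_mean_def using p0 by (simp add: field_simps)
qed

text \<open>The zero relation holds for every \<open>b\<close> and determines no coordinate, so the
  counting argument must exclude it.\<close>

definition hit_nonzero :: "int \<Rightarrow> real \<Rightarrow> 'i set \<Rightarrow> ('i \<Rightarrow> int) \<Rightarrow> real" where
  "hit_nonzero p \<mu> I b = measure_pmf.prob (lazy_vec \<mu> I) {c. p dvd (\<Sum>j\<in>I. c j * b j) \<and> (\<exists>j\<in>I. c j \<noteq> 0)}"

lemma hit_le_hit_nonzero:
  assumes I: "finite I" and mu: "0 \<le> \<mu>" "\<mu> \<le> 1"
  shows "hit p \<mu> I b \<le> hit_nonzero p \<mu> I b + exp (- \<mu> * real (card I))"
proof -
  let ?Z = "Pi I (\<lambda>_. {0 :: int})"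
  have "hit p \<mu> I b \<le> measure_pmf.prob (lazy_vec \<mu> I)
     ({c. p dvd (\<Sum>j\<in>I. c j * b j) \<and> (\<exists>j\<in>I. c j \<noteq> 0)} \<union> ?Z)"
    unfolding hit_def by (intro measure_pmf.finite_measure_mono) auto
  also have "\<dots> \<le> hit_nonzero p \<mu> I b + measure_pmf.prob (lazy_vec \<mu> I) ?Z"
    unfolding hit_nonzero_def by (intro measure_Un_le) auto
  also have "measure_pmf.prob (lazy_vec \<mu> I) ?Z = (1 - \<mu>) ^ card I"
    unfolding lazy_vec_def using I mu by (subst measure_Pi_pmf_Pi) (auto simp: measure_pmf_single pmf_lazy_sign)
  also have "\<dots> \<le> exp (- \<mu>) ^ card I"
    using mu exp_ge_add_one_self[of "- \<mu>"] by (intro power_mono) auto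
  also have "\<dots> = exp (- \<mu> * real (card I))" by (simp add: exp_of_nat_mult[symmetric] mult.commute)
  finally show ?thesis by simp
qed

section \<open>Counting vectors with large concentration\<close>

text \<open>This is the \<open>\<tau>\<close> of the overview. Because of the minimum over subsets
  it can only grow when coordinates are deleted (\<open>min_hit_antimono\<close>), as needed when
  the coordinate determined by a relation is removed.\<close>

definition min_hit :: "int \<Rightarrow> real \<Rightarrow> nat \<Rightarrow> 'i set \<Rightarrow> ('i \<Rightarrow> int) \<Rightarrow> real" where
  "min_hit p \<mu> m I b = Min ((\<lambda>J. hit_nonzero p \<mu> J b) ` {J. J \<subseteq> I \<and> m \<le> card J})"

lemma hit_nonzero_range: "0 \<le> hit_nonzero p \<mu> J b" "hit_nonzero p \<mu> J b \<le> 1"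
  unfolding hit_nonzero_def by auto

lemma hit_nonzero_cong:
  assumes "\<And>j. j \<in> J \<Longrightarrow> b j = b' j"
  shows "hit_nonzero p \<mu> J b = hit_nonzero p \<mu> J b'"
proof -
  have "(\<Sum>j\<in>J. c j * b j) = (\<Sum>j\<in>J. c j * b' j)" for c :: "'a \<Rightarrow> int"
    using assms by (intro sum.cong) auto
  then show ?thesis unfolding hit_nonzero_def by simp
qed

context
  fixes I :: "'i set" and m :: nat
  assumes I: "finite I" and mI: "m \<le> card I"
begin

lemma finite_large_subsets: "finite {J. J \<subseteq> I \<and> m \<le> card J}" "{J. J \<subseteq> I \<and> m \<le> card J} \<noteq> {}"
  using I mI by auto

lemma min_hit_le: "J \<subseteq> I \<Longrightarrow> m \<le> card J \<Longrightarrow> min_hit p \<mu> m I b \<le> hit_nonzero p \<mu> J b"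
  unfolding min_hit_def using finite_large_subsets by (intro Min_le) auto

lemma min_hit_attained:
  obtains J where "J \<subseteq> I" "m \<le> card J" "min_hit p \<mu> m I b = hit_nonzero p \<mu> J b"
proof -
  have "min_hit p \<mu> m I b \<in> (\<lambda>J. hit_nonzero p \<mu> J b) ` {J. J \<subseteq> I \<and> m \<le> card J}"
    unfolding min_hit_def using finite_large_subsets by (intro Min_in) auto
  then show thesis using that by auto
qed

lemma min_hit_range: "0 \<le> min_hit p \<mu> m I b" "min_hit p \<mu> m I b \<le> 1"
proof -
  obtain J where "min_hit p \<mu> m I b = hit_nonzero p \<mu> J b" using min_hit_attained .
  then show "0 \<le> min_hit p \<mu> m I b" "min_hit p \<mu> m I b \<le> 1" by (simp_all add: hit_nonzero_range)
qed

end

lemma min_hit_antimono: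
  assumes "finite I" "I' \<subseteq> I" "m \<le> card I'"
  shows "min_hit p \<mu> m I b \<le> min_hit p \<mu> m I' b"
proof -
  have I': "finite I'" using assms finite_subset by blast
  have mI: "m \<le> card I" using assms card_mono le_trans by blast
  obtain J where J: "J \<subseteq> I'" "m \<le> card J" "min_hit p \<mu> m I' b = hit_nonzero p \<mu> J b"
    using min_hit_attained[OF I' assms(3)] .
  then show ?thesis using min_hit_le[OF assms(1) mI, of J] assms by auto
qed

lemma min_hit_cong:
  assumes "\<And>j. j \<in> I \<Longrightarrow> b j = b' j"
  shows "min_hit p \<mu> m I b = min_hit p \<mu> m I b'"
  unfolding min_hit_def using assms
  by (intro arg_cong[of _ _ Min] image_cong refl hit_nonzero_cong) auto

text \<open>Each relation \<open>p dvd \<Sum>j\<in>I. c j * b j\<close> with \<open>c i\<close> invertible determines \<open>b i\<close> from the other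
  entries; averaging over the relation \<open>c\<close> trades one factor \<open>min_hit\<close> for one coordinate.\<close>
lemma sum_min_hit_power_le:
  assumes I: "finite I" and p: "prime p" "odd p" and m: "m \<le> card I"
  shows "(\<Sum>b\<in>PiE I (\<lambda>_. {0..<p}). min_hit p \<mu> m I b ^ (card I - m)) \<le> real_of_int p ^ m"
  using I m
proof (induction "card I" arbitrary: I)
  case 0
  then have "PiE I (\<lambda>_. {0..<p}) = {\<lambda>_. undefined}" by simp
  then show ?case using 0 by simp
next
  case (Suc k)
  have p0: "p > 0" using p by (simp add: prime_gt_0_int)
  let ?V = "PiE I (\<lambda>_. {0..<p})"
  have finV: "finite ?V" using Suc by (intro finite_PiE) auto
  show ?case
  proof (cases "m = card I")
    case True
    then have "(\<Sum>b\<in>?V. min_hit p \<mu> m I b ^ (card I - m)) = real (card ?V)" by simp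
    also have "\<dots> = real_of_int p ^ m" using Suc p0 True by (simp add: card_PiE)
    finally show ?thesis by simp
  next
    case False
    then have mk: "m \<le> k" "card I - m = Suc (k - m)" using Suc by auto
    let ?L = "lazy_vec \<mu> I"
    define R where "R b c \<longleftrightarrow> p dvd (\<Sum>j\<in>I. c j * b j) \<and> (\<exists>j\<in>I. c j \<noteq> 0)" for b c
    let ?f = "\<lambda>b. min_hit p \<mu> m I b ^ (k - m)"
    have f0: "?f b \<ge> 0" for b using min_hit_range[OF Suc.prems] by simp
    \<comment> \<open>One of the \<open>card I - m\<close> factors is bounded through
      \<open>J = I\<close> and becomes an average over the relation \<open>c\<close>; the others are
      left to the induction hypothesis.\<close>
    have "min_hit p \<mu> m I b ^ (card I - m) \<le> hit_nonzero p \<mu> I b * ?f b" for b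
      unfolding mk(2) power_Suc using min_hit_le[OF Suc.prems, of I] Suc.prems f0
      by (intro mult_right_mono) auto
    then have "(\<Sum>b\<in>?V. min_hit p \<mu> m I b ^ (card I - m)) \<le> (\<Sum>b\<in>?V. hit_nonzero p \<mu> I b * ?f b)"
      by (rule sum_mono)
    also have "\<dots> = (\<Sum>b\<in>?V. measure_pmf.expectation ?L (\<lambda>c. indicator {c. R b c} c * ?f b))"
      unfolding hit_nonzero_def R_def[symmetric] by simp
    also have "\<dots> = measure_pmf.expectation ?L (\<lambda>c. \<Sum>b\<in>?V. indicator {c. R b c} c * ?f b)"
      using Suc.prems by (intro Bochner_Integration.integral_sum[symmetric] integrable_measure_pmf_finite) simp
    also have "\<dots> \<le> measure_pmf.expectation ?L (\<lambda>c. real_of_int p ^ m)"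
    proof (rule integral_mono_AE)
      show "AE c in ?L. (\<Sum>b\<in>?V. indicator {c. R b c} c * ?f b) \<le> real_of_int p ^ m"
      proof (rule AE_pmfI)
        fix c assume "c \<in> set_pmf ?L"
        then have cr: "c j \<in> {-1, 0, 1}" if "j \<in> I" for j
          using that Suc.prems set_lazy_sign unfolding lazy_vec_def
          by (subst (asm) set_Pi_pmf) (auto simp: PiE_dflt_def)
        show "(\<Sum>b\<in>?V. indicator {c. R b c} c * ?f b) \<le> real_of_int p ^ m"
        proof (cases "\<exists>i\<in>I. c i \<noteq> 0")
          case False
          then show ?thesis using p0 by (simp add: R_def)
        next
          case True
          \<comment> \<open>The index \<open>i\<close> depends on \<open>c\<close> alone, so for
            fixed \<open>c\<close> the same coordinate is removed from all \<open>b\<close>.\<close>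
          then obtain i where i: "i \<in> I" "c i \<noteq> 0" by blast
          let ?I' = "I - {i}"
          have I': "finite ?I'" "k = card ?I'" using Suc i by auto
          let ?V' = "PiE ?I' (\<lambda>_. {0..<p})"
          let ?S = "{b \<in> ?V. R b c}"
          have inj: "inj_on (\<lambda>b. restrict b ?I') ?S"
          proof (rule inj_onI)
            fix b b' assume b: "b \<in> ?S" "b' \<in> ?S" and eq: "restrict b ?I' = restrict b' ?I'"
            have off: "b j = b' j" if "j \<in> ?I'" for j using fun_cong[OF eq, of j] that by simp
            have split: "(\<Sum>j\<in>I. c j * x j) = c i * x i + (\<Sum>j\<in>?I'. c j * x j)" for x
              using i Suc.prems by (simp add: sum.remove)
            have "p dvd (\<Sum>j\<in>I. c j * b j) - (\<Sum>j\<in>I. c j * b' j)"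
              using b unfolding R_def by (intro dvd_diff) auto
            moreover have "(\<Sum>j\<in>?I'. c j * b j) = (\<Sum>j\<in>?I'. c j * b' j)" using off by (intro sum.cong) auto
            ultimately have "p dvd c i * (b i - b' i)" unfolding split by (simp add: algebra_simps)
            then have "p dvd b i - b' i" using cr[OF i(1)] i(2) by (auto simp: dvd_diff_commute)
            moreover have "b i \<in> {0..<p}" "b' i \<in> {0..<p}" using b i by (auto simp: PiE_iff)
            ultimately have "b i = b' i" by (metis atLeastLessThan_iff mod_eq_dvd_iff mod_pos_pos_trivial)
            show "b = b'"
            proof
              fix j show "b j = b' j"
                using b off \<open>b i = b' i\<close> by (cases "j \<in> I"; cases "j = i") (auto simp: PiE_iff extensional_def)
            qed
          qed
          have "(\<Sum>b\<in>?V. indicator {c. R b c} c * ?f b) = (\<Sum>b\<in>?V. if b \<in> ?S then ?f b else 0)"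
            by (rule sum.cong) (auto split: split_indicator)
          also have "\<dots> = (\<Sum>b\<in>?S. ?f b)"
            using finV by (subst sum.inter_restrict[symmetric]) (auto intro!: arg_cong[of _ _ "sum _"])
          also have "\<dots> \<le> (\<Sum>b\<in>?S. min_hit p \<mu> m ?I' (restrict b ?I') ^ (k - m))"
          proof (rule sum_mono)
            fix b
            have "min_hit p \<mu> m I b \<le> min_hit p \<mu> m ?I' b"
              using Suc.prems mk I' by (intro min_hit_antimono) auto
            also have "\<dots> = min_hit p \<mu> m ?I' (restrict b ?I')" by (rule min_hit_cong) simp
            finally show "?f b \<le> min_hit p \<mu> m ?I' (restrict b ?I') ^ (k - m)"
              using min_hit_range[OF Suc.prems] by (intro power_mono) auto
          qed
          also have "\<dots> = (\<Sum>b\<in>(\<lambda>b. restrict b ?I') ` ?S. min_hit p \<mu> m ?I' b ^ (k - m))"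
            by (subst sum.reindex[OF inj]) simp
          also have "\<dots> \<le> (\<Sum>b\<in>?V'. min_hit p \<mu> m ?I' b ^ (k - m))"
          proof (rule sum_mono2)
            show "finite ?V'" using I' by (intro finite_PiE) auto
            show "(\<lambda>b. restrict b ?I') ` ?S \<subseteq> ?V'" by (rule image_subsetI) (simp add: PiE_iff)
            show "0 \<le> min_hit p \<mu> m ?I' b ^ (k - m)" for b
              using min_hit_range[of ?I' m] I' mk by simp
          qed
          also have "\<dots> \<le> real_of_int p ^ m"
            using Suc.hyps(1)[OF I'(2) I'(1)] mk(1) I'(2) by metis
          finally show ?thesis .
        qed
      qed
    qed (use Suc.prems in \<open>auto intro!: integrable_measure_pmf_finite\<close>)
    also have "\<dots> = real_of_int p ^ m" by simp
    finally show ?thesis .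
  qed
qed

text \<open>With \<open>l = ln p\<close>, the choice \<open>\<mu> = l / m\<close> makes the zero
  relation no likelier than \<open>1 / p\<close>, \<open>M = 2 * l\<close> gives
  \<open>exp (- M / 2) = 1 / p\<close>, and \<open>4 ^ a\<close> of order
  \<open>m / (8 * l^2)\<close> keeps \<open>4 * \<mu> * 4 ^ a * M\<close> at most 1, so that the
  exponential factor is at most 3. The errors sum to \<open>(1 + 1 + 3) / p\<close>.\<close>

lemma hit_le_min_hit:
  fixes p :: int
  assumes I: "finite I" and p: "prime p" "odd p" and b: "\<And>j. j \<in> I \<Longrightarrow> \<not> p dvd b j"
    and m: "m \<le> card I" "8 * (ln (real_of_int p))\<^sup>2 \<le> real m"
  shows "hit p 1 I b \<le> 5 / real_of_int p + 18 * ln (real_of_int p) / sqrt (real m) * min_hit p (ln (real_of_int p) / real m) m I b"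
proof -
  let ?l = "ln (real_of_int p)"
  let ?\<mu> = "?l / real m"
  let ?x = "real m / (8 * ?l\<^sup>2)"
  have "p \<noteq> 2" using p by auto
  then have p3: "p \<ge> 3" using p(1) prime_ge_2_int[of p] by linarith
  then have "real_of_int p \<ge> 3" by simp
  then have "exp 1 \<le> real_of_int p" using exp_le by linarith
  then have l1: "?l \<ge> 1" using p3 by (simp add: ln_ge_iff)
  have "?l\<^sup>2 \<ge> 1" using l1 by (simp add: one_le_power)
  then have m0: "real m > 0" using m(2) by linarith
  have x1: "?x \<ge> 1" using m(2) l1 by (simp add: le_divide_eq)
  then have "nat \<lfloor>?x\<rfloor> \<ge> 1" by (simp add: le_nat_iff le_floor_iff)
  then obtain a where a: "4 ^ a \<le> nat \<lfloor>?x\<rfloor>" "nat \<lfloor>?x\<rfloor> < 4 ^ (a + 1)"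
    using ex_power_ivl1[of 4 "nat \<lfloor>?x\<rfloor>"] by auto
  have "real (4 ^ a) \<le> real (nat \<lfloor>?x\<rfloor>)" using a(1) by (simp only: of_nat_le_iff)
  also have "\<dots> \<le> ?x" using x1 by simp
  finally have a1: "4 ^ a \<le> ?x" by simp
  have "real (nat \<lfloor>?x\<rfloor> + 1) \<le> real (4 ^ (a + 1))" using a(2) by (simp only: of_nat_le_iff)
  moreover have "real (nat \<lfloor>?x\<rfloor>) = real_of_int \<lfloor>?x\<rfloor>" using x1 by simp
  moreover have "real (nat \<lfloor>?x\<rfloor> + 1) = real (nat \<lfloor>?x\<rfloor>) + 1" "real (4 ^ (a + 1)) = 4 * 4 ^ a" by simp_all
  ultimately have a2: "?x < 4 * 4 ^ a" using floor_correct[of ?x] by linarith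
  obtain J where J: "J \<subseteq> I" "m \<le> card J" "min_hit p ?\<mu> m I b = hit_nonzero p ?\<mu> J b"
    using min_hit_attained[OF I m(1)] .
  have finJ: "finite J" using J I finite_subset by blast
  have mu: "0 \<le> ?\<mu>" "?\<mu> \<le> 1 / 4"
  proof -
    have "4 * ?l \<le> 8 * ?l\<^sup>2" using l1 by (simp add: power2_eq_square)
    then show "?\<mu> \<le> 1 / 4" using m m0 by (simp add: field_simps)
  qed (use l1 in simp)
  have aM: "4 ^ a * (2 * ?l) \<le> real m / (4 * ?l)"
  proof -
    have "4 ^ a * (2 * ?l) \<le> ?x * (2 * ?l)" using a1 l1 by (intro mult_right_mono) auto
    also have "\<dots> = real m / (4 * ?l)" using l1 by (simp add: power2_eq_square)
    finally show ?thesis .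
  qed
  have "real m / (4 * ?l) < real m / 2" using l1 m0 by (intro divide_strict_left_mono) auto
  with aM J(2) have "4 ^ a * (2 * ?l) < real (card J) / 2" by linarith
  then have "abs_cos_mean p J b \<le> exp (- (2 * ?l) / 2) + 1 / real_of_int p + exp (4 * ?\<mu> * (4 ^ a * (2 * ?l))) / 2 ^ a * hit p ?\<mu> J b"
    using J b mu l1 by (intro abs_cos_mean_le_hit[OF finJ p]) auto
  moreover have "exp (- (2 * ?l) / 2) = 1 / real_of_int p" using p3 by (simp add: exp_minus inverse_eq_divide)
  moreover have "exp (4 * ?\<mu> * (4 ^ a * (2 * ?l))) / 2 ^ a * hit p ?\<mu> J b
      \<le> 3 / real_of_int p + 18 * ?l / sqrt (real m) * hit_nonzero p ?\<mu> J b"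
  proof -
    have "4 * ?\<mu> * (4 ^ a * (2 * ?l)) \<le> 4 * ?\<mu> * (real m / (4 * ?l))"
      using aM mu by (intro mult_left_mono) auto
    also have "\<dots> = 1" using l1 m0 by simp
    finally have "exp (4 * ?\<mu> * (4 ^ a * (2 * ?l))) \<le> exp 1" by simp
    then have "exp (4 * ?\<mu> * (4 ^ a * (2 * ?l))) \<le> 3" using exp_le by linarith
    then have e: "exp (4 * ?\<mu> * (4 ^ a * (2 * ?l))) / 2 ^ a \<le> 3 / 2 ^ a" by (simp add: divide_right_mono)
    have K: "3 / 2 ^ a \<le> 18 * ?l / sqrt (real m)"
    proof -
      have "real m < 32 * ?l\<^sup>2 * 4 ^ a" 
        using a2 l1 pos_divide_less_eq[of "8 * ?l\<^sup>2" "real m" "4 * 4 ^ a"] by (simp add: mult_ac)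
      \<comment> \<open>Rounding 32 up to a square; with the bound 3 on the exponential this gives
        \<open>18 = 3 * 6\<close>.\<close>
      also have "\<dots> \<le> 36 * ?l\<^sup>2 * 4 ^ a" by simp
      also have "\<dots> = (6 * ?l * 2 ^ a)\<^sup>2"
        using power_mult_distrib[of "2 :: real" 2 a] by (simp add: power2_eq_square)
      finally have "sqrt (real m) \<le> 6 * ?l * 2 ^ a" using l1 by (intro real_le_lsqrt) auto
      then show ?thesis using m0 by (simp add: field_simps)
    qed
    have "hit p ?\<mu> J b \<le> hit_nonzero p ?\<mu> J b + 1 / real_of_int p"
    proof -
      have "?l \<le> ?\<mu> * real (card J)" using J(2) m0 l1 by (simp add: field_simps mult_left_mono)
      then have "exp (- ?\<mu> * real (card J)) \<le> exp (- ?l)" by simp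
      also have "\<dots> = 1 / real_of_int p" using p3 by (simp add: exp_minus inverse_eq_divide)
      finally show ?thesis using hit_le_hit_nonzero[OF finJ, of ?\<mu> p b] mu by linarith
    qed
    then have "exp (4 * ?\<mu> * (4 ^ a * (2 * ?l))) / 2 ^ a * hit p ?\<mu> J b
       \<le> 3 / 2 ^ a * (hit_nonzero p ?\<mu> J b + 1 / real_of_int p)"
      using e by (intro mult_mono) (auto simp: hit_def)
    also have "\<dots> = 3 / 2 ^ a * (1 / real_of_int p) + 3 / 2 ^ a * hit_nonzero p ?\<mu> J b" by (simp add: algebra_simps)
    also have "\<dots> \<le> 3 * (1 / real_of_int p) + 18 * ?l / sqrt (real m) * hit_nonzero p ?\<mu> J b"
    proof (intro add_mono mult_right_mono K)
      show "(3 :: real) / 2 ^ a \<le> 3" by (simp add: divide_le_eq)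
    qed (use p3 in \<open>auto simp: hit_nonzero_range\<close>)
    finally show ?thesis by simp
  qed
  ultimately show ?thesis using hit_le_abs_cos_mean[OF I p(1) J(1), of b] J(3) by simp
qed

lemma add_power_le:
  fixes x y :: real
  assumes "x \<ge> 0" "y \<ge> 0"
  shows "(x + y) ^ n \<le> 2 ^ n * (x ^ n + y ^ n)"
proof -
  have "(x + y) ^ n \<le> (2 * max x y) ^ n" using assms by (intro power_mono) auto
  also have "\<dots> = 2 ^ n * max x y ^ n" by (simp add: power_mult_distrib)
  also have "max x y ^ n \<le> x ^ n + y ^ n" using assms by (auto simp: max_def)
  finally show ?thesis by simp
qed

text \<open>Splitting the two terms of \<open>hit_le_min_hit\<close> costs \<open>2 ^ n\<close>,
  whence 10 and 36. As \<open>min_hit\<close> is at most 1, its exponent may be lowered from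
  \<open>n\<close> to \<open>card I - m\<close>, where \<open>sum_min_hit_power_le\<close>
  applies.\<close>

lemma sum_hit_power_le:
  fixes p :: int
  assumes I: "finite I" and p: "prime p" "odd p"
    and m: "m \<le> card I" "card I \<le> n" "8 * (ln (real_of_int p))\<^sup>2 \<le> real m"
  shows "(\<Sum>b\<in>PiE I (\<lambda>_. {1..<p}). hit p 1 I b ^ n) \<le>
    10 ^ n * real_of_int p ^ card I / real_of_int p ^ n + (36 * ln (real_of_int p) / sqrt (real m)) ^ n * real_of_int p ^ m"
proof -
  let ?V = "PiE I (\<lambda>_. {0..<p})"
  let ?\<mu> = "ln (real_of_int p) / real m"
  let ?K = "18 * ln (real_of_int p) / sqrt (real m)"
  have p1: "p > 1" using p by (simp add: prime_gt_1_int)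
  have finV: "finite ?V" using I by (intro finite_PiE) auto
  have K0: "?K \<ge> 0" using p1 by simp
  have bnd: "hit p 1 I b ^ n \<le> 2 ^ n * ((5 / real_of_int p) ^ n + ?K ^ n * min_hit p ?\<mu> m I b ^ (card I - m))"
    if b: "b \<in> PiE I (\<lambda>_. {1..<p})" for b
  proof -
    note r = min_hit_range[OF I m(1), of p ?\<mu> b]
    have "\<not> p dvd b j" if "j \<in> I" for j
      using b that by (auto simp: PiE_iff dest!: bspec zdvd_imp_le)
    then have "hit p 1 I b \<le> 5 / real_of_int p + ?K * min_hit p ?\<mu> m I b"
      using m by (intro hit_le_min_hit I p) auto
    then have "hit p 1 I b ^ n \<le> (5 / real_of_int p + ?K * min_hit p ?\<mu> m I b) ^ n"
      by (intro power_mono) (auto simp: hit_def)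
    also have "\<dots> \<le> 2 ^ n * ((5 / real_of_int p) ^ n + (?K * min_hit p ?\<mu> m I b) ^ n)"
      using p1 K0 r by (intro add_power_le) auto
    also have "(?K * min_hit p ?\<mu> m I b) ^ n \<le> ?K ^ n * min_hit p ?\<mu> m I b ^ (card I - m)"
      unfolding power_mult_distrib using m r K0 by (intro mult_left_mono power_decreasing) auto
    finally show ?thesis by simp
  qed
  have "(\<Sum>b\<in>PiE I (\<lambda>_. {1..<p}). hit p 1 I b ^ n) \<le>
     (\<Sum>b\<in>PiE I (\<lambda>_. {1..<p}). 2 ^ n * ((5 / real_of_int p) ^ n + ?K ^ n * min_hit p ?\<mu> m I b ^ (card I - m)))"
    by (rule sum_mono[OF bnd])
  also have "\<dots> \<le> (\<Sum>b\<in>?V. 2 ^ n * ((5 / real_of_int p) ^ n + ?K ^ n * min_hit p ?\<mu> m I b ^ (card I - m)))"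
  proof (rule sum_mono2[OF finV])
    show "PiE I (\<lambda>_. {1..<p}) \<subseteq> ?V" by (rule PiE_mono) auto
  qed (use p1 K0 min_hit_range[OF I m(1)] in simp)
  also have "\<dots> = 2 ^ n * ((5 / real_of_int p) ^ n * real (card ?V) + ?K ^ n * (\<Sum>b\<in>?V. min_hit p ?\<mu> m I b ^ (card I - m)))"
    by (simp add: sum_distrib_left[symmetric] sum.distrib)
  also have "\<dots> \<le> 2 ^ n * ((5 / real_of_int p) ^ n * real (card ?V) + ?K ^ n * real_of_int p ^ m)"
    using sum_min_hit_power_le[OF I p m(1), of ?\<mu>] K0 by (intro mult_left_mono add_left_mono) auto
  also have "real (card ?V) = real_of_int p ^ card I" using I p1 by (simp add: card_PiE)
  also have "2 ^ n * ((5 / real_of_int p) ^ n * real_of_int p ^ card I + ?K ^ n * real_of_int p ^ m) =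
     (2 * 5) ^ n * real_of_int p ^ card I / real_of_int p ^ n + (2 * ?K) ^ n * real_of_int p ^ m"
    unfolding power_mult_distrib power_divide by (simp add: algebra_simps)
  finally show ?thesis by simp
qed

lemma sum_hit_power_le':
  fixes p :: int
  assumes I: "finite I" "I \<noteq> {}" and p: "prime p" "odd p"
  shows "(\<Sum>b\<in>PiE I (\<lambda>_. {1..<p}). hit p 1 I b ^ n) \<le> real_of_int p ^ card I * (3 / 4) ^ n"
proof -
  have p1: "p > 1" using p by (simp add: prime_gt_1_int)
  obtain j where j: "j \<in> I" using I by blast
  have "(\<Sum>b\<in>PiE I (\<lambda>_. {1..<p}). hit p 1 I b ^ n) \<le> (\<Sum>b\<in>PiE I (\<lambda>_. {1..<p}). (3 / 4) ^ n)"
  proof (intro sum_mono power_mono)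
    fix b assume b: "b \<in> PiE I (\<lambda>_. {1..<p})"
    then have "\<not> p dvd b j"
      using j by (auto simp: PiE_iff dest!: bspec zdvd_imp_le)
    from abs_cos_mean_singleton_le[OF p, of b j, OF this] hit_le_abs_cos_mean[OF I(1) p(1), of "{j}" b] j
    show "hit p 1 I b \<le> 3 / 4" by simp
  qed (auto simp: hit_def)
  also have "\<dots> = real_of_int (p - 1) ^ card I * (3 / 4) ^ n" using I p1 by (simp add: card_PiE)
  also have "\<dots> \<le> real_of_int p ^ card I * (3 / 4) ^ n" using p1 by (intro mult_right_mono power_mono) auto
  finally show ?thesis .
qed

section \<open>Linear dependence and the union bound\<close>

lemma cols_indep_iff:
  assumes S: "S \<subseteq> {..<dim_col M}"
  shows "cols_indep M S \<longleftrightarrow> (\<forall>x. (\<forall>i<dim_row M. (\<Sum>j\<in>S. M $$ (i, j) * x j) = 0) \<longrightarrow> (\<forall>j\<in>S. x j = 0))"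
    (is "_ \<longleftrightarrow> ?R")
proof -
  interpret vec_space "TYPE(real)" "dim_row M" .
  have fin: "finite S" using S finite_subset by blast
  have sub: "col M ` S \<subseteq> carrier_vec (dim_row M)" by auto
  have idx: "col M j $ i = M $$ (i, j)" if "j \<in> S" "i < dim_row M" for i j
    using that S by (intro index_col) auto
  show ?thesis
  proof
    assume ci: "cols_indep M S"
    then have inj: "inj_on (col M) S" and li: "\<not> lin_dep (col M ` S)" unfolding cols_indep_def by auto
    show ?R
    proof (intro allI impI ballI)
      fix x j assume x: "\<forall>i<dim_row M. (\<Sum>j\<in>S. M $$ (i, j) * x j) = 0" and j: "j \<in> S"
      define a where "a v = x (the_inv_into S (col M) v)" for v
      have a: "a (col M k) = x k" if "k \<in> S" for k using that inj by (simp add: a_def the_inv_into_f_f)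
      have "lincomb a (col M ` S) = 0\<^sub>v (dim_row M)"
      proof (rule eq_vecI)
        fix i assume "i < dim_vec (0\<^sub>v (dim_row M) :: real vec)"
        then have i: "i < dim_row M" by simp
        have "lincomb a (col M ` S) $ i = (\<Sum>j\<in>S. a (col M j) * col M j $ i)"
          by (simp add: lincomb_index[OF i sub] sum.reindex[OF inj])
        also have "\<dots> = (\<Sum>j\<in>S. M $$ (i, j) * x j)"
          using i by (intro sum.cong) (simp_all add: a idx)
        finally show "lincomb a (col M ` S) $ i = 0\<^sub>v (dim_row M) $ i" using x i by simp
      qed (use fin sub lincomb_dim in auto)
      then show "x j = 0"
        using lin_dep_crit[of "col M ` S" "col M ` S" "col M j" a] fin j li a by auto
    qed
  next
    assume R: ?R
    have inj: "inj_on (col M) S"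
    proof (rule inj_onI, rule ccontr)
      fix j k assume jk: "j \<in> S" "k \<in> S" "col M j = col M k" "j \<noteq> k"
      define x :: "nat \<Rightarrow> real" where "x l = (if l = j then 1 else 0) - (if l = k then 1 else 0)" for l
      have "(\<Sum>l\<in>S. M $$ (i, l) * x l) = 0" if "i < dim_row M" for i
      proof -
        have "(\<Sum>l\<in>S. M $$ (i, l) * x l) = M $$ (i, j) - M $$ (i, k)"
          unfolding x_def right_diff_distrib sum_subtractf using fin jk by (simp add: if_distrib sum.delta cong: if_cong)
        then show ?thesis using idx[OF jk(1) that] idx[OF jk(2) that] jk(3) by simp
      qed
      with R jk(1) have "x j = 0" by blast
      with jk(4) show False by (simp add: x_def)
    qed
    moreover have "\<not> lin_dep (col M ` S)"
    proof (rule finite_lin_indpt2)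
      fix a assume a: "lincomb a (col M ` S) = 0\<^sub>v (dim_row M)"
      have rel: "\<forall>i<dim_row M. (\<Sum>j\<in>S. M $$ (i, j) * a (col M j)) = 0"
      proof (intro allI impI)
        fix i assume i: "i < dim_row M"
        have "(\<Sum>j\<in>S. M $$ (i, j) * a (col M j)) = (\<Sum>j\<in>S. a (col M j) * col M j $ i)"
          using i by (intro sum.cong) (simp_all add: idx)
        also have "\<dots> = lincomb a (col M ` S) $ i"
          by (simp add: lincomb_index[OF i sub] sum.reindex[OF inj])
        finally show "(\<Sum>j\<in>S. M $$ (i, j) * a (col M j)) = 0" using a i by simp
      qed
      have "\<forall>j\<in>S. a (col M j) = 0" by (rule mp[OF spec[OF R, of "\<lambda>j. a (col M j)"] rel])
      then show "\<forall>v\<in>col M ` S. a v = 0" by (intro ballI) (elim imageE, simp)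
    qed (use fin sub in auto)
    ultimately show "cols_indep M S" unfolding cols_indep_def by simp
  qed
qed

text \<open>A real relation between integer columns yields an integer one by simultaneous Diophantine
  approximation; after division by the gcd it stays nonzero modulo \<open>p\<close>.\<close>
lemma real_relation_imp_integer_relation:
  fixes A :: "nat \<Rightarrow> nat \<Rightarrow> int" and x :: "nat \<Rightarrow> real"
  assumes S: "finite S" and A: "\<And>i j. i < n \<Longrightarrow> j \<in> S \<Longrightarrow> \<bar>A i j\<bar> \<le> 1"
    and x: "\<And>i. i < n \<Longrightarrow> (\<Sum>j\<in>S. real_of_int (A i j) * x j) = 0" and k: "k \<in> S" "x k \<noteq> 0"
  obtains r where "r k \<noteq> 0" "\<And>i. i < n \<Longrightarrow> (\<Sum>j\<in>S. A i j * r j) = 0"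
proof -
  \<comment> \<open>With an error below \<open>1 / N\<close> in each of the \<open>card S\<close>
    entries, every row sum of the rounded vector is an integer of absolute value below 1.\<close>
  define N where "N = card S + 1"
  obtain D where D: "\<And>j. j \<in> S \<Longrightarrow> j < D" using S by (metis finite_nat_set_iff_bounded)
  \<comment> \<open>Normalised to \<open>y k = 1\<close>, so that \<open>r k = 0\<close> would force
    \<open>q < 1\<close>.\<close>
  define y where "y j = x j / x k" for j
  have N0: "N > 0" by (simp add: N_def)
  obtain q r where q: "0 < q" and r: "\<And>j. j < D \<Longrightarrow> \<bar>of_int q * y j - of_int (r j)\<bar> < 1 / N"
    using Dirichlet_approx_simult[OF N0, of D y] by metis
  have y: "(\<Sum>j\<in>S. real_of_int (A i j) * y j) = 0" if "i < n" for i
    using x[OF that] by (simp add: y_def sum_divide_distrib[symmetric])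
  have "r k \<noteq> 0"
  proof
    assume "r k = 0"
    then have "\<bar>real_of_int q\<bar> < 1 / N" using r[OF D[OF k(1)]] k by (simp add: y_def)
    moreover have "1 / real N \<le> 1" using N0 by simp
    ultimately have "real_of_int q < 1" by linarith
    with q show False by simp
  qed
  moreover have "(\<Sum>j\<in>S. A i j * r j) = 0" if i: "i < n" for i
  proof -
    have "real_of_int (\<Sum>j\<in>S. A i j * r j) = (\<Sum>j\<in>S. real_of_int (A i j) * (real_of_int (r j) - of_int q * y j))"
      using y[OF i] by (simp add: right_diff_distrib sum_subtractf sum_distrib_left[symmetric] mult.left_commute)
    also have "\<bar>\<dots>\<bar> \<le> (\<Sum>j\<in>S. \<bar>real_of_int (A i j) * (real_of_int (r j) - of_int q * y j)\<bar>)" by (rule sum_abs)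
    also have "\<dots> \<le> (\<Sum>j\<in>S. 1 * (1 / N))"
      unfolding abs_mult
    proof (intro sum_mono mult_mono)
      fix j assume j: "j \<in> S"
      show "\<bar>real_of_int (A i j)\<bar> \<le> 1" using A[OF i j] by linarith
      show "\<bar>real_of_int (r j) - of_int q * y j\<bar> \<le> 1 / N" using r[OF D[OF j]] by linarith
    qed auto
    also have "\<dots> < 1" by (simp add: N_def)
    finally show ?thesis by linarith
  qed
  ultimately show thesis using that by blast
qed

text \<open>Restriction to the support \<open>T\<close> modulo \<open>p\<close> leaves only nonzero
  residues, as the level-set estimates require; the price is that \<open>T\<close> can be any
  nonempty subset of \<open>S\<close>.\<close>

lemma integer_relation_imp_relation_mod:
  fixes A :: "nat \<Rightarrow> nat \<Rightarrow> int" and p :: int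
  assumes S: "finite S" and p: "prime p" and k: "k \<in> S" "r k \<noteq> 0"
    and r: "\<And>i. i < n \<Longrightarrow> (\<Sum>j\<in>S. A i j * r j) = 0"
  shows "\<exists>T\<subseteq>S. T \<noteq> {} \<and> (\<exists>b\<in>PiE T (\<lambda>_. {1..<p}). \<forall>i<n. p dvd (\<Sum>j\<in>T. A i j * b j))"
proof -
  have p0: "p > 0" using p by (simp add: prime_gt_0_int)
  define g where "g = Gcd (r ` S)"
  have g0: "g \<noteq> 0" using k unfolding g_def by auto
  define w where "w j = r j div g" for j
  have rw: "r j = g * w j" if "j \<in> S" for j using that by (simp add: w_def g_def)
  have w0: "(\<Sum>j\<in>S. A i j * w j) = 0" if "i < n" for i
  proof -
    have "g * (\<Sum>j\<in>S. A i j * w j) = (\<Sum>j\<in>S. A i j * r j)"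
      unfolding sum_distrib_left by (intro sum.cong) (simp_all add: rw)
    then show ?thesis using r[OF that] g0 by simp
  qed
  define T where "T = {j\<in>S. \<not> p dvd w j}"
  have "T \<noteq> {}"
  proof
    assume "T = {}"
    then have "p * g dvd r j" if "j \<in> S" for j
      using that rw[OF that] by (auto simp: T_def mult.commute[of p])
    then have "p * g dvd g" unfolding g_def by (intro Gcd_greatest) auto
    then have "p dvd 1" using g0 by (metis dvd_mult_cancel_right mult_1)
    with p show False by (metis not_prime_unit)
  qed
  moreover have "T \<subseteq> S" by (auto simp: T_def)
  moreover define b where "b = restrict (\<lambda>j. w j mod p) T"
  have "b \<in> PiE T (\<lambda>_. {1..<p})"
  proof -
    have "w j mod p \<ge> 1 \<and> w j mod p < p" if "j \<in> T" for j
      using that p0 pos_mod_sign[of p "w j"] by (auto simp: T_def dvd_eq_mod_eq_0 simp del: pos_mod_sign)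
    then show ?thesis by (auto simp: b_def)
  qed
  moreover have "p dvd (\<Sum>j\<in>T. A i j * b j)" if "i < n" for i
  proof -
    have "p dvd (\<Sum>j\<in>T. A i j * b j) - (\<Sum>j\<in>T. A i j * w j)"
      unfolding sum_subtractf[symmetric] right_diff_distrib[symmetric]
      by (intro dvd_sum dvd_mult) (simp add: b_def mod_eq_dvd_iff[symmetric])
    moreover have "p dvd (\<Sum>j\<in>S - T. A i j * w j)" by (intro dvd_sum dvd_mult) (auto simp: T_def)
    moreover have "(\<Sum>j\<in>S. A i j * w j) = (\<Sum>j\<in>S - T. A i j * w j) + (\<Sum>j\<in>T. A i j * w j)"
      using \<open>T \<subseteq> S\<close> S by (rule sum.subset_diff)
    ultimately show ?thesis using w0[OF that]
      by (metis (no_types, lifting) add_diff_cancel_left' diff_add_cancel dvd_add dvd_add_right_iff dvd_0_right)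
  qed
  ultimately show ?thesis by blast
qed

lemma not_cols_indep_imp_relation_mod:
  fixes c :: "nat \<times> nat \<Rightarrow> int" and p :: int
  assumes S: "S \<subseteq> {..<d}" and c: "\<And>i j. i < n \<Longrightarrow> j < d \<Longrightarrow> \<bar>c (i, j)\<bar> \<le> 1" and p: "prime p"
    and nc: "\<not> cols_indep (mat n d (\<lambda>ij. real_of_int (c ij))) S"
  shows "\<exists>T\<subseteq>S. T \<noteq> {} \<and> (\<exists>b\<in>PiE T (\<lambda>_. {1..<p}). \<forall>i<n. p dvd (\<Sum>j\<in>T. c (i, j) * b j))"
proof -
  let ?M = "mat n d (\<lambda>ij. real_of_int (c ij))"
  have fin: "finite S" using S finite_subset by blast
  obtain x k where x: "\<And>i. i < n \<Longrightarrow> (\<Sum>j\<in>S. ?M $$ (i, j) * x j) = 0" and k: "k \<in> S" "x k \<noteq> 0"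
    using nc cols_indep_iff[of S ?M] S by auto
  have x': "(\<Sum>j\<in>S. real_of_int (c (i, j)) * x j) = 0" if "i < n" for i
  proof -
    have "(\<Sum>j\<in>S. real_of_int (c (i, j)) * x j) = (\<Sum>j\<in>S. ?M $$ (i, j) * x j)"
      using that S by (intro sum.cong) auto
    with x[OF that] show ?thesis by simp
  qed
  have cS: "\<bar>c (i, j)\<bar> \<le> 1" if "i < n" "j \<in> S" for i j using that c S by auto
  obtain r where r: "r k \<noteq> 0" "\<And>i. i < n \<Longrightarrow> (\<Sum>j\<in>S. c (i, j) * r j) = 0"
  proof (rule real_relation_imp_integer_relation[where n = n and A = "\<lambda>i j. c (i, j)" and x = x, OF fin])
    fix r assume "r k \<noteq> 0" "\<And>i. i < n \<Longrightarrow> (\<Sum>j\<in>S. c (i, j) * r j) = 0"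
    then show thesis by (rule that)
  qed (use cS x' k in auto)
  show ?thesis
    by (rule integer_relation_imp_relation_mod[OF fin p k(1) r])
qed

section \<open>Independent rows of the random sign matrix\<close>

lemma random_sign_mat_eq:
  "random_sign_mat n d = map_pmf (\<lambda>c. mat n d (\<lambda>ij. real_of_int (c ij))) (lazy_vec 1 ({..<n} \<times> {..<d}))"
proof -
  have "map_pmf real_of_int (pmf_of_set {-1, 1}) = pmf_of_set {-1, 1}"
    by (subst map_pmf_of_set_inj) auto
  then have "Pi_pmf ({..<n} \<times> {..<d}) 0 (\<lambda>_. pmf_of_set {-1, 1}) =
     map_pmf (\<lambda>h. real_of_int \<circ> h) (lazy_vec 1 ({..<n} \<times> {..<d}))"
    unfolding lazy_vec_def lazy_sign_1
    using Pi_pmf_map[of "{..<n} \<times> {..<d}" real_of_int 0 0 "\<lambda>_. pmf_of_set {-1, 1}"] by simp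
  then show ?thesis unfolding random_sign_mat_def by (simp add: map_pmf_comp o_def)
qed

lemma prob_pair_pmf_Times:
  "measure_pmf.prob (pair_pmf M N) (A \<times> B) = measure_pmf.prob M A * measure_pmf.prob N B"
proof -
  have "measure_pmf.prob (pair_pmf M N) (A \<times> B) = measure_pmf.prob (pair_pmf M N) ((A \<inter> set_pmf M) \<times> (B \<inter> set_pmf N))"
    by (subst measure_Int_set_pmf[symmetric]) (auto intro: arg_cong[of _ _ "measure_pmf.prob _"])
  also have "\<dots> = measure_pmf.prob M (A \<inter> set_pmf M) * measure_pmf.prob N (B \<inter> set_pmf N)"
    by (intro measure_pmf_prob_product) (auto intro: countable_subset[OF Int_lower2])
  finally show ?thesis by (simp only: measure_Int_set_pmf)
qed

lemma prob_rows:
  assumes D: "finite D" and Q: "\<And>g g'. (\<And>j. j \<in> D \<Longrightarrow> g j = g' j) \<Longrightarrow> Q g = Q g'"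
  shows "measure_pmf.prob (lazy_vec \<mu> ({..<n :: nat} \<times> D)) {c. \<forall>i<n. Q (\<lambda>j. c (i, j))} =
    measure_pmf.prob (lazy_vec \<mu> D) {g. Q g} ^ n"
proof (induction n)
  case 0
  then show ?case by simp
next
  case (Suc n)
  let ?A = "{..<n} \<times> D" and ?B = "{n} \<times> D"
  have AB: "{..<Suc n} \<times> D = ?A \<union> ?B" by auto
  have "lazy_vec \<mu> ({..<Suc n} \<times> D) = map_pmf (\<lambda>(f, g) x. if x \<in> ?A then f x else g x) (pair_pmf (lazy_vec \<mu> ?A) (lazy_vec \<mu> ?B))"
    unfolding AB lazy_vec_def using D by (intro Pi_pmf_union) auto
  moreover have "(\<lambda>(f, g) x. if x \<in> ?A then f x else g x) -` {c. \<forall>i<Suc n. Q (\<lambda>j. c (i, j))} =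
     {c. \<forall>i<n. Q (\<lambda>j. c (i, j))} \<times> {c. Q (\<lambda>j. c (n, j))}"
  proof -
    have "Q (\<lambda>j. if (i, j) \<in> ?A then f (i, j) else g (i, j)) = Q (\<lambda>j. f (i, j))" if "i < n" for i f g
      using that by (intro Q) auto
    moreover have "Q (\<lambda>j. if (n, j) \<in> ?A then f (n, j) else g (n, j)) = Q (\<lambda>j. g (n, j))" for f g
      by (intro Q) auto
    ultimately show ?thesis by (auto simp: less_Suc_eq)
  qed
  ultimately have "measure_pmf.prob (lazy_vec \<mu> ({..<Suc n} \<times> D)) {c. \<forall>i<Suc n. Q (\<lambda>j. c (i, j))} =
     measure_pmf.prob (lazy_vec \<mu> ?A) {c. \<forall>i<n. Q (\<lambda>j. c (i, j))} * measure_pmf.prob (lazy_vec \<mu> ?B) {c. Q (\<lambda>j. c (n, j))}"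
    by (simp only: measure_map_pmf prob_pair_pmf_Times)
  moreover have "lazy_vec \<mu> D = map_pmf (\<lambda>g. g \<circ> Pair n) (lazy_vec \<mu> ?B)"
    unfolding lazy_vec_def using D by (intro Pi_pmf_bij_betw) (auto simp: bij_betw_def inj_on_def)
  then have "measure_pmf.prob (lazy_vec \<mu> D) {g. Q g} = measure_pmf.prob (lazy_vec \<mu> ?B) {c. Q (\<lambda>j. c (n, j))}"
    by (simp add: vimage_def o_def)
  ultimately show ?case using Suc by simp
qed

lemma prob_lazy_vec_subset:
  assumes "finite D" "S \<subseteq> D" and Q: "\<And>g g'. (\<And>j. j \<in> S \<Longrightarrow> g j = g' j) \<Longrightarrow> Q g = Q g'"
  shows "measure_pmf.prob (lazy_vec \<mu> D) {g. Q g} = measure_pmf.prob (lazy_vec \<mu> S) {g. Q g}"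
proof -
  have "lazy_vec \<mu> S = map_pmf (\<lambda>f x. if x \<in> S then f x else 0) (lazy_vec \<mu> D)"
    unfolding lazy_vec_def using assms by (intro Pi_pmf_subset)
  moreover have "Q (\<lambda>x. if x \<in> S then f x else 0) = Q f" for f by (intro Q) auto
  ultimately show ?thesis by (simp add: vimage_def)
qed

lemma prob_relation_all_rows:
  fixes d n :: nat
  assumes "S \<subseteq> {..<d}"
  shows "measure_pmf.prob (lazy_vec 1 ({..<n} \<times> {..<d})) {c. \<forall>i<n. p dvd (\<Sum>j\<in>S. c (i, j) * b j)} = hit p 1 S b ^ n"
proof -
  have Q: "(p dvd (\<Sum>j\<in>S. g j * b j)) = (p dvd (\<Sum>j\<in>S. g' j * b j))" if "\<And>j. j \<in> S \<Longrightarrow> g j = g' j" for g g'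
    using that by (metis (no_types, lifting) sum.cong)
  have "measure_pmf.prob (lazy_vec 1 ({..<n} \<times> {..<d})) {c. \<forall>i<n. p dvd (\<Sum>j\<in>S. c (i, j) * b j)} =
     measure_pmf.prob (lazy_vec 1 {..<d}) {g. p dvd (\<Sum>j\<in>S. g j * b j)} ^ n"
    using assms by (intro prob_rows[where Q = "\<lambda>g. p dvd (\<Sum>j\<in>S. g j * b j)"] Q) auto
  also have "measure_pmf.prob (lazy_vec 1 {..<d}) {g. p dvd (\<Sum>j\<in>S. g j * b j)} = hit p 1 S b"
    unfolding hit_def using assms by (intro prob_lazy_vec_subset Q) auto
  finally show ?thesis .
qed

section \<open>The union bound over supports and residue vectors\<close>

lemma sum_over_subsets_by_card:
  fixes f :: "nat \<Rightarrow> real"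
  shows "(\<Sum>T\<in>{T. T \<subseteq> {..<d} \<and> 1 \<le> card T \<and> card T \<le> s}. f (card T)) = (\<Sum>k=1..s. real (d choose k) * f k)"
proof -
  let ?F = "\<lambda>k. {T. T \<subseteq> {..<d} \<and> card T = k}"
  have "{T. T \<subseteq> {..<d} \<and> 1 \<le> card T \<and> card T \<le> s} = (\<Union>k\<in>{1..s}. ?F k)" by auto
  then have "(\<Sum>T\<in>{T. T \<subseteq> {..<d} \<and> 1 \<le> card T \<and> card T \<le> s}. f (card T)) = (\<Sum>k=1..s. \<Sum>T\<in>?F k. f (card T))"
    by (simp only:) (rule sum.UNION_disjoint, auto)
  also have "\<dots> = (\<Sum>k=1..s. real (d choose k) * f k)"
    by (intro sum.cong refl) (simp add: n_subsets)
  finally show ?thesis .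
qed

lemma prob_not_robust_le:
  fixes p :: int
  assumes p: "prime p" "odd p" and m: "8 * (ln (real_of_int p))\<^sup>2 \<le> real m" and s: "s \<le> n"
  shows "measure_pmf.prob (random_sign_mat n d) {M. \<not> robust s M} \<le>
    (\<Sum>k=1..s. real (d choose k) * (if k < m then real_of_int p ^ k * (3 / 4) ^ n
       else 10 ^ n * real_of_int p ^ k / real_of_int p ^ n + (36 * ln (real_of_int p) / sqrt (real m)) ^ n * real_of_int p ^ m))"
proof -
  let ?L = "lazy_vec 1 ({..<n} \<times> {..<d})"
  let ?F = "{T. T \<subseteq> {..<d} \<and> 1 \<le> card T \<and> card T \<le> s}"
  let ?E = "\<lambda>T b. {c. \<forall>i<n. p dvd (\<Sum>j\<in>T. c (i, j) * b j)}"
  have finF: "finite ?F" by (rule finite_subset[of _ "Pow {..<d}"]) auto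
  have finV: "finite (PiE T (\<lambda>_. {1..<p}))" if "T \<in> ?F" for T
    using that by (intro finite_PiE) (auto intro: finite_subset)
  have "measure_pmf.prob (random_sign_mat n d) {M. \<not> robust s M} =
     measure_pmf.prob ?L {c. \<not> robust s (mat n d (\<lambda>ij. real_of_int (c ij)))}"
    unfolding random_sign_mat_eq by (simp add: vimage_def)
  \<comment> \<open>Inside the support of the distribution all entries are bounded by 1, which the
    passage to an integer relation needs.\<close>
  also have "\<dots> = measure_pmf.prob ?L ({c. \<not> robust s (mat n d (\<lambda>ij. real_of_int (c ij)))} \<inter> set_pmf ?L)"
    by (simp only: measure_Int_set_pmf)
  also have "\<dots> \<le> measure_pmf.prob ?L (\<Union>T\<in>?F. \<Union>b\<in>PiE T (\<lambda>_. {1..<p}). ?E T b)"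
  proof (intro measure_pmf.finite_measure_mono subsetI)
    fix c assume c: "c \<in> {c. \<not> robust s (mat n d (\<lambda>ij. real_of_int (c ij)))} \<inter> set_pmf ?L"
    have "\<bar>c ij\<bar> \<le> 1" for ij
    proof -
      have "c \<in> PiE_dflt ({..<n} \<times> {..<d}) 0 (\<lambda>_. set_pmf (lazy_sign 1))"
        using c unfolding lazy_vec_def by (subst (asm) set_Pi_pmf) auto
      then have "c ij = 0 \<or> c ij \<in> set_pmf (lazy_sign 1)" by (cases ij) (auto simp: PiE_dflt_def)
      then have "c ij \<in> {-1, 0, 1}" using set_lazy_sign[of 1] by auto
      then show ?thesis by auto
    qed
    moreover obtain S where S: "S \<subseteq> {..<d}" "card S = s" "\<not> cols_indep (mat n d (\<lambda>ij. real_of_int (c ij))) S"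
      using c by (auto simp: robust_def)
    ultimately obtain T b where T: "T \<subseteq> S" "T \<noteq> {}" "b \<in> PiE T (\<lambda>_. {1..<p})" "\<forall>i<n. p dvd (\<Sum>j\<in>T. c (i, j) * b j)"
      using not_cols_indep_imp_relation_mod[OF S(1) _ p(1) S(3)] by blast
    have finS: "finite S" using S finite_subset by blast
    then have "T \<in> ?F" using T(1,2) S card_mono[OF finS T(1)] finite_subset[OF T(1) finS]
      by (auto simp: Suc_le_eq card_gt_0_iff)
    then show "c \<in> (\<Union>T\<in>?F. \<Union>b\<in>PiE T (\<lambda>_. {1..<p}). ?E T b)" using T by blast
  qed auto
  also have "\<dots> \<le> (\<Sum>T\<in>?F. measure_pmf.prob ?L (\<Union>b\<in>PiE T (\<lambda>_. {1..<p}). ?E T b))"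
    using finF by (intro measure_UNION_le) auto
  also have "\<dots> \<le> (\<Sum>T\<in>?F. \<Sum>b\<in>PiE T (\<lambda>_. {1..<p}). measure_pmf.prob ?L (?E T b))"
    using finV by (intro sum_mono measure_UNION_le) auto
  also have "\<dots> = (\<Sum>T\<in>?F. \<Sum>b\<in>PiE T (\<lambda>_. {1..<p}). hit p 1 T b ^ n)"
    by (intro sum.cong refl prob_relation_all_rows) auto
  also have "\<dots> \<le> (\<Sum>T\<in>?F. if card T < m then real_of_int p ^ card T * (3 / 4) ^ n
       else 10 ^ n * real_of_int p ^ card T / real_of_int p ^ n + (36 * ln (real_of_int p) / sqrt (real m)) ^ n * real_of_int p ^ m)"
  proof (intro sum_mono)
    fix T assume T: "T \<in> ?F"
    then have "finite T" "T \<noteq> {}" by (auto intro: finite_subset)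
    then show "(\<Sum>b\<in>PiE T (\<lambda>_. {1..<p}). hit p 1 T b ^ n) \<le> (if card T < m then real_of_int p ^ card T * (3 / 4) ^ n
       else 10 ^ n * real_of_int p ^ card T / real_of_int p ^ n + (36 * ln (real_of_int p) / sqrt (real m)) ^ n * real_of_int p ^ m)"
      using sum_hit_power_le[of T p m n] sum_hit_power_le'[of T p n] p m T s by auto
  qed
  also have "\<dots> = (\<Sum>k=1..s. real (d choose k) * (if k < m then real_of_int p ^ k * (3 / 4) ^ n
       else 10 ^ n * real_of_int p ^ k / real_of_int p ^ n + (36 * ln (real_of_int p) / sqrt (real m)) ^ n * real_of_int p ^ m))"
    by (rule sum_over_subsets_by_card)
  finally show ?thesis .
qed

section \<open>Robustness below the threshold\<close>

text \<open>In other words, \<open>n powr \<epsilon>\<close> eventually exceeds every fixed power of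
  \<open>ln n\<close>; this absorbs all logarithmic losses.\<close>

lemma eventually_eps_ge:
  fixes \<epsilon> :: "nat \<Rightarrow> real"
  assumes "filterlim (\<lambda>n. \<epsilon> n * ln (real n) / ln (ln (real n))) at_top sequentially"
  shows "\<forall>\<^sub>F n in sequentially. \<epsilon> n * ln (real n) \<ge> B * ln (ln (real n))"
proof -
  have "\<forall>\<^sub>F n in sequentially. B \<le> \<epsilon> n * ln (real n) / ln (ln (real n))"
    using assms by (simp add: filterlim_at_top)
  moreover have "\<forall>\<^sub>F n :: nat in sequentially. 0 < ln (ln (real n))" by real_asymp
  ultimately show ?thesis by eventually_elim (simp add: field_simps)
qed

lemma nat_ceiling_bounds:
  fixes x :: real
  assumes "x \<ge> 0"
  shows "x \<le> real (nat \<lceil>x\<rceil>)" "real (nat \<lceil>x\<rceil>) \<le> x + 1"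
proof -
  have "real (nat \<lceil>x\<rceil>) = real_of_int \<lceil>x\<rceil>" using assms by simp
  then show "x \<le> real (nat \<lceil>x\<rceil>)" "real (nat \<lceil>x\<rceil>) \<le> x + 1" using ceiling_correct[of x] by linarith+
qed

lemma binomial_le_exp_power:
  assumes "k \<ge> 1"
  shows "real (d choose k) \<le> (exp 1 * real d / real k) ^ k"
proof -
  have "(d choose k) * fact k \<le> d ^ k" by (rule binomial_fact_pow)
  then have "real ((d choose k) * fact k) \<le> real (d ^ k)" by (simp only: of_nat_le_iff)
  then have 1: "real (d choose k) * fact k \<le> real d ^ k" by simp
  \<comment> \<open>A single term of the exponential series yields
    \<open>k ^ k \<le> exp k * fact k\<close>.\<close>
  have "(\<Sum>i\<in>{k}. real k ^ i /\<^sub>R fact i) \<le> (\<Sum>i. real k ^ i /\<^sub>R fact i)"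
    using exp_converges[of "real k"] by (intro sum_le_suminf) (auto simp: sums_iff)
  also have "\<dots> = exp (real k)" using exp_converges[of "real k"] by (simp add: sums_iff)
  finally have "real k ^ k \<le> exp (real k) * fact k" by (simp add: field_simps)
  then have "real (d choose k) * real k ^ k \<le> real (d choose k) * (exp (real k) * fact k)" by (intro mult_left_mono) auto
  also have "\<dots> = exp (real k) * (real (d choose k) * fact k)" by simp
  also have "\<dots> \<le> exp (real k) * real d ^ k" using 1 by (intro mult_left_mono) auto
  also have "exp (real k) = exp 1 ^ k" by (simp add: exp_of_nat_mult[symmetric])
  finally show ?thesis using assms by (simp add: power_divide power_mult_distrib field_simps)
qed

lemma binomial_le_power_real: "real (d choose k) \<le> real d ^ k"
proof -
  have "(d choose k) * 1 \<le> (d choose k) * fact k" by (rule mult_left_mono) (simp_all add: fact_ge_1)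
  also have "\<dots> \<le> d ^ k" by (rule binomial_fact_pow)
  finally have "real (d choose k) \<le> real (d ^ k)" by (simp only: of_nat_le_iff mult_1_right)
  then show ?thesis by simp
qed

text \<open>\<open>?E1\<close> belongs to the supports below \<open>m\<close>. \<open>?E2\<close> is
  the part of order \<open>1 / p\<close>: since \<open>n - k \<ge> \<delta> * n\<close>, the lower
  bound on \<open>p\<close> gives a factor \<open>n powr (- (D + 1) * n)\<close> against at most
  \<open>n powr (D * n)\<close> supports. \<open>?E3\<close> is the main part: \<open>B\<close>
  solves \<open>(1 - \<delta>) * (2 - B) = - 3\<close>, so, up to constants to the power
  \<open>n\<close>, the supports number at most \<open>n powr (n / 2) / L ^ (3 * n)\<close>, while
  Halasz's bound loses only \<open>L ^ (2 * n)\<close> against \<open>n powr (- n / 2)\<close>: one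
  \<open>L\<close> from \<open>ln p\<close> and one from \<open>sqrt m\<close>.\<close>

lemma union_bound_terms:
  fixes n d k s m :: nat and p :: int and \<delta> L C1 \<alpha> D B :: real
  assumes \<delta>: "0 < \<delta>" "\<delta> < 1" and \<alpha>: "\<alpha> = 1 / (2 - 2 * \<delta>)" and D: "D = 1 + \<alpha>" and B: "B = 2 + 3 / (1 - \<delta>)"
    and L: "L = ln (real n)" "L \<ge> 1" "1 + L / 2 - 3 * ln L \<ge> 0"
    and d: "real d \<le> exp (D * L - B * ln L)"
    and p: "exp ((D + 1) / \<delta> * L) \<le> real_of_int p" "ln (real_of_int p) \<le> C1 * L"
    and C1: "C1 \<ge> 1"
    and m: "real n / L\<^sup>2 \<le> real m" "real m \<le> real n / L\<^sup>2 + 1"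
    and k: "1 \<le> k" "k \<le> s" and s: "real s \<le> (1 - \<delta>) * real n"
  shows "real (d choose k) * (if k < m then real_of_int p ^ k * (3 / 4) ^ n
       else 10 ^ n * real_of_int p ^ k / real_of_int p ^ n + (36 * ln (real_of_int p) / sqrt (real m)) ^ n * real_of_int p ^ m)
     \<le> exp ((D + C1) * L * (real n / L\<^sup>2 + 1) + real n * ln (3 / 4)) + exp (real n * ln 10 - L * real n)
       + exp (real n * (1 + ln (36 * C1) - ln L + C1 / L) + C1 * L)"
    (is "_ \<le> ?E1 + ?E2 + ?E3")
proof -
  have \<alpha>0: "\<alpha> > 0" "\<alpha> * (1 - \<delta>) = 1 / 2" using \<delta> unfolding \<alpha> by (simp_all add: field_simps)
  have D1: "D > 1" using \<alpha>0 by (simp add: D)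
  have lnL: "ln L \<ge> 0" using L(2) by simp
  have n0: "real n > 0" using L by (cases "n = 0") auto
  have nL: "real n = exp L" using L n0 by simp
  have p1: "real_of_int p \<ge> 1"
  proof -
    have "0 \<le> (D + 1) / \<delta> * L" using D1 \<delta> L(2) by simp
    then have "1 \<le> exp ((D + 1) / \<delta> * L)" by simp
    with p(1) show ?thesis by linarith
  qed
  have pe: "real_of_int p = exp (ln (real_of_int p))" using p1 by simp
  have pub: "real_of_int p \<le> exp (C1 * L)" using p(2) by (subst pe) simp
  have "B \<ge> 0" using \<delta> by (simp add: B)
  then have "exp (D * L - B * ln L) \<le> exp (D * L)" using lnL by simp
  with d have dub: "real d \<le> exp (D * L)" by linarith
  have kn: "real k \<le> (1 - \<delta>) * real n" using k s by linarith
  also have "\<dots> \<le> 1 * real n" using \<delta> by (intro mult_right_mono) auto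
  finally have kn': "k \<le> n" "real k \<le> real n" by simp_all
  have m0: "real m > 0" using m(1) n0 L(2) by (smt (verit) divide_pos_pos zero_less_power)
  show ?thesis
  proof (cases "k < m")
    case True
    have "real (d choose k) * (real_of_int p ^ k * (3 / 4) ^ n) \<le> exp (D * L) ^ k * (exp (C1 * L) ^ k * (3 / 4) ^ n)"
      using dub pub p1 by (intro mult_mono power_mono order_trans[OF binomial_le_power_real]) auto
    also have "\<dots> = exp (real k * ((D + C1) * L) + real n * ln (3 / 4))"
      
      by (simp add: exp_add exp_of_nat_mult distrib_right distrib_left power_mult_distrib mult.assoc)
    also have "\<dots> \<le> ?E1"
    proof -
      have "real k \<le> real n / L\<^sup>2 + 1" using True m(2) by linarith
      then have "real k * ((D + C1) * L) \<le> (real n / L\<^sup>2 + 1) * ((D + C1) * L)"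
        using D1 C1 L(2) by (intro mult_right_mono) auto
      then show ?thesis by (simp add: mult_ac)
    qed
    finally have "real (d choose k) * (real_of_int p ^ k * (3 / 4) ^ n) \<le> ?E1" .
    moreover have "?E2 \<ge> 0" "?E3 \<ge> 0" by simp_all
    ultimately show ?thesis unfolding if_P[OF True] by linarith
  next
    case False
    have "real (d choose k) * (10 ^ n * real_of_int p ^ k / real_of_int p ^ n) \<le> ?E2"
    proof -
      have "real_of_int p ^ k / real_of_int p ^ n = 1 / real_of_int p ^ (n - k)"
        using p1 kn' by (simp add: power_diff)
      also have "\<dots> \<le> 1 / exp ((D + 1) / \<delta> * L) ^ (n - k)"
        using p(1) p1 by (intro divide_left_mono power_mono mult_pos_pos zero_less_power) auto
      also have "\<dots> = exp (- (real (n - k) * ((D + 1) / \<delta> * L)))"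
        by (simp only: exp_minus exp_of_nat_mult inverse_eq_divide)
      also have "\<dots> \<le> exp (- (\<delta> * real n * ((D + 1) / \<delta> * L)))"
      proof -
        have "\<delta> * real n \<le> real (n - k)" using kn by (simp add: of_nat_diff[OF kn'(1)] algebra_simps)
        then have "\<delta> * real n * ((D + 1) / \<delta> * L) \<le> real (n - k) * ((D + 1) / \<delta> * L)"
          using D1 \<delta> L(2) by (intro mult_right_mono) auto
        then show ?thesis by (simp only: exp_le_cancel_iff neg_le_iff_le)
      qed
      also have "\<delta> * real n * ((D + 1) / \<delta> * L) = real n * ((D + 1) * L)" using \<delta> by simp
      finally have 1: "real_of_int p ^ k / real_of_int p ^ n \<le> exp (- (real n * ((D + 1) * L)))" .
      have "real (d choose k) \<le> exp (D * L) ^ k"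
        using dub by (intro order_trans[OF binomial_le_power_real] power_mono) auto
      also have "\<dots> = exp (real k * (D * L))" by (simp only: exp_of_nat_mult)
      also have "\<dots> \<le> exp (real n * (D * L))"
        unfolding exp_le_cancel_iff using kn' D1 L(2) by (intro mult_right_mono) auto
      finally have 2: "real (d choose k) \<le> exp (real n * (D * L))" .
      have "real (d choose k) * (10 ^ n * real_of_int p ^ k / real_of_int p ^ n) =
         real (d choose k) * (10 ^ n * (real_of_int p ^ k / real_of_int p ^ n))" by simp
      also have "\<dots> \<le> exp (real n * (D * L)) * (10 ^ n * exp (- (real n * ((D + 1) * L))))"
        using 1 2 p1 by (intro mult_mono) auto
      also have "\<dots> = exp (real n * (D * L)) * (exp (real n * ln 10) * exp (- (real n * ((D + 1) * L))))"
        by (simp add: exp_of_nat_mult)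
      also have "\<dots> = ?E2"
        by (simp add: exp_add[symmetric] algebra_simps)
      finally show ?thesis .
    qed
    moreover have "real (d choose k) * ((36 * ln (real_of_int p) / sqrt (real m)) ^ n * real_of_int p ^ m) \<le> ?E3"
    proof -
      \<comment> \<open>The maximum makes the base at least 1, so that the exponent \<open>k\<close>
        may be raised to \<open>(1 - \<delta>) * n\<close>.\<close>
      let ?Y = "exp (max 0 (1 + \<alpha> * L + (2 - B) * ln L))"
      have nL2: "real n / L\<^sup>2 > 0" using n0 L(2) by (intro divide_pos_pos zero_less_power) auto
      have kL: "real n / L\<^sup>2 \<le> real k" using False m(1) by linarith
      have "exp 1 * real d / real k \<le> exp 1 * real d / (real n / L\<^sup>2)"
        using kL nL2 k by (intro divide_left_mono mult_pos_pos) auto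
      also have "\<dots> \<le> exp 1 * exp (D * L - B * ln L) / (real n / L\<^sup>2)"
        using d n0 L(2) by (intro divide_right_mono mult_left_mono) auto
      also have "\<dots> = exp (1 + \<alpha> * L + (2 - B) * ln L)"
      proof -
        have "L\<^sup>2 = exp (2 * ln L)" using L(2) by (simp add: exp_double)
        then show ?thesis unfolding nL D by (simp add: exp_add[symmetric] exp_diff[symmetric] algebra_simps)
      qed
      also have "\<dots> \<le> ?Y" by simp
      finally have "(exp 1 * real d / real k) ^ k \<le> ?Y ^ k" by (intro power_mono) auto
      then have "real (d choose k) \<le> ?Y ^ k" using binomial_le_exp_power[OF k(1), of d] by linarith
      also have "\<dots> = exp (real k * max 0 (1 + \<alpha> * L + (2 - B) * ln L))" by (simp only: exp_of_nat_mult)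
      also have "\<dots> \<le> exp ((1 - \<delta>) * real n * max 0 (1 + \<alpha> * L + (2 - B) * ln L))"
        unfolding exp_le_cancel_iff using kn by (intro mult_right_mono) auto
      also have "(1 - \<delta>) * real n * max 0 (1 + \<alpha> * L + (2 - B) * ln L) \<le> real n * (1 + L / 2 - 3 * ln L)"
      proof -
        have "(1 - \<delta>) * (1 + \<alpha> * L + (2 - B) * ln L) = (1 - \<delta>) + L / 2 - 3 * ln L"
        proof -
          have "(1 - \<delta>) * (2 - B) = - 3" using \<delta> by (simp add: B field_simps)
          moreover have "(1 - \<delta>) * \<alpha> = 1 / 2" using \<alpha>0 by (simp add: mult.commute)
          ultimately have "(1 - \<delta>) + ((1 - \<delta>) * \<alpha>) * L + ((1 - \<delta>) * (2 - B)) * ln L = (1 - \<delta>) + (1 / 2) * L + (- 3) * ln L"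
            by (simp only:)
          then show ?thesis by (simp add: distrib_left mult.assoc)
        qed
        then have "(1 - \<delta>) * max 0 (1 + \<alpha> * L + (2 - B) * ln L) \<le> 1 + L / 2 - 3 * ln L"
          using \<delta> L(3) by (simp add: max_def)
        then have "real n * ((1 - \<delta>) * max 0 (1 + \<alpha> * L + (2 - B) * ln L)) \<le> real n * (1 + L / 2 - 3 * ln L)"
          by (rule mult_left_mono) simp
        then show ?thesis by (simp only: mult_ac)
      qed
      finally have c: "real (d choose k) \<le> exp (real n * (1 + L / 2 - 3 * ln L))" by simp
      have K: "36 * ln (real_of_int p) / sqrt (real m) \<le> exp (ln (36 * C1) + 2 * ln L - L / 2)"
      proof -
        have "36 * ln (real_of_int p) / sqrt (real m) \<le> 36 * (C1 * L) / sqrt (real n / L\<^sup>2)"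
          using p(2) p1 m(1) m0 n0 L(2) C1 by (intro frac_le mult_left_mono) auto
        also have "sqrt (real n / L\<^sup>2) = exp (L / 2 - ln L)"
        proof -
          have "real n / L\<^sup>2 = (exp (L / 2 - ln L))\<^sup>2"
            using L(2) nL by (simp add: exp_diff power_divide exp_double[symmetric])
          then show ?thesis by simp
        qed
        also have "36 * (C1 * L) = exp (ln (36 * C1) + ln L)" using C1 L(2) by (simp add: exp_add)
        also have "exp (ln (36 * C1) + ln L) / exp (L / 2 - ln L) = exp (ln (36 * C1) + 2 * ln L - L / 2)"
          by (simp add: exp_diff[symmetric] algebra_simps)
        finally show ?thesis .
      qed
      have "(36 * ln (real_of_int p) / sqrt (real m)) ^ n \<le> exp (ln (36 * C1) + 2 * ln L - L / 2) ^ n"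
        using K p1 by (intro power_mono) auto
      also have "\<dots> = exp (real n * (ln (36 * C1) + 2 * ln L - L / 2))" by (simp only: exp_of_nat_mult)
      finally have K': "(36 * ln (real_of_int p) / sqrt (real m)) ^ n \<le> exp (real n * (ln (36 * C1) + 2 * ln L - L / 2))" .
      have "real_of_int p ^ m \<le> exp (C1 * L) ^ m" using pub p1 by (intro power_mono) auto
      also have "\<dots> = exp (real m * (C1 * L))" by (simp only: exp_of_nat_mult)
      also have "\<dots> \<le> exp ((real n / L\<^sup>2 + 1) * (C1 * L))" 
        unfolding exp_le_cancel_iff using m(2) C1 L(2) by (intro mult_right_mono) auto
      also have "(real n / L\<^sup>2 + 1) * (C1 * L) = real n * (C1 / L) + C1 * L"
        using L(2) by (simp add: field_simps power2_eq_square)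
      finally have P: "real_of_int p ^ m \<le> exp (real n * (C1 / L) + C1 * L)" .
      have "real (d choose k) * ((36 * ln (real_of_int p) / sqrt (real m)) ^ n * real_of_int p ^ m) \<le>
        exp (real n * (1 + L / 2 - 3 * ln L)) * (exp (real n * (ln (36 * C1) + 2 * ln L - L / 2)) * exp (real n * (C1 / L) + C1 * L))"
        using c K' P p1 by (intro mult_mono) auto
      also have "\<dots> = ?E3"
        by (simp only: exp_add[symmetric]) (rule arg_cong[of _ _ exp], simp add: algebra_simps)
      finally show ?thesis .
    qed
    moreover have "?E1 \<ge> 0" by simp
    ultimately show ?thesis unfolding if_not_P[OF False] distrib_left by linarith
  qed
qed

text \<open>The outer factor \<open>n\<close> bounds the number of values of \<open>k\<close>. To
  leading order the exponents are \<open>n * ln (3 / 4)\<close>, \<open>- n * ln n\<close> and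
  \<open>- n * ln (ln n)\<close>.\<close>

lemma error_terms_tendsto_0:
  fixes D C1 :: real
  shows "(\<lambda>n. real n * (exp ((D + C1) * ln (real n) * (real n / (ln (real n))\<^sup>2 + 1) + real n * ln (3 / 4)) +
      exp (real n * ln 10 - ln (real n) * real n) +
      exp (real n * (1 + ln (36 * C1) - ln (ln (real n)) + C1 / ln (real n)) + C1 * ln (real n)))) \<longlonglongrightarrow> 0"
proof -
  have 1: "(\<lambda>n. real n * exp (A * ln (real n) * (real n / (ln (real n))\<^sup>2 + 1) + real n * ln (3 / 4))) \<longlonglongrightarrow> 0" for A :: real
    by real_asymp
  have 2: "(\<lambda>n. real n * exp (real n * ln 10 - ln (real n) * real n)) \<longlonglongrightarrow> 0"
    by real_asymp
  have 3: "(\<lambda>n. real n * exp (real n * (A - ln (ln (real n)) + C1 / ln (real n)) + C1 * ln (real n))) \<longlonglongrightarrow> 0" for A :: real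
    by real_asymp
  show ?thesis
    using tendsto_add[OF tendsto_add[OF 1[of "D + C1"] 2] 3[of "1 + ln (36 * C1)"]] by (simp add: distrib_left)
qed

lemma prob_eq_1_minus: "measure_pmf.prob M {x. P x} = 1 - measure_pmf.prob M {x. \<not> P x}"
proof -
  have "{x. P x} = space (measure_pmf M) - {x. \<not> P x}" by auto
  then show ?thesis using measure_pmf.prob_compl[of "{x. \<not> P x}" M] by simp
qed

theorem robust_below_threshold:
  fixes \<delta> :: real and \<epsilon> :: "nat \<Rightarrow> real" and d :: "nat \<Rightarrow> nat"
  assumes \<delta>: "0 < \<delta>" "\<delta> < 1"
    and \<epsilon>: "filterlim (\<lambda>n. \<epsilon> n * ln (real n) / ln (ln (real n))) at_top sequentially"
    and d: "\<forall>\<^sub>F n in sequentially. real (d n) \<le> real n powr (1 + 1 / (2 - 2 * \<delta>) - \<epsilon> n)"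
  shows "(\<lambda>n. measure_pmf.prob (random_sign_mat n (d n)) {M. robust (nat \<lfloor>(1 - \<delta>) * real n\<rfloor>) M}) \<longlonglongrightarrow> 1"
proof -
  \<comment> \<open>The prime lies above \<open>n powr c\<close> and below about twice its square;
    the extra 1 in \<open>C1\<close> absorbs the constants in
    \<open>ln p \<le> C1 * ln n\<close>.\<close>
  define \<alpha> D B c C1 where "\<alpha> = 1 / (2 - 2 * \<delta>)" and "D = 1 + \<alpha>" and "B = 2 + 3 / (1 - \<delta>)"
    and "c = (D + 1) / \<delta>" and "C1 = 2 * c + 1"
  define s where "s n = nat \<lfloor>(1 - \<delta>) * real n\<rfloor>" for n
  have \<alpha>0: "\<alpha> > 0" using \<delta> by (simp add: \<alpha>_def)
  have "D + 1 \<ge> 1" using \<alpha>0 by (simp add: D_def)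
  then have c1: "c \<ge> 1" using \<delta> unfolding c_def by (simp add: le_divide_eq)
  then have C1: "C1 \<ge> 1" by (simp add: C1_def)
  let ?err = "\<lambda>n. real n * (exp ((D + C1) * ln (real n) * (real n / (ln (real n))\<^sup>2 + 1) + real n * ln (3 / 4)) +
      exp (real n * ln 10 - ln (real n) * real n) +
      exp (real n * (1 + ln (36 * C1) - ln (ln (real n)) + C1 / ln (real n)) + C1 * ln (real n)))"
  have cpos: "c > 0" using c1 by simp
  have "filterlim (\<lambda>n :: nat. nat \<lceil>real n powr c\<rceil>) sequentially sequentially"
  proof (rule filterlim_at_top_mono)
    show "filterlim (\<lambda>n :: nat. n) sequentially sequentially" by (rule filterlim_ident)
    show "\<forall>\<^sub>F n :: nat in sequentially. n \<le> nat \<lceil>real n powr c\<rceil>"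
      using eventually_ge_at_top[of 1]
    proof eventually_elim
      case (elim n)
      then have "real n powr 1 \<le> real n powr c" using c1 by (intro powr_mono) auto
      then have "real n \<le> real_of_int \<lceil>real n powr c\<rceil>" using elim by simp linarith
      then show ?case by linarith
    qed
  qed
  from eventually_compose_filterlim[OF eventually_prime_between_square this]
  have ev_prime: "\<forall>\<^sub>F n in sequentially. \<exists>p. prime p \<and> nat \<lceil>real n powr c\<rceil> < p \<and> p \<le> 2 * (nat \<lceil>real n powr c\<rceil>)\<^sup>2 + 1" .
  \<comment> \<open>Rearranged, \<open>8 * (C1 * L)^2 \<le> n / L^2\<close>, which yields the
    condition on \<open>m\<close> in the union bound.\<close>
  have ev_m: "\<forall>\<^sub>F n :: nat in sequentially. (ln (real n)) ^ 4 / real n < 1 / (8 * C1\<^sup>2)"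
  proof (rule order_tendstoD(2))
    show "(\<lambda>n. (ln (real n)) ^ 4 / real n) \<longlonglongrightarrow> 0" by real_asymp
    show "0 < 1 / (8 * C1\<^sup>2)" using C1 by simp
  qed
  have ev1: "\<forall>\<^sub>F n :: nat in sequentially. ln (real n) \<ge> 1" by real_asymp
  have ev2: "\<forall>\<^sub>F n :: nat in sequentially. 1 + ln (real n) / 2 - 3 * ln (ln (real n)) \<ge> 0" by real_asymp
  have ev: "\<forall>\<^sub>F n in sequentially. measure_pmf.prob (random_sign_mat n (d n)) {M. \<not> robust (s n) M} \<le> ?err n"
    using d eventually_eps_ge[OF \<epsilon>, of B] ev_prime ev_m ev1 ev2 eventually_ge_at_top[of 9]
  proof eventually_elim
    case (elim n)
    define L where "L = ln (real n)"
    have n: "real n > 0" "real n \<ge> 9" using elim by auto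
    have pw: "real n powr a = exp (a * L)" for a using n by (simp add: powr_def L_def)
    have L1: "L \<ge> 1" using elim by (simp add: L_def)
    obtain q where q: "prime q" "nat \<lceil>real n powr c\<rceil> < q" "q \<le> 2 * (nat \<lceil>real n powr c\<rceil>)\<^sup>2 + 1"
      using elim by blast
    let ?X = "nat \<lceil>real n powr c\<rceil>"
    have X: "real n powr c \<le> real ?X" "real ?X \<le> real n powr c + 1" by (rule nat_ceiling_bounds, simp)+
    have "real n powr 1 \<le> real n powr c" using c1 n by (intro powr_mono) auto
    then have nc: "9 \<le> real n powr c" using n by simp
    have qX: "real ?X < real q" using q(2) by simp
    then have q9: "real q > 9" using X nc by linarith
    then have "odd q" using q(1) by (intro prime_odd_nat) auto
    define p where "p = int q"
    have p: "prime p" "odd p" "real_of_int p = real q" using q \<open>odd q\<close> by (simp_all add: p_def)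
    have p_lower: "exp ((D + 1) / \<delta> * L) \<le> real_of_int p"
      using X(1) qX unfolding p(3) pw c_def by linarith
    have "real q \<le> 2 * (real ?X)\<^sup>2 + 1"
    proof -
      have "real q \<le> real (2 * ?X\<^sup>2 + 1)" using q(3) by (simp only: of_nat_le_iff)
      then show ?thesis by simp
    qed
    \<comment> \<open>Both roundings together leave the factor \<open>2 * 4 + 1 = 9\<close>, which
      is the reason for taking \<open>n \<ge> 9\<close>.\<close>
    also have "\<dots> \<le> 2 * (2 * real n powr c)\<^sup>2 + (real n powr c)\<^sup>2"
    proof (intro add_mono mult_left_mono power_mono)
      show "real ?X \<le> 2 * real n powr c" using X(2) nc by linarith
      show "1 \<le> (real n powr c)\<^sup>2" using nc by (intro one_le_power) simp
    qed (use nc in auto)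
    also have "\<dots> = 9 * (real n powr c)\<^sup>2" by (simp add: power_mult_distrib)
    also have "\<dots> \<le> real n * (real n powr c)\<^sup>2" using n by (intro mult_right_mono) auto
    also have "\<dots> = exp (C1 * L)"
    proof -
      have nL: "real n = exp L" using n by (simp add: L_def)
      show ?thesis unfolding pw C1_def unfolding nL
        by (simp add: exp_double[symmetric] exp_add[symmetric] algebra_simps)
    qed
    finally have "real_of_int p \<le> exp (C1 * L)" by (simp add: p(3))
    then have "ln (real_of_int p) \<le> ln (exp (C1 * L))"
      using q9 p(3) by (subst ln_le_cancel_iff) auto
    then have p_upper: "ln (real_of_int p) \<le> C1 * L" by simp
    define m where "m = nat \<lceil>real n / L\<^sup>2\<rceil>"
    have m: "real n / L\<^sup>2 \<le> real m" "real m \<le> real n / L\<^sup>2 + 1"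
      unfolding m_def by (rule nat_ceiling_bounds, simp)+
    have pm: "8 * (ln (real_of_int p))\<^sup>2 \<le> real m"
    proof -
      have "0 \<le> ln (real_of_int p)" using q9 p(3) by simp
      then have "(ln (real_of_int p))\<^sup>2 \<le> (C1 * L)\<^sup>2" using p_upper by (intro power_mono)
      then have "8 * (ln (real_of_int p))\<^sup>2 \<le> 8 * (C1 * L)\<^sup>2" by simp
      also have "\<dots> \<le> real n / L\<^sup>2"
      proof -
        have "L ^ 4 * (8 * C1\<^sup>2) < real n"
          using elim(4) n C1 unfolding L_def[symmetric] by (simp add: field_simps)
        moreover have "8 * (C1 * L)\<^sup>2 * L\<^sup>2 = L ^ 4 * (8 * C1\<^sup>2)"
          by (simp add: power2_eq_square power4_eq_xxxx mult_ac)
        ultimately have "8 * (C1 * L)\<^sup>2 * L\<^sup>2 \<le> real n" by linarith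
        then show ?thesis using L1 by (simp add: pos_le_divide_eq)
      qed
      finally show ?thesis using m by linarith
    qed
    have s1: "real (s n) \<le> (1 - \<delta>) * real n" unfolding s_def using \<delta> by (intro of_nat_floor) simp
    also have "\<dots> \<le> 1 * real n" using \<delta> by (intro mult_right_mono) auto
    finally have sn: "s n \<le> n" by simp
    have dn: "real (d n) \<le> exp (D * L - B * ln L)"
    proof -
      have "real (d n) \<le> exp ((D - \<epsilon> n) * L)" using elim(1) unfolding pw D_def \<alpha>_def .
      also have "\<dots> \<le> exp (D * L - B * ln L)" using elim(2) by (simp add: L_def left_diff_distrib)
      finally show ?thesis .
    qed
    let ?t = "exp ((D + C1) * L * (real n / L\<^sup>2 + 1) + real n * ln (3 / 4)) + exp (real n * ln 10 - L * real n)
       + exp (real n * (1 + ln (36 * C1) - ln L + C1 / L) + C1 * L)"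
    have "measure_pmf.prob (random_sign_mat n (d n)) {M. \<not> robust (s n) M} \<le> (\<Sum>k=1..s n. ?t)"
    proof (rule order_trans[OF prob_not_robust_le[OF p(1,2) pm sn] sum_mono])
      fix k assume "k \<in> {1..s n}"
      then show "real (d n choose k) * (if k < m then real_of_int p ^ k * (3 / 4) ^ n
       else 10 ^ n * real_of_int p ^ k / real_of_int p ^ n + (36 * ln (real_of_int p) / sqrt (real m)) ^ n * real_of_int p ^ m) \<le> ?t"
        using elim(6) by (intro union_bound_terms[OF \<delta> \<alpha>_def D_def B_def L_def L1 _ dn p_lower p_upper C1 m _ _ s1]) (auto simp: L_def)
    qed
    also have "\<dots> = real (s n) * ?t" by simp
    also have "\<dots> \<le> real n * ?t" using sn by (intro mult_right_mono) (auto intro: add_nonneg_nonneg)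
    finally show ?case unfolding L_def .
  qed
  have "(\<lambda>n. measure_pmf.prob (random_sign_mat n (d n)) {M. \<not> robust (s n) M}) \<longlonglongrightarrow> 0"
    by (rule tendsto_sandwich[OF _ ev tendsto_const error_terms_tendsto_0]) simp
  then have "(\<lambda>n. 1 - measure_pmf.prob (random_sign_mat n (d n)) {M. \<not> robust (s n) M}) \<longlonglongrightarrow> 1 - 0"
    by (intro tendsto_diff tendsto_const)
  moreover have "1 - measure_pmf.prob (random_sign_mat n (d n)) {M. \<not> robust (s n) M} =
      measure_pmf.prob (random_sign_mat n (d n)) {M. robust (s n) M}" for n
    by (rule prob_eq_1_minus[symmetric])
  ultimately show ?thesis by (simp add: s_def)
qed

section \<open>Pairs of vanishing sign sums\<close>

text \<open>For a uniform sign \<open>x\<close>, \<open>f (s + x) = avg f s + x * dif f s\<close>,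
  so \<open>avg\<close> and \<open>dif\<close> extract the two Fourier coefficients in one variable.
  Their iterates give the coefficients in several variables, which depend only on the order
  \<open>r\<close>.\<close>

definition avg :: "(int \<Rightarrow> real) \<Rightarrow> int \<Rightarrow> real" where
  "avg f = (\<lambda>s. (f (s + 1) + f (s - 1)) / 2)"

definition dif :: "(int \<Rightarrow> real) \<Rightarrow> int \<Rightarrow> real" where
  "dif f = (\<lambda>s. (f (s + 1) - f (s - 1)) / 2)"

lemma avg_apply: "avg f s = (f (s + 1) + f (s - 1)) / 2"
  by (simp add: avg_def)

lemma avg_dif_commute: "avg (dif f) = dif (avg f)"
  unfolding avg_def dif_def by (rule ext) (simp add: algebra_simps add_divide_distrib diff_divide_distrib)

lemma avg_pow_dif_commute: "(avg ^^ l) (dif f) = dif ((avg ^^ l) f)"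
  by (induction l) (simp_all add: avg_dif_commute)

lemma avg_dif_pow_commute: "avg ((dif ^^ r) f) = (dif ^^ r) (avg f)"
  by (induction r) (simp_all add: avg_dif_commute)

lemma avg_pow_Suc: "(avg ^^ Suc l) f = (avg ^^ l) (avg f)"
  by (simp only: funpow_Suc_right o_apply)

lemma dif_pow_Suc: "(dif ^^ Suc l) f = (dif ^^ l) (dif f)"
  by (simp only: funpow_Suc_right o_apply)

lemma avg_add: "avg (\<lambda>s. f s + g s) = (\<lambda>s. avg f s + avg g s)"
  unfolding avg_def by (rule ext) (simp add: field_simps)

lemma avg_pow_add: "(avg ^^ l) (\<lambda>s. f s + g s) = (\<lambda>s. (avg ^^ l) f s + (avg ^^ l) g s)"
  by (induction l) (simp_all add: avg_add)

lemma avg_square: "avg (\<lambda>s. (f s)\<^sup>2) = (\<lambda>s. (avg f s)\<^sup>2 + (dif f s)\<^sup>2)"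
  unfolding avg_def dif_def by (rule ext) (simp add: power2_eq_square field_simps)

lemma sum_binomial_Suc:
  fixes f :: "nat \<Rightarrow> real"
  shows "(\<Sum>r\<le>Suc j. real (Suc j choose r) * f r) = (\<Sum>r\<le>j. real (j choose r) * (f r + f (Suc r)))"
proof -
  have "(\<Sum>r\<le>Suc j. real (Suc j choose r) * f r) = f 0 + (\<Sum>r\<le>j. real (Suc j choose Suc r) * f (Suc r))"
    by (subst sum.atMost_Suc_shift) simp
  also have "(\<Sum>r\<le>j. real (Suc j choose Suc r) * f (Suc r)) =
     (\<Sum>r\<le>j. real (j choose r) * f (Suc r)) + (\<Sum>r\<le>j. real (j choose Suc r) * f (Suc r))"
    by (simp add: sum.distrib distrib_right)
  also have "f 0 + ((\<Sum>r\<le>j. real (j choose r) * f (Suc r)) + (\<Sum>r\<le>j. real (j choose Suc r) * f (Suc r))) =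
     (\<Sum>r\<le>j. real (j choose r) * f (Suc r)) + (\<Sum>r\<le>Suc j. real (j choose r) * f r)"
    by (subst sum.atMost_Suc_shift) simp
  also have "(\<Sum>r\<le>Suc j. real (j choose r) * f r) = (\<Sum>r\<le>j. real (j choose r) * f r)" by simp
  finally show ?thesis by (simp add: sum.distrib distrib_left)
qed

text \<open>Parseval's identity for the sign walk.\<close>
lemma avg_pow_square:
  "(avg ^^ j) (\<lambda>s. (f s)\<^sup>2) s = (\<Sum>r\<le>j. real (j choose r) * ((dif ^^ r) ((avg ^^ (j - r)) f) s)\<^sup>2)"
proof (induction j arbitrary: f)
  case 0
  then show ?case by simp
next
  case (Suc j)
  have "(avg ^^ Suc j) (\<lambda>s. (f s)\<^sup>2) s = (avg ^^ j) (\<lambda>s. (avg f s)\<^sup>2) s + (avg ^^ j) (\<lambda>s. (dif f s)\<^sup>2) s"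
    by (simp only: avg_pow_Suc avg_square avg_pow_add)
  also have "\<dots> = (\<Sum>r\<le>j. real (j choose r) * (((dif ^^ r) ((avg ^^ (j - r)) (avg f)) s)\<^sup>2 + ((dif ^^ r) ((avg ^^ (j - r)) (dif f)) s)\<^sup>2))"
    unfolding Suc by (simp add: sum.distrib distrib_left)
  also have "\<dots> = (\<Sum>r\<le>j. real (j choose r) * (((dif ^^ r) ((avg ^^ (Suc j - r)) f) s)\<^sup>2 + ((dif ^^ Suc r) ((avg ^^ (Suc j - Suc r)) f) s)\<^sup>2))"
  proof (intro sum.cong refl)
    fix r assume "r \<in> {..j}"
    then have "Suc j - r = Suc (j - r)" by auto
    then show "real (j choose r) * (((dif ^^ r) ((avg ^^ (j - r)) (avg f)) s)\<^sup>2 + ((dif ^^ r) ((avg ^^ (j - r)) (dif f)) s)\<^sup>2) =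
      real (j choose r) * (((dif ^^ r) ((avg ^^ (Suc j - r)) f) s)\<^sup>2 + ((dif ^^ Suc r) ((avg ^^ (Suc j - Suc r)) f) s)\<^sup>2)"
      by (simp only: avg_pow_Suc avg_pow_dif_commute dif_pow_Suc diff_Suc_Suc)
  qed
  also have "\<dots> = (\<Sum>r\<le>Suc j. real (Suc j choose r) * ((dif ^^ r) ((avg ^^ (Suc j - r)) f) s)\<^sup>2)"
    by (rule sum_binomial_Suc[symmetric])
  finally show ?case .
qed

definition delta0 :: "int \<Rightarrow> real" where
  "delta0 s = (if s = 0 then 1 else 0)"

text \<open>\<open>(avg ^^ l) delta0 s\<close> is the probability that \<open>l\<close> signs sum to
  \<open>- s\<close>. On this event \<open>s\<close> is minus the sum of the signs, and by symmetry
  each sign contributes the same expectation \<open>dif ((avg ^^ (l - 1)) delta0) s\<close>.\<close>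

lemma times_avg_pow_delta0: "real_of_int s * (avg ^^ l) delta0 s = - real l * dif ((avg ^^ (l - 1)) delta0) s"
proof (induction l arbitrary: s)
  case 0
  then show ?case by (simp add: delta0_def)
next
  case (Suc l)
  let ?g = "(avg ^^ l) delta0"
  have "real_of_int s * avg ?g s = avg (\<lambda>s. real_of_int s * ?g s) s - dif ?g s"
    unfolding avg_def dif_def by (simp add: algebra_simps) (simp add: field_simps)
  also have "avg (\<lambda>s. real_of_int s * ?g s) s = - (real l * avg (dif ((avg ^^ (l - 1)) delta0)) s)"
    unfolding avg_def Suc by (simp add: algebra_simps)
  also have "real l * avg (dif ((avg ^^ (l - 1)) delta0)) s = real l * dif ?g s"
    by (cases l) (simp_all add: avg_dif_commute)
  finally show ?case by (simp add: algebra_simps)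
qed

text \<open>Iterated product rule: one \<open>dif\<close> turns \<open>s * f s\<close> into
  \<open>s * dif f s + avg f s\<close>.\<close>

lemma dif_pow_times:
  "(dif ^^ r) (\<lambda>s. real_of_int s * f s) s = real_of_int s * (dif ^^ r) f s + real r * avg ((dif ^^ (r - 1)) f) s"
proof (induction r arbitrary: s)
  case 0
  then show ?case by simp
next
  case (Suc r)
  let ?g = "(dif ^^ r) f"
  have "(dif ^^ Suc r) (\<lambda>s. real_of_int s * f s) s = dif ((dif ^^ r) (\<lambda>s. real_of_int s * f s)) s" by simp
  also have "\<dots> = dif (\<lambda>s. real_of_int s * ?g s + real r * avg ((dif ^^ (r - 1)) f) s) s"
    unfolding dif_def Suc by simp
  also have "\<dots> = dif (\<lambda>s. real_of_int s * ?g s) s + real r * dif (avg ((dif ^^ (r - 1)) f)) s"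
    unfolding dif_def by (simp add: field_simps)
  also have "dif (\<lambda>s. real_of_int s * ?g s) s = real_of_int s * dif ?g s + avg ?g s"
    unfolding avg_def dif_def by (simp add: field_simps)
  also have "real r * dif (avg ((dif ^^ (r - 1)) f)) s = real r * avg ?g s"
    by (cases r) (simp_all add: avg_dif_commute)
  finally show ?case by (simp add: algebra_simps)
qed

text \<open>The Fourier coefficient of order \<open>r\<close> of the indicator of \<open>x\<^sub>1 + \<dots> + x\<^sub>k = 0\<close> on \<open>{-1, 1}\<^sup>k\<close>.\<close>
definition fcoeff :: "nat \<Rightarrow> nat \<Rightarrow> real" where
  "fcoeff k r = (dif ^^ r) ((avg ^^ (k - r)) delta0) 0"

text \<open>Apply \<open>dif ^^ r\<close> to \<open>times_avg_pow_delta0\<close> with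
  \<open>l = k - r\<close> and evaluate at 0: the product rule leaves a coefficient of order
  \<open>r - 1\<close> on one side, and the other side has order \<open>r + 1\<close>.\<close>

lemma fcoeff_rec:
  assumes "1 \<le> r" "r < k"
  shows "real (k - r) * fcoeff k (r + 1) = - real r * fcoeff k (r - 1)"
proof -
  let ?l = "k - r"
  have kr: "k - (r - 1) = Suc ?l" "k - (r + 1) = ?l - 1" "Suc (r - 1) = r" using assms by auto
  have times: "(\<lambda>s. real_of_int s * (avg ^^ ?l) delta0 s) = (\<lambda>s. - real ?l * dif ((avg ^^ (?l - 1)) delta0) s)"
    by (rule ext) (rule times_avg_pow_delta0)
  have lin: "(dif ^^ n) (\<lambda>s. c * f s) = (\<lambda>s. c * (dif ^^ n) f s)" for n c f
    by (induction n) (simp_all add: dif_def fun_eq_iff algebra_simps)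
  have "real r * avg ((dif ^^ (r - 1)) ((avg ^^ ?l) delta0)) 0 = (dif ^^ r) (\<lambda>s. real_of_int s * (avg ^^ ?l) delta0 s) 0"
    by (simp add: dif_pow_times)
  also have "\<dots> = - real ?l * (dif ^^ r) (dif ((avg ^^ (?l - 1)) delta0)) 0"
    unfolding times lin by simp
  also have "(dif ^^ r) (dif ((avg ^^ (?l - 1)) delta0)) 0 = fcoeff k (r + 1)"
    unfolding fcoeff_def kr by (simp only: Suc_eq_plus1[symmetric] dif_pow_Suc)
  also have "avg ((dif ^^ (r - 1)) ((avg ^^ ?l) delta0)) 0 = fcoeff k (r - 1)"
    unfolding fcoeff_def kr avg_dif_pow_commute by simp
  finally show ?thesis by simp
qed

lemma fcoeff_1:
  assumes "k \<ge> 1"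
  shows "fcoeff k 1 = 0"
  using times_avg_pow_delta0[of 0 k] assms by (simp add: fcoeff_def)

lemma avg_pow_nonneg: "(\<And>s. f s \<ge> 0) \<Longrightarrow> (avg ^^ l) f s \<ge> 0"
proof (induction l arbitrary: s)
  case (Suc l)
  then show ?case by (simp add: avg_apply[of "(avg ^^ l) f"])
qed simp

lemma expectation_sign_sum:
  fixes F :: "int \<Rightarrow> real"
  assumes "finite S"
  shows "measure_pmf.expectation (lazy_vec 1 S) (\<lambda>c. F (s + (\<Sum>j\<in>S. c j))) = (avg ^^ card S) F s"
  using assms
proof (induction S arbitrary: s rule: finite_induct)
  case empty
  then show ?case by (simp add: lazy_vec_def)
next
  case (insert x S)
  have upd: "(\<Sum>j\<in>S. (c(x := y)) j) = (\<Sum>j\<in>S. c j)" for c :: "'a \<Rightarrow> int" and y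
    using insert.hyps by (intro sum.cong) auto
  have E: "measure_pmf.expectation (lazy_vec 1 S) (\<lambda>c. F (s + (\<Sum>j\<in>insert x S. (c(x := y)) j))) = (avg ^^ card S) F (s + y)" for y
    using insert.IH[of "s + y"] insert.hyps upd by (simp add: add.assoc)
  have "measure_pmf.expectation (lazy_vec 1 (insert x S)) (\<lambda>c. F (s + (\<Sum>j\<in>insert x S. c j))) =
     1 / 2 * (avg ^^ card S) F (s + 1) + 1 / 2 * (avg ^^ card S) F (s + -1) + (1 - 1) * (avg ^^ card S) F (s + 0)"
    unfolding E[symmetric] by (rule expectation_lazy_vec_insert[OF insert.hyps(1,2)]) auto
  then show ?case using insert.hyps by (simp add: avg_apply[of "(avg ^^ card S) F"])
qed

lemma avg_scale1: "avg (\<lambda>s. c * f s) = (\<lambda>s. c * avg f s)"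
  by (simp add: avg_def fun_eq_iff distrib_left)

lemma avg_scale: "(avg ^^ l) (\<lambda>s. c * f s) = (\<lambda>s. c * (avg ^^ l) f s)"
  by (induction l) (simp_all add: avg_scale1)

lemma avg_pow_mono: "(\<And>s. f s \<le> g s) \<Longrightarrow> (avg ^^ l) f s \<le> (avg ^^ l) g s"
proof (induction l arbitrary: s)
  case (Suc l)
  from Suc.IH[of "s + 1"] Suc.IH[of "s - 1"] Suc.prems show ?case
    by (simp add: avg_apply[of "(avg ^^ l) f"] avg_apply[of "(avg ^^ l) g"])
qed simp

text \<open>The signs in \<open>T\<close> are averaged with those in \<open>S\<close> frozen. The
  offset \<open>\<sigma>\<close> is general because each induction step adds a sign to it.\<close>

lemma expectation_sign_sum_Un:
  fixes F :: "('i \<Rightarrow> int) \<Rightarrow> int \<Rightarrow> real"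
  assumes "finite T" "finite S" "S \<inter> T = {}"
    and "\<And>c c'. (\<And>j. j \<in> S \<Longrightarrow> c j = c' j) \<Longrightarrow> F c = F c'"
    and "\<And>c c'. (\<And>j. j \<in> S \<Longrightarrow> c j = c' j) \<Longrightarrow> \<sigma> c = \<sigma> c'"
  shows "measure_pmf.expectation (lazy_vec 1 (S \<union> T)) (\<lambda>c. F c (\<sigma> c + (\<Sum>j\<in>T. c j))) =
    measure_pmf.expectation (lazy_vec 1 S) (\<lambda>c. (avg ^^ card T) (F c) (\<sigma> c))"
  using assms(1,3,5)
proof (induction T arbitrary: \<sigma> rule: finite_induct)
  case empty
  show ?case by simp
next
  case (insert x T)
  have x: "x \<notin> S \<union> T" "x \<notin> T" "x \<notin> S" using insert.hyps insert.prems(1) by auto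
  have upd: "(\<Sum>j\<in>insert x T. (c(x := y)) j) = y + (\<Sum>j\<in>T. c j)" for c :: "'i \<Rightarrow> int" and y
  proof -
    have "(\<Sum>j\<in>T. (c(x := y)) j) = (\<Sum>j\<in>T. c j)" using x by (intro sum.cong) auto
    then show ?thesis using insert.hyps by simp
  qed
  have F: "F (c(x := y)) = F c" for c y using x by (intro assms(4)) auto
  have \<sigma>: "\<sigma> (c(x := y)) = \<sigma> c" for c y using x by (intro insert.prems(2)) auto
  let ?h = "\<lambda>c. F c (\<sigma> c + (\<Sum>j\<in>insert x T. c j))"
  let ?E = "\<lambda>y. measure_pmf.expectation (lazy_vec 1 S) (\<lambda>c. (avg ^^ card T) (F c) (\<sigma> c + y))"
  have E: "measure_pmf.expectation (lazy_vec 1 (S \<union> T)) (\<lambda>c. ?h (c(x := y))) = ?E y" for y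
  proof -
    have "?h (c(x := y)) = F c ((\<sigma> c + y) + (\<Sum>j\<in>T. c j))" for c by (simp only: upd F \<sigma> add.assoc)
    moreover have "measure_pmf.expectation (lazy_vec 1 (S \<union> T)) (\<lambda>c. F c ((\<sigma> c + y) + (\<Sum>j\<in>T. c j))) = ?E y"
    proof (rule insert.IH)
      fix c c' :: "'i \<Rightarrow> int" assume eq: "\<And>j. j \<in> S \<Longrightarrow> c j = c' j"
      have "\<sigma> c = \<sigma> c'" by (rule insert.prems(2)) (rule eq)
      then show "\<sigma> c + y = \<sigma> c' + y" by simp
    qed (use insert.prems(1) in auto)
    ultimately show ?thesis by simp
  qed
  have "measure_pmf.expectation (lazy_vec 1 (insert x (S \<union> T))) ?h =
     1 / 2 * measure_pmf.expectation (lazy_vec 1 (S \<union> T)) (\<lambda>c. ?h (c(x := 1))) +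
     1 / 2 * measure_pmf.expectation (lazy_vec 1 (S \<union> T)) (\<lambda>c. ?h (c(x := -1))) +
     (1 - 1) * measure_pmf.expectation (lazy_vec 1 (S \<union> T)) (\<lambda>c. ?h (c(x := 0)))"
    using x insert.hyps assms(2) by (intro expectation_lazy_vec_insert) auto
  also have "\<dots> = 1 / 2 * ?E 1 + 1 / 2 * ?E (-1)" unfolding E by simp
  also have "\<dots> = measure_pmf.expectation (lazy_vec 1 S) (\<lambda>c. 1 / 2 * (avg ^^ card T) (F c) (\<sigma> c + 1) + 1 / 2 * (avg ^^ card T) (F c) (\<sigma> c + -1))"
    using assms(2) by (subst Bochner_Integration.integral_add) (auto intro: integrable_measure_pmf_finite)
  also have "\<dots> = measure_pmf.expectation (lazy_vec 1 S) (\<lambda>c. (avg ^^ card (insert x T)) (F c) (\<sigma> c))"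
    using insert.hyps by (simp add: avg_apply[of "(avg ^^ card T) g" for g] add_divide_distrib)
  finally show ?case by simp
qed

text \<open>Given the sum \<open>s\<close> of the \<open>j\<close> common signs, the two remaining
  sums of \<open>k - j\<close> signs are independent and must both equal \<open>- s\<close>; hence
  the square.\<close>

definition pair_prob :: "nat \<Rightarrow> nat \<Rightarrow> real" where
  "pair_prob k j = (avg ^^ j) (\<lambda>s. ((avg ^^ (k - j)) delta0 s)\<^sup>2) 0"

lemma prob_two_zero_sums:
  fixes S T :: "'i set"
  assumes fin: "finite S" "finite T" and card: "card S = k" "card T = k" "card (S \<inter> T) = j"
  shows "measure_pmf.prob (lazy_vec 1 (S \<union> T)) {g. (\<Sum>i\<in>S. g i) = 0 \<and> (\<Sum>i\<in>T. g i) = 0} = pair_prob k j"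
proof -
  define C U V where "C = S \<inter> T" and "U = S - T" and "V = T - S"
  have f: "finite C" "finite U" "finite V" using fin by (auto simp: C_def U_def V_def)
  have cU: "card U = k - j" unfolding U_def using card card_Diff_subset_Int[of S T] fin by simp
  have cV: "card V = k - j" unfolding V_def using card card_Diff_subset_Int[of T S] fin by (simp add: Int_commute)
  have eq: "S \<union> T = (C \<union> U) \<union> V" unfolding C_def U_def V_def by auto
  have S: "(\<Sum>i\<in>S. g i) = (\<Sum>i\<in>C. g i) + (\<Sum>i\<in>U. g i)" for g :: "'i \<Rightarrow> int"
    unfolding C_def U_def by (rule sum.Int_Diff[OF fin(1)])
  have T: "(\<Sum>i\<in>T. g i) = (\<Sum>i\<in>C. g i) + (\<Sum>i\<in>V. g i)" for g :: "'i \<Rightarrow> int"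
    unfolding C_def V_def using sum.Int_Diff[OF fin(2), of g S] by (simp add: Int_commute)
  let ?\<sigma> = "\<lambda>c :: 'i \<Rightarrow> int. \<Sum>i\<in>C. c i"
  let ?\<beta> = "(avg ^^ (k - j)) delta0"
  have \<sigma>: "?\<sigma> c = ?\<sigma> c'" if "\<And>j. j \<in> C \<Longrightarrow> c j = c' j" for c c' using that by (intro sum.cong) auto
  have \<sigma>U: "(\<Sum>i\<in>U. c i) = (\<Sum>i\<in>U. c' i)" if "\<And>j. j \<in> U \<Longrightarrow> c j = c' j" for c c' :: "'i \<Rightarrow> int"
    using that by (intro sum.cong) auto
  have "measure_pmf.prob (lazy_vec 1 (S \<union> T)) {g. (\<Sum>i\<in>S. g i) = 0 \<and> (\<Sum>i\<in>T. g i) = 0} =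
     measure_pmf.expectation (lazy_vec 1 (S \<union> T)) (indicator {g. (\<Sum>i\<in>S. g i) = 0 \<and> (\<Sum>i\<in>T. g i) = 0})"
    by simp
  also have "\<dots> = measure_pmf.expectation (lazy_vec 1 ((C \<union> U) \<union> V))
      (\<lambda>c. delta0 (?\<sigma> c + (\<Sum>i\<in>U. c i)) * delta0 (?\<sigma> c + (\<Sum>i\<in>V. c i)))"
    unfolding eq by (intro Bochner_Integration.integral_cong refl) (simp add: S T delta0_def indicator_def)
  also have "\<dots> = measure_pmf.expectation (lazy_vec 1 (C \<union> U))
      (\<lambda>c. (avg ^^ card V) (\<lambda>t. delta0 (?\<sigma> c + (\<Sum>i\<in>U. c i)) * delta0 t) (?\<sigma> c))"
  proof (rule expectation_sign_sum_Un)
    fix c c' :: "'i \<Rightarrow> int" assume "\<And>j. j \<in> C \<union> U \<Longrightarrow> c j = c' j"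
    then show "?\<sigma> c = ?\<sigma> c'" "(\<lambda>t. delta0 (?\<sigma> c + (\<Sum>i\<in>U. c i)) * delta0 t) = (\<lambda>t. delta0 (?\<sigma> c' + (\<Sum>i\<in>U. c' i)) * delta0 t)"
      using \<sigma>[of c c'] \<sigma>U[of c c'] by auto
  qed (use f in \<open>auto simp: C_def U_def V_def\<close>)
  also have "\<dots> = measure_pmf.expectation (lazy_vec 1 (C \<union> U)) (\<lambda>c. ?\<beta> (?\<sigma> c) * delta0 (?\<sigma> c + (\<Sum>i\<in>U. c i)))"
    unfolding avg_scale cV by (simp add: mult.commute)
  also have "\<dots> = measure_pmf.expectation (lazy_vec 1 C) (\<lambda>c. (avg ^^ card U) (\<lambda>t. ?\<beta> (?\<sigma> c) * delta0 t) (?\<sigma> c))"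
  proof (rule expectation_sign_sum_Un)
    fix c c' :: "'i \<Rightarrow> int" assume "\<And>j. j \<in> C \<Longrightarrow> c j = c' j"
    then show "?\<sigma> c = ?\<sigma> c'" "(\<lambda>t. ?\<beta> (?\<sigma> c) * delta0 t) = (\<lambda>t. ?\<beta> (?\<sigma> c') * delta0 t)"
      using \<sigma>[of c c'] by auto
  qed (use f in \<open>auto simp: C_def U_def\<close>)
  also have "\<dots> = measure_pmf.expectation (lazy_vec 1 C) (\<lambda>c. (?\<beta> (0 + ?\<sigma> c))\<^sup>2)"
    unfolding avg_scale cU by (simp add: power2_eq_square)
  also have "\<dots> = pair_prob k j"
    unfolding pair_prob_def using expectation_sign_sum[OF f(1), of "\<lambda>s. (?\<beta> s)\<^sup>2" 0] card(3) C_def by simp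
  finally show ?thesis .
qed

lemma avg_avg_eq: "avg (avg f) s = f s + dif (dif f) s"
  unfolding avg_def dif_def by (simp add: algebra_simps add_divide_distrib diff_divide_distrib)

text \<open>For even \<open>k\<close>, \<open>fcoeff k 0\<close> is the central binomial coefficient
  divided by \<open>2 ^ k\<close>. Its ratio follows from
  \<open>avg (avg f) = f + dif (dif f)\<close> and the recursion at \<open>r = 1\<close>.\<close>

lemma fcoeff_0_rec: "fcoeff (k + 2) 0 = fcoeff k 0 * (real k + 1) / (real k + 2)"
proof -
  have "fcoeff (k + 2) 0 = fcoeff k 0 + fcoeff (k + 2) 2"
    by (simp add: fcoeff_def avg_avg_eq numeral_2_eq_2)
  moreover have "(real k + 1) * fcoeff (k + 2) 2 = - fcoeff (k + 2) 0"
    using fcoeff_rec[of 1 "k + 2"] by (simp add: numeral_2_eq_2 add.commute)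
  ultimately have "(real k + 2) * fcoeff (k + 2) 0 = fcoeff k 0 * (real k + 1)"
    by (simp add: algebra_simps)
  then show ?thesis by (simp add: field_simps)
qed

lemma fcoeff_0_lower: "h \<ge> 1 \<Longrightarrow> 1 / (2 * sqrt (real h)) \<le> fcoeff (2 * h) 0"
proof -
  \<comment> \<open>The quantity \<open>4 * h * (fcoeff (2 * h) 0)^2\<close> equals 1 at
    \<open>h = 1\<close> and increases, because
    \<open>(2 * h + 1)^2 \<ge> 4 * h * (h + 1)\<close>.\<close>
  have "fcoeff (2 * h) 0 > 0 \<and> (h \<ge> 1 \<longrightarrow> 1 \<le> 4 * real h * (fcoeff (2 * h) 0)\<^sup>2)" for h
  proof (induction h)
    case 0
    then show ?case by (simp add: fcoeff_def delta0_def)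
  next
    case (Suc h)
    let ?c = "fcoeff (2 * h) 0"
    have r: "fcoeff (2 * Suc h) 0 = ?c * (2 * real h + 1) / (2 * real h + 2)"
      using fcoeff_0_rec[of "2 * h"] by simp
    have "1 \<le> 4 * real (Suc h) * (fcoeff (2 * Suc h) 0)\<^sup>2"
    proof (cases "h = 0")
      case True
      then show ?thesis unfolding r by (simp add: fcoeff_def delta0_def power2_eq_square)
    next
      case False
      have "4 * real (Suc h) * (fcoeff (2 * Suc h) 0)\<^sup>2 = (4 * real h * ?c\<^sup>2) * ((2 * real h + 1)\<^sup>2 / (4 * real h * (real h + 1)))"
        unfolding r using False by (simp add: divide_simps power2_eq_square) (simp add: algebra_simps)
      also have "\<dots> \<ge> (4 * real h * ?c\<^sup>2) * 1"
      proof (rule mult_left_mono)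
        have "4 * real h * (real h + 1) \<le> (2 * real h + 1)\<^sup>2" by (simp add: power2_eq_square algebra_simps)
        then show "1 \<le> (2 * real h + 1)\<^sup>2 / (4 * real h * (real h + 1))" using False by (simp add: pos_le_divide_eq)
      qed simp
      finally show ?thesis using Suc False by auto
    qed
    then show ?case using Suc r by simp
  qed
  note this[of h]
  moreover assume "h \<ge> 1"
  ultimately have c: "fcoeff (2 * h) 0 > 0" "1 \<le> 4 * real h * (fcoeff (2 * h) 0)\<^sup>2" by auto
  have "1\<^sup>2 \<le> (2 * sqrt (real h) * fcoeff (2 * h) 0)\<^sup>2" using c by (simp add: power_mult_distrib)
  then have "1 \<le> 2 * sqrt (real h) * fcoeff (2 * h) 0" by (rule power2_le_imp_le) (use c in simp)
  then show ?thesis using \<open>h \<ge> 1\<close> by (simp add: field_simps)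
qed

lemma delta0_avg_range: "0 \<le> (avg ^^ l) delta0 s" "(avg ^^ l) delta0 s \<le> 1"
proof -
  show "0 \<le> (avg ^^ l) delta0 s" by (rule avg_pow_nonneg) (simp add: delta0_def)
  have "(avg ^^ l) delta0 s \<le> (avg ^^ l) (\<lambda>_. 1) s" by (rule avg_pow_mono) (simp add: delta0_def)
  also have "(avg ^^ l) (\<lambda>_. 1) s = 1"
    by (induction l arbitrary: s) (simp_all add: avg_apply[of "(avg ^^ l) (\<lambda>_. 1)" for l])
  finally show "(avg ^^ l) delta0 s \<le> 1" .
qed

lemma pair_prob_le:
  assumes "j \<le> k"
  shows "pair_prob k j \<le> fcoeff k 0"
proof -
  have "pair_prob k j \<le> (avg ^^ j) ((avg ^^ (k - j)) delta0) 0"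
    unfolding pair_prob_def
    by (rule avg_pow_mono) (use delta0_avg_range in \<open>simp add: power2_eq_square mult_left_le\<close>)
  also have "\<dots> = fcoeff k 0" using assms by (simp add: fcoeff_def funpow_add[symmetric, THEN fun_cong, simplified])
  finally show ?thesis .
qed

lemma pair_prob_same: "pair_prob k k = fcoeff k 0"
proof -
  have "(\<lambda>s. (delta0 s)\<^sup>2) = delta0" by (rule ext) (simp add: delta0_def)
  then show ?thesis by (simp add: pair_prob_def fcoeff_def)
qed

section \<open>Comparing the Parseval sum with a binomial series\<close>

lemma pair_prob_eq_sum:
  assumes "j \<le> k"
  shows "pair_prob k j = (\<Sum>r\<le>j. real (j choose r) * (fcoeff k r)\<^sup>2)"
proof -
  have "(avg ^^ (j - r)) ((avg ^^ (k - j)) delta0) = (avg ^^ (k - r)) delta0" if "r \<le> j" for r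
  proof -
    have "k - r = (j - r) + (k - j)" using that assms by simp
    then show ?thesis by (simp only: funpow_add o_apply)
  qed
  then show ?thesis unfolding pair_prob_def avg_pow_square fcoeff_def by (intro sum.cong) auto
qed

lemma fcoeff_odd:
  assumes "odd r" "r \<le> k"
  shows "fcoeff k r = 0"
proof -
  obtain t where r: "r = 2 * t + 1" using assms(1) by (elim oddE)
  have "2 * t + 1 \<le> k \<Longrightarrow> fcoeff k (2 * t + 1) = 0" for t
  proof (induction t)
    case 0
    then show ?case using fcoeff_1[of k] by simp
  next
    case (Suc t)
    then have "fcoeff k (2 * t + 1) = 0" by simp
    moreover have "real (k - (2 * t + 2)) * fcoeff k ((2 * t + 2) + 1) = - real (2 * t + 2) * fcoeff k ((2 * t + 2) - 1)"
      using Suc.prems by (intro fcoeff_rec) auto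
    ultimately show ?case using Suc.prems by simp
  qed
  then show ?thesis using assms r by simp
qed

text \<open>The power series coefficients of \<open>1 / sqrt (1 - y)\<close>; the sign makes them
  nonnegative, so partial sums stay below the limit.\<close>

definition invsqrt_coeff :: "nat \<Rightarrow> real" where
  "invsqrt_coeff t = (-1) ^ t * ((- (1 / 2)) gchoose t)"

lemma invsqrt_coeff_Suc: "invsqrt_coeff (Suc t) = invsqrt_coeff t * ((2 * real t + 1) / (2 * real t + 2))"
proof -
  have "real (Suc t) * ((- (1 / 2) :: real) gchoose Suc t) = (- (1 / 2) - real t) * ((- (1 / 2)) gchoose t)"
    using gbinomial_absorb_comp[of "- (1 / 2) :: real" t] gbinomial_absorption'[of "Suc t" "- (1 / 2) :: real"]
      gbinomial_mult_1[of "- (1 / 2) :: real" t] by (simp add: algebra_simps)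
  then have eq: "((- (1 / 2) :: real) gchoose Suc t) = (- (1 / 2) - real t) * ((- (1 / 2)) gchoose t) / real (Suc t)"
    by (simp add: field_simps)
  show ?thesis unfolding invsqrt_coeff_def eq by (simp add: divide_simps) (simp add: algebra_simps)
qed

lemma invsqrt_coeff_nonneg: "0 \<le> invsqrt_coeff t"
  by (induction t) (simp_all add: invsqrt_coeff_Suc, simp add: invsqrt_coeff_def)

lemma sum_invsqrt_coeff_le:
  assumes "0 \<le> y" "y < 1"
  shows "(\<Sum>t\<le>N. invsqrt_coeff t * y ^ t) \<le> 1 / sqrt (1 - y)"
proof -
  have "(\<lambda>t. ((- (1 / 2)) gchoose t) * (- y) ^ t) sums (1 + - y) powr (- (1 / 2))"
    using assms by (intro gen_binomial_real) auto
  moreover have "((- (1 / 2)) gchoose t) * (- y) ^ t = invsqrt_coeff t * y ^ t" for t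
    unfolding invsqrt_coeff_def by (simp add: power_minus[of y])
  ultimately have s: "(\<lambda>t. invsqrt_coeff t * y ^ t) sums (1 - y) powr (- (1 / 2))" by simp
  have "(\<Sum>t\<le>N. invsqrt_coeff t * y ^ t) \<le> (\<Sum>t. invsqrt_coeff t * y ^ t)"
    using s assms invsqrt_coeff_nonneg by (intro sum_le_suminf) (auto simp: sums_iff)
  also have "\<dots> = (1 - y) powr (- (1 / 2))" using s by (simp add: sums_iff)
  also have "\<dots> = 1 / sqrt (1 - y)" using assms by (simp add: powr_minus_divide powr_half_sqrt)
  finally show ?thesis .
qed

text \<open>From \<open>t\<close> to \<open>t + 1\<close> the left side is multiplied by
  \<open>(2 * t + 1) / (2 * t + 2)\<close>, the ratio of consecutive \<open>invsqrt_coeff\<close>,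
  and by \<open>a * (a - 1) / b^2\<close> with \<open>a = j - 2 * t\<close> and
  \<open>b = k - 1 - 2 * t\<close>, which is at most \<open>(j / (k - 1))^2\<close>.\<close>

lemma fcoeff_even_le:
  assumes "j + 1 \<le> k" "2 * t \<le> j"
  shows "real (j choose (2 * t)) * (fcoeff k (2 * t))\<^sup>2 \<le> (fcoeff k 0)\<^sup>2 * (invsqrt_coeff t * ((real j / (real k - 1))\<^sup>2) ^ t)"
  using assms(2)
proof (induction t)
  case 0
  then show ?case by (simp add: invsqrt_coeff_def)
next
  case (Suc t)
  let ?y = "(real j / (real k - 1))\<^sup>2"
  let ?F = "(fcoeff k (2 * t))\<^sup>2"
  have IH: "real (j choose (2 * t)) * ?F \<le> (fcoeff k 0)\<^sup>2 * (invsqrt_coeff t * ?y ^ t)" using Suc by simp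
  have k: "2 * t + 1 < k" using Suc.prems assms by simp
  define a where "a = real j - 2 * real t"
  define b where "b = real k - 1 - 2 * real t"
  have ab: "a \<ge> 2" "b \<ge> a" "b > 0"
  proof -
    have "real (2 * Suc t) \<le> real j" "real (j + 1) \<le> real k"
      using Suc.prems assms by (simp_all only: of_nat_le_iff)
    then show "a \<ge> 2" "b \<ge> a" "b > 0" unfolding a_def b_def by simp_all
  qed
  have rec: "b * fcoeff k (2 * Suc t) = - (2 * real t + 1) * fcoeff k (2 * t)"
    using fcoeff_rec[of "2 * t + 1" k] k unfolding b_def by (simp add: of_nat_diff algebra_simps)
  have F: "(fcoeff k (2 * Suc t))\<^sup>2 = ((2 * real t + 1) / b)\<^sup>2 * ?F"
  proof -
    have "fcoeff k (2 * Suc t) = - ((2 * real t + 1) / b) * fcoeff k (2 * t)" using rec ab by (simp add: field_simps)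
    then show ?thesis by (simp only: power_mult_distrib power2_minus)
  qed
  have ch: "real (j choose (2 * Suc t)) = real (j choose (2 * t)) * (a * (a - 1)) / ((2 * real t + 1) * (2 * real t + 2))"
  proof -
    have step: "real (Suc i) * real (j choose Suc i) = (real j - real i) * real (j choose i)" if "i \<le> j" for i
    proof -
      have "Suc i * (j choose Suc i) = (j - i) * (j choose i)"
        using binomial_absorb_comp[of j i] binomial_absorption[of i j] by (metis mult.commute)
      then have "real (Suc i) * real (j choose Suc i) = real (j - i) * real (j choose i)" by (metis of_nat_mult)
      then show ?thesis using that by (simp add: of_nat_diff)
    qed
    have "real (j choose (2 * Suc t)) * ((2 * real t + 1) * (2 * real t + 2)) =
       (2 * real t + 1) * (real (Suc (2 * t + 1)) * real (j choose Suc (2 * t + 1)))" by simp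
    also have "\<dots> = (real j - real (2 * t + 1)) * (real (Suc (2 * t)) * real (j choose Suc (2 * t)))"
      using Suc.prems by (subst step) (simp_all add: mult_ac)
    also have "\<dots> = (real j - real (2 * t + 1)) * ((real j - real (2 * t)) * real (j choose (2 * t)))"
      using Suc.prems by (subst step) simp_all
    also have "\<dots> = real (j choose (2 * t)) * (a * (a - 1))" unfolding a_def by (simp add: mult_ac)
    finally have X: "real (j choose (2 * Suc t)) * ((2 * real t + 1) * (2 * real t + 2)) = real (j choose (2 * t)) * (a * (a - 1))" .
    have P0: "(2 * real t + 1) * (2 * real t + 2) > 0" by (intro mult_pos_pos) auto
    show ?thesis by (rule eq_divide_imp[OF less_imp_neq[OF P0, symmetric] X])
  qed
  have y: "(a * (a - 1)) / b\<^sup>2 \<le> ?y"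
  proof -
    have "a * (a - 1) \<le> a\<^sup>2" using ab by (simp add: power2_eq_square)
    then have "(a * (a - 1)) / b\<^sup>2 \<le> (a / b)\<^sup>2" by (simp add: power_divide divide_right_mono)
    also have "\<dots> \<le> ?y"
    proof (rule power_mono)
      \<comment> \<open>Subtracting the same \<open>2 * t\<close> from \<open>j\<close> and from the
        larger \<open>k - 1\<close> does not increase the quotient.\<close>
      have "a * (real k - 1) \<le> real j * b"
      proof -
        have "real j * b - a * (real k - 1) = 2 * real t * (real k - 1 - real j)" unfolding a_def b_def by (simp add: algebra_simps)
        moreover have "real k - 1 - real j \<ge> 0" using assms by linarith
        then have "2 * real t * (real k - 1 - real j) \<ge> 0" by simp
        ultimately show ?thesis by linarith
      qed
      moreover have "real k - 1 > 0" using k by simp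
      ultimately show "a / b \<le> real j / (real k - 1)" using ab by (simp add: field_simps)
    qed (use ab in simp)
    finally show ?thesis .
  qed
  let ?u = "(2 * real t + 1) / (2 * real t + 2)"
  have "real (j choose (2 * Suc t)) * (fcoeff k (2 * Suc t))\<^sup>2 = (real (j choose (2 * t)) * ?F) * (?u * ((a * (a - 1)) / b\<^sup>2))"
    unfolding ch F using ab by (simp add: divide_simps power2_eq_square)
  also have "\<dots> \<le> ((fcoeff k 0)\<^sup>2 * (invsqrt_coeff t * ?y ^ t)) * (?u * ?y)"
  proof (rule mult_mono[OF IH])
    show "?u * ((a * (a - 1)) / b\<^sup>2) \<le> ?u * ?y" using y by (intro mult_left_mono) auto
  qed (use ab invsqrt_coeff_nonneg in auto)
  also have "\<dots> = (fcoeff k 0)\<^sup>2 * (invsqrt_coeff (Suc t) * ?y ^ Suc t)"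
    unfolding invsqrt_coeff_Suc by simp
  finally show ?case .
qed

lemma pair_prob_le_invsqrt:
  assumes "j + 2 \<le> k"
  shows "pair_prob k j \<le> (fcoeff k 0)\<^sup>2 / sqrt (1 - (real j / (real k - 1))\<^sup>2)"
proof -
  let ?y = "(real j / (real k - 1))\<^sup>2"
  let ?f = "\<lambda>r. real (j choose r) * (fcoeff k r)\<^sup>2"
  have "pair_prob k j = (\<Sum>r\<le>j. ?f r)" using assms by (intro pair_prob_eq_sum) simp
  also have "\<dots> = (\<Sum>r\<in>{r. r \<le> j \<and> even r}. ?f r)"
    using assms by (intro sum.mono_neutral_right) (auto simp: fcoeff_odd)
  also have "\<dots> \<le> (\<Sum>r\<in>(\<lambda>t. 2 * t) ` {..j div 2}. ?f r)"
    by (intro sum_mono2) (auto elim!: evenE)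
  also have "\<dots> = (\<Sum>t\<le>j div 2. ?f (2 * t))" by (subst sum.reindex) (auto simp: inj_on_def)
  also have "\<dots> \<le> (\<Sum>t\<le>j div 2. (fcoeff k 0)\<^sup>2 * (invsqrt_coeff t * ?y ^ t))"
    using assms by (intro sum_mono fcoeff_even_le) auto
  also have "\<dots> = (fcoeff k 0)\<^sup>2 * (\<Sum>t\<le>j div 2. invsqrt_coeff t * ?y ^ t)" by (simp add: sum_distrib_left)
  also have "\<dots> \<le> (fcoeff k 0)\<^sup>2 * (1 / sqrt (1 - ?y))"
  proof (intro mult_left_mono sum_invsqrt_coeff_le)
    have "real j / (real k - 1) < 1" using assms by (simp add: divide_less_eq)
    moreover have "0 \<le> real j / (real k - 1)" using assms by simp
    ultimately have "?y < 1\<^sup>2" by (intro power_strict_mono) auto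
    then show "?y < 1" by simp
  qed auto
  finally show ?thesis by simp
qed

section \<open>The second moment method\<close>

text \<open>Chebyshev's inequality: the variance of the number of events is at most
  \<open>\<eta> * e^2\<close>, and on the event in question this number misses its mean
  \<open>e\<close> by all of \<open>e\<close>.\<close>

lemma second_moment_bound:
  fixes M :: "'a pmf" and Ev :: "'t \<Rightarrow> 'a set" and q \<eta> :: real
  assumes T: "finite T" "T \<noteq> {}" and M: "finite (set_pmf M)"
    and q: "q > 0" "\<And>t. t \<in> T \<Longrightarrow> measure_pmf.prob M (Ev t) = q"
    and sm: "(\<Sum>t\<in>T. \<Sum>t'\<in>T. measure_pmf.prob M (Ev t \<inter> Ev t')) \<le> (1 + \<eta>) * (real (card T) * q)\<^sup>2"
  shows "measure_pmf.prob M {x. \<forall>t\<in>T. x \<notin> Ev t} \<le> \<eta>"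
proof -
  define X where "X x = (\<Sum>t\<in>T. indicat_real (Ev t) x)" for x
  define e where "e = real (card T) * q"
  have e0: "e > 0" using T q by (simp add: e_def card_gt_0_iff)
  have int: "integrable (measure_pmf M) f" for f :: "'a \<Rightarrow> real" using M by (rule integrable_measure_pmf_finite)
  have EX: "measure_pmf.expectation M X = e"
    unfolding X_def e_def using q(2) by (subst Bochner_Integration.integral_sum) (auto simp: int)
  have "measure_pmf.expectation M (\<lambda>x. (X x)\<^sup>2) = measure_pmf.expectation M (\<lambda>x. \<Sum>t\<in>T. \<Sum>t'\<in>T. indicat_real (Ev t \<inter> Ev t') x)"
    unfolding X_def power2_eq_square sum_product by (intro Bochner_Integration.integral_cong refl sum.cong) (simp add: indicator_inter_arith)
  also have "\<dots> = (\<Sum>t\<in>T. \<Sum>t'\<in>T. measure_pmf.prob M (Ev t \<inter> Ev t'))"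
    by (simp add: int Bochner_Integration.integral_sum)
  finally have EX2: "measure_pmf.expectation M (\<lambda>x. (X x)\<^sup>2) \<le> (1 + \<eta>) * e\<^sup>2" using sm by (simp add: e_def)
  have "measure_pmf.prob M {x. \<forall>t\<in>T. x \<notin> Ev t} * e\<^sup>2 = measure_pmf.expectation M (\<lambda>x. indicator {x. \<forall>t\<in>T. x \<notin> Ev t} x * e\<^sup>2)"
    by simp
  also have "\<dots> \<le> measure_pmf.expectation M (\<lambda>x. (X x)\<^sup>2 - 2 * e * X x + e\<^sup>2)"
  proof (rule integral_mono[OF int int])
    fix x
    show "indicator {x. \<forall>t\<in>T. x \<notin> Ev t} x * e\<^sup>2 \<le> (X x)\<^sup>2 - 2 * e * X x + e\<^sup>2"
    proof (cases "\<forall>t\<in>T. x \<notin> Ev t")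
      case True
      then have "X x = 0" by (simp add: X_def)
      then show ?thesis by (simp add: indicator_def)
    next
      case False
      have "0 \<le> (X x - e)\<^sup>2" by simp
      then show ?thesis using False by (simp add: power2_diff mult_ac)
    qed
  qed
  also have "\<dots> = measure_pmf.expectation M (\<lambda>x. (X x)\<^sup>2) - 2 * e * measure_pmf.expectation M X + e\<^sup>2"
    by (simp add: int Bochner_Integration.integral_add Bochner_Integration.integral_diff)
  also have "\<dots> \<le> \<eta> * e\<^sup>2" using EX2 unfolding EX by (simp add: power2_eq_square algebra_simps)
  finally show ?thesis using e0 by simp
qed

text \<open>The columns are cut into \<open>k\<close> blocks of length \<open>m\<close>, and \<open>t\<close> selects one column from each block.\<close>
definition transversal :: "nat \<Rightarrow> nat \<Rightarrow> (nat \<Rightarrow> nat) \<Rightarrow> nat set" where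
  "transversal k m t = (\<lambda>g. g * m + t g) ` {..<k}"

definition agreement :: "nat \<Rightarrow> (nat \<Rightarrow> nat) \<Rightarrow> (nat \<Rightarrow> nat) \<Rightarrow> nat" where
  "agreement k t t' = card {g\<in>{..<k}. t g = t' g}"

lemma block_index_inj:
  fixes a b g g' m :: nat
  assumes "g * m + a = g' * m + b" "a < m" "b < m"
  shows "g = g' \<and> a = b"
proof -
  have "(g * m + a) div m = g" "(g' * m + b) div m = g'" using assms(2,3) by simp_all
  then have "g = g'" using assms(1) by simp
  then show ?thesis using assms(1) by simp
qed

lemma transversal_properties:
  assumes t: "t \<in> PiE {..<k} (\<lambda>_. {..<m})" and t': "t' \<in> PiE {..<k} (\<lambda>_. {..<m})"
  shows "finite (transversal k m t)" "card (transversal k m t) = k"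
    "card (transversal k m t \<inter> transversal k m t') = agreement k t t'"
    "transversal k m t \<subseteq> {..<k * m}"
proof -
  have l: "t g < m" "t' g < m" if "g < k" for g using t t' that by (auto simp: PiE_iff)
  show "finite (transversal k m t)" by (simp add: transversal_def)
  have inj: "inj_on (\<lambda>g. g * m + t g) {..<k}"
    by (rule inj_onI) (use l block_index_inj in blast)
  then show "card (transversal k m t) = k" by (simp add: transversal_def card_image)
  have "transversal k m t \<inter> transversal k m t' = (\<lambda>g. g * m + t g) ` {g\<in>{..<k}. t g = t' g}"
  proof (intro equalityI subsetI)
    fix x assume "x \<in> transversal k m t \<inter> transversal k m t'"
    then obtain g g' where g: "g < k" "g' < k" "x = g * m + t g" "x = g' * m + t' g'" by (auto simp: transversal_def)
    then have "g = g' \<and> t g = t' g'" using l by (intro block_index_inj[of g m "t g" g' "t' g'"]) auto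
    then show "x \<in> (\<lambda>g. g * m + t g) ` {g\<in>{..<k}. t g = t' g}"
      using g by (intro image_eqI[of _ _ g]) auto
  next
    fix x assume "x \<in> (\<lambda>g. g * m + t g) ` {g\<in>{..<k}. t g = t' g}"
    then obtain g where g: "g < k" "t g = t' g" "x = g * m + t g" by auto
    then have "x = g * m + t' g" by simp
    then show "x \<in> transversal k m t \<inter> transversal k m t'" using g(1,3) unfolding transversal_def by blast
  qed
  moreover have "inj_on (\<lambda>g. g * m + t g) {g\<in>{..<k}. t g = t' g}" using inj by (rule inj_on_subset) auto
  ultimately show "card (transversal k m t \<inter> transversal k m t') = agreement k t t'"
    by (simp only: agreement_def card_image)
  show "transversal k m t \<subseteq> {..<k * m}"
  proof
    fix x assume "x \<in> transversal k m t"
    then obtain g where g: "g < k" "x = g * m + t g" by (auto simp: transversal_def)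
    have "x < Suc g * m" using g l[of g] by simp
    also have "Suc g * m \<le> k * m" using g by (intro mult_le_mono1) simp
    finally show "x \<in> {..<k * m}" by simp
  qed
qed

lemma prob_transversals:
  fixes k m d n :: nat
  assumes t: "t \<in> PiE {..<k} (\<lambda>_. {..<m})" and t': "t' \<in> PiE {..<k} (\<lambda>_. {..<m})" and d: "k * m \<le> d"
  shows "measure_pmf.prob (lazy_vec 1 ({..<n} \<times> {..<d}))
    ({c. \<forall>i<n. (\<Sum>j\<in>transversal k m t. c (i, j)) = 0} \<inter> {c. \<forall>i<n. (\<Sum>j\<in>transversal k m t'. c (i, j)) = 0})
    = pair_prob k (agreement k t t') ^ n"
proof -
  let ?S = "transversal k m t" and ?T = "transversal k m t'"
  let ?Q = "\<lambda>g :: nat \<Rightarrow> int. (\<Sum>j\<in>?S. g j) = 0 \<and> (\<Sum>j\<in>?T. g j) = 0"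
  have sub: "?S \<union> ?T \<subseteq> {..<d}" using transversal_properties(4)[OF t t] transversal_properties(4)[OF t' t'] d by fastforce
  have Q: "?Q g = ?Q g'" if "\<And>j. j \<in> ?S \<union> ?T \<Longrightarrow> g j = g' j" for g g'
  proof -
    have "(\<Sum>j\<in>?S. g j) = (\<Sum>j\<in>?S. g' j)" "(\<Sum>j\<in>?T. g j) = (\<Sum>j\<in>?T. g' j)" using that by (auto intro!: sum.cong)
    then show ?thesis by simp
  qed
  have "{c. \<forall>i<n. (\<Sum>j\<in>?S. c (i, j)) = 0} \<inter> {c. \<forall>i<n. (\<Sum>j\<in>?T. c (i, j)) = 0} = {c. \<forall>i<n. ?Q (\<lambda>j. c (i, j))}"
    by auto
  moreover have "measure_pmf.prob (lazy_vec 1 ({..<n} \<times> {..<d})) {c. \<forall>i<n. ?Q (\<lambda>j. c (i, j))} =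
      measure_pmf.prob (lazy_vec 1 {..<d}) {g. ?Q g} ^ n"
  proof (rule prob_rows)
    fix g g' :: "nat \<Rightarrow> int" assume eq: "\<And>j. j \<in> {..<d} \<Longrightarrow> g j = g' j"
    show "?Q g = ?Q g'" by (rule Q) (use eq sub in blast)
  qed simp
  moreover have "measure_pmf.prob (lazy_vec 1 {..<d}) {g. ?Q g} = measure_pmf.prob (lazy_vec 1 (?S \<union> ?T)) {g. ?Q g}"
    by (rule prob_lazy_vec_subset[OF _ sub Q]) simp
  moreover have "\<dots> = pair_prob k (agreement k t t')"
    using transversal_properties[OF t t'] transversal_properties[OF t' t] by (intro prob_two_zero_sums) auto
  ultimately show ?thesis by simp
qed

lemma agreement_self: "agreement k t t = k"
  by (simp add: agreement_def)

lemma agreement_le: "agreement k t t' \<le> k"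
  unfolding agreement_def using card_mono[of "{..<k}" "{g\<in>{..<k}. t g = t' g}"] by auto

text \<open>Only the places of agreement are fixed; elsewhere \<open>t'\<close> is left free, which
  overcounts but suffices for an upper bound.\<close>

lemma card_agreement_le:
  assumes t: "t \<in> PiE {..<k} (\<lambda>_. {..<m})" and j: "j \<le> k"
  shows "card {t'\<in>PiE {..<k} (\<lambda>_. {..<m}). agreement k t t' = j} \<le> (k choose j) * m ^ (k - j)"
proof -
  let ?F = "{J. J \<subseteq> {..<k} \<and> card J = j}"
  let ?P = "\<lambda>J. PiE {..<k} (\<lambda>g. if g \<in> J then {t g} else {..<m})"
  have fin: "finite ?F" by (rule finite_subset[of _ "Pow {..<k}"]) auto
  have "{t'\<in>PiE {..<k} (\<lambda>_. {..<m}). agreement k t t' = j} \<subseteq> (\<Union>J\<in>?F. ?P J)"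
  proof
    fix t' assume t': "t' \<in> {t'\<in>PiE {..<k} (\<lambda>_. {..<m}). agreement k t t' = j}"
    let ?J = "{g\<in>{..<k}. t g = t' g}"
    have "?J \<in> ?F" using t' by (auto simp: agreement_def)
    moreover have "t' \<in> ?P ?J" using t' by (auto simp: PiE_iff)
    ultimately show "t' \<in> (\<Union>J\<in>?F. ?P J)" by (rule UN_I)
  qed
  then have "card {t'\<in>PiE {..<k} (\<lambda>_. {..<m}). agreement k t t' = j} \<le> card (\<Union>J\<in>?F. ?P J)"
    using fin by (intro card_mono finite_UN_I finite_PiE) auto
  also have "\<dots> \<le> (\<Sum>J\<in>?F. card (?P J))" by (rule card_UN_le[OF fin])
  also have "\<dots> = (\<Sum>J\<in>?F. m ^ (k - j))"
  proof (rule sum.cong[OF refl])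
    fix J assume J: "J \<in> ?F"
    then have "finite J" using finite_subset by blast
    have "card (?P J) = (\<Prod>g<k. if g \<in> J then 1 else m)" by (subst card_PiE) (auto intro!: prod.cong)
    also have "\<dots> = m ^ card ({..<k} - J)"
      by (simp add: prod.If_cases Diff_eq)
    also have "card ({..<k} - J) = k - j" using J \<open>finite J\<close> by (simp add: card_Diff_subset)
    finally show "card (?P J) = m ^ (k - j)" .
  qed
  also have "\<dots> = (k choose j) * m ^ (k - j)" by (simp add: n_subsets)
  finally show ?thesis .
qed

text \<open>\<open>robust\<close> speaks of exactly \<open>s\<close> columns, so the transversal is
  padded to size \<open>s\<close>; its indicator remains a nonzero kernel vector.\<close>

lemma transversal_imp_not_robust:
  fixes c :: "nat \<times> nat \<Rightarrow> int"
  assumes t: "t \<in> PiE {..<k} (\<lambda>_. {..<m})" and k: "0 < k" "k \<le> s" "s \<le> d" "k * m \<le> d"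
    and c: "\<forall>i<n. (\<Sum>j\<in>transversal k m t. c (i, j)) = 0"
  shows "\<not> robust s (mat n d (\<lambda>ij. real_of_int (c ij)))"
proof
  let ?M = "mat n d (\<lambda>ij. real_of_int (c ij))"
  let ?T = "transversal k m t"
  note T = transversal_properties[OF t t]
  assume rob: "robust s ?M"
  have Td: "?T \<subseteq> {..<d}" using T(4) k(4) by fastforce
  obtain S where S: "?T \<subseteq> S" "S \<subseteq> {..<d}" "card S = s"
    using exists_subset_between[of ?T s "{..<d}"] T(2) k Td by auto
  have finS: "finite S" using S finite_subset by blast
  have "cols_indep ?M S" using rob S by (auto simp: robust_def)
  then have ind: "(\<forall>i<n. (\<Sum>j\<in>S. ?M $$ (i, j) * x j) = 0) \<Longrightarrow> (\<forall>j\<in>S. x j = 0)" for x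
    using cols_indep_iff[of S ?M] S(2) by simp
  let ?x = "\<lambda>j. if j \<in> ?T then 1 else 0 :: real"
  have "(\<Sum>j\<in>S. ?M $$ (i, j) * ?x j) = 0" if i: "i < n" for i
  proof -
    have "(\<Sum>j\<in>S. ?M $$ (i, j) * ?x j) = (\<Sum>j\<in>S. if j \<in> ?T then real_of_int (c (i, j)) else 0)"
      using S i by (intro sum.cong) auto
    also have "\<dots> = (\<Sum>j\<in>?T. real_of_int (c (i, j)))"
      using finS S by (simp add: sum.inter_restrict[symmetric] Int_absorb1)
    also have "\<dots> = real_of_int (\<Sum>j\<in>?T. c (i, j))" by simp
    finally show ?thesis using c i by simp
  qed
  then have z: "\<forall>j\<in>S. ?x j = 0" by (intro ind) blast
  obtain j where "j \<in> ?T" using T(2) k(1) by fastforce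
  then show False using z S(1) by fastforce
qed

text \<open>Relative to the squared mean, \<open>(k choose j) / m ^ j\<close> bounds the fraction of
  pairs with overlap \<open>j\<close>, and the power of the ratio is their correlation. Overlaps up
  to \<open>J\<close> contribute at most \<open>1 + \<eta>\<close> in total, since their fractions
  sum to at most 1.\<close>

lemma prob_robust_le:
  fixes h k m s d n :: nat and J \<eta> :: real
  assumes h: "h \<ge> 1" "k = 2 * h" and k: "k \<le> s" "s \<le> d" "k * m \<le> d" and m: "m \<ge> 1"
    and \<eta>: "\<eta> \<ge> 0"
    and small: "\<And>j. j \<le> k \<Longrightarrow> real j \<le> J \<Longrightarrow> (pair_prob k j / (fcoeff k 0)\<^sup>2) ^ n \<le> 1 + \<eta>"
  shows "measure_pmf.prob (random_sign_mat n d) {M. robust s M} \<le>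
    \<eta> + (\<Sum>j | j \<le> k \<and> J < real j. real (k choose j) / real m ^ j * (pair_prob k j / (fcoeff k 0)\<^sup>2) ^ n)"
proof -
  let ?L = "lazy_vec 1 ({..<n} \<times> {..<d})"
  let ?T = "PiE {..<k} (\<lambda>_. {..<m})"
  let ?Ev = "\<lambda>t. {c. \<forall>i<n. (\<Sum>j\<in>transversal k m t. c (i, j)) = (0 :: int)}"
  let ?R = "\<lambda>j. (pair_prob k j / (fcoeff k 0)\<^sup>2) ^ n"
  let ?q = "fcoeff k 0 ^ n"
  let ?tail = "\<Sum>j | j \<le> k \<and> J < real j. real (k choose j) / real m ^ j * ?R j"
  have "0 < 1 / (2 * sqrt (real h))" using h by simp
  then have p0: "fcoeff k 0 > 0" using fcoeff_0_lower[OF h(1)] unfolding h(2) by linarith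
  have finT: "finite ?T" by (intro finite_PiE) auto
  have cT: "card ?T = m ^ k" by (simp add: card_PiE)
  have R0: "?R j \<ge> 0" for j
  proof -
    have "pair_prob k j \<ge> 0" unfolding pair_prob_def by (rule avg_pow_nonneg) simp
    then show ?thesis by simp
  qed
  have "measure_pmf.prob (random_sign_mat n d) {M. robust s M} =
     measure_pmf.prob ?L {c. robust s (mat n d (\<lambda>ij. real_of_int (c ij)))}"
    unfolding random_sign_mat_eq by (simp add: vimage_def)
  also have "\<dots> \<le> measure_pmf.prob ?L {c. \<forall>t\<in>?T. c \<notin> ?Ev t}"
  proof (intro measure_pmf.finite_measure_mono subsetI)
    fix c assume "c \<in> {c. robust s (mat n d (\<lambda>ij. real_of_int (c ij)))}"
    then show "c \<in> {c. \<forall>t\<in>?T. c \<notin> ?Ev t}"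
      using transversal_imp_not_robust[of _ k m s d n c] h k by fastforce
  qed auto
  also have "\<dots> \<le> \<eta> + ?tail"
  proof (rule second_moment_bound[where q = ?q])
    show "?T \<noteq> {}" using m by (auto simp: PiE_eq_empty_iff lessThan_empty_iff)
    show "finite (set_pmf ?L)" by simp
    show "?q > 0" using p0 by simp
    show "measure_pmf.prob ?L (?Ev t) = ?q" if "t \<in> ?T" for t
      using prob_transversals[OF that that k(3), of n] by (simp add: agreement_self pair_prob_same)
    have row: "(\<Sum>t'\<in>?T. measure_pmf.prob ?L (?Ev t \<inter> ?Ev t')) \<le> ?q\<^sup>2 * (real m ^ k * (1 + (\<eta> + ?tail)))" if t: "t \<in> ?T" for t
    proof -
      have "(\<Sum>t'\<in>?T. measure_pmf.prob ?L (?Ev t \<inter> ?Ev t')) = (\<Sum>t'\<in>?T. ?q\<^sup>2 * ?R (agreement k t t'))"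
      proof (rule sum.cong[OF refl])
        fix t' assume t': "t' \<in> ?T"
        have "pair_prob k j ^ n = ?q\<^sup>2 * ?R j" for j
          using p0 by (simp add: power_divide power_mult[symmetric] mult.commute)
        then show "measure_pmf.prob ?L (?Ev t \<inter> ?Ev t') = ?q\<^sup>2 * ?R (agreement k t t')"
          using prob_transversals[OF t t' k(3), of n] by simp
      qed
      also have "\<dots> = ?q\<^sup>2 * (\<Sum>t'\<in>?T. ?R (agreement k t t'))" by (simp only: sum_distrib_left)
      finally have total: "(\<Sum>t'\<in>?T. measure_pmf.prob ?L (?Ev t \<inter> ?Ev t')) = ?q\<^sup>2 * (\<Sum>t'\<in>?T. ?R (agreement k t t'))" .
      have "(\<Sum>t'\<in>?T. ?R (agreement k t t')) \<le>
          (\<Sum>t'\<in>?T. (1 + \<eta>) + (\<Sum>j | j \<le> k \<and> J < real j. if agreement k t t' = j then ?R j else 0))"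
      proof (rule sum_mono)
        fix t' assume t': "t' \<in> ?T"
        let ?a = "agreement k t t'"
        have a: "?a \<le> k" by (rule agreement_le)
        have fin: "finite {j. j \<le> k \<and> J < real j}" by (rule finite_subset[of _ "{..k}"]) auto
        show "?R ?a \<le> (1 + \<eta>) + (\<Sum>j | j \<le> k \<and> J < real j. if ?a = j then ?R j else 0)"
        proof (cases "real ?a \<le> J")
          case True
          have "0 \<le> (\<Sum>j | j \<le> k \<and> J < real j. if ?a = j then ?R j else 0)" using R0 by (intro sum_nonneg) simp
          with small[OF a True] show ?thesis by linarith
        next
          case False
          then have "(\<Sum>j | j \<le> k \<and> J < real j. if ?a = j then ?R j else 0) = ?R ?a"
            using a fin by (simp add: sum.delta)
          then show ?thesis using \<eta> by linarith
        qed
      qed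
      also have "\<dots> = real m ^ k * (1 + \<eta>) + (\<Sum>j | j \<le> k \<and> J < real j. \<Sum>t'\<in>?T. if agreement k t t' = j then ?R j else 0)"
      proof -
        have "(\<Sum>t'\<in>?T. 1 + \<eta>) = real m ^ k * (1 + \<eta>)" by (simp only: sum_constant cT of_nat_power)
        then show ?thesis
          using sum.swap[of "\<lambda>t' j. if agreement k t t' = j then ?R j else 0" "{j. j \<le> k \<and> J < real j}" ?T]
            sum.distrib[of "\<lambda>_. 1 + \<eta>" "\<lambda>t'. \<Sum>j | j \<le> k \<and> J < real j. if agreement k t t' = j then ?R j else 0" ?T]
          by linarith
      qed
      also have "\<dots> \<le> real m ^ k * (1 + \<eta>) + (\<Sum>j | j \<le> k \<and> J < real j. real m ^ k * (real (k choose j) / real m ^ j * ?R j))"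
      proof (rule add_left_mono, rule sum_mono)
        fix j assume j: "j \<in> {j. j \<le> k \<and> J < real j}"
        have "(\<Sum>t'\<in>?T. if agreement k t t' = j then ?R j else 0) = real (card {t'\<in>?T. agreement k t t' = j}) * ?R j"
          using finT by (subst sum.inter_filter[symmetric]) auto
        also have "\<dots> \<le> real ((k choose j) * m ^ (k - j)) * ?R j"
          using card_agreement_le[OF t, of j] j R0 by (intro mult_right_mono of_nat_mono) auto
        also have "\<dots> = real m ^ k * (real (k choose j) / real m ^ j * ?R j)"
        proof -
          have "real (m ^ (k - j)) = real m ^ k / real m ^ j"
            unfolding of_nat_power using m j by (intro power_diff) auto
          then show ?thesis by (simp only: of_nat_mult) simp
        qed
        finally show "(\<Sum>t'\<in>?T. if agreement k t t' = j then ?R j else 0) \<le> real m ^ k * (real (k choose j) / real m ^ j * ?R j)" .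
      qed
      also have "\<dots> = real m ^ k * (1 + (\<eta> + ?tail))"
        by (simp only: sum_distrib_left[symmetric] distrib_left add.assoc)
      finally show ?thesis unfolding total by (rule mult_left_mono) simp
    qed
    have "(\<Sum>t\<in>?T. \<Sum>t'\<in>?T. measure_pmf.prob ?L (?Ev t \<inter> ?Ev t')) \<le> (\<Sum>t\<in>?T. ?q\<^sup>2 * (real m ^ k * (1 + (\<eta> + ?tail))))"
      by (rule sum_mono[OF row])
    also have "\<dots> = (1 + (\<eta> + ?tail)) * (real (card ?T) * ?q)\<^sup>2" by (simp add: cT power2_eq_square)
    finally show "(\<Sum>t\<in>?T. \<Sum>t'\<in>?T. measure_pmf.prob ?L (?Ev t \<inter> ?Ev t')) \<le> (1 + (\<eta> + ?tail)) * (real (card ?T) * ?q)\<^sup>2" .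
  qed (rule finT)
  finally show ?thesis .
qed

section \<open>Dependence above the threshold\<close>

text \<open>In this range \<open>y = (j / (k - 1))^2\<close> is at most \<open>1 / 4\<close>, where
  \<open>1 / sqrt (1 - y) \<le> exp y\<close>. The quadratic dependence on \<open>j\<close> keeps
  the \<open>n\<close>-th power near 1 for \<open>j\<close> well below
  \<open>sqrt n\<close>.\<close>

lemma pair_ratio_le_exp:
  assumes k: "k \<ge> 4" and j: "real j \<le> (real k - 1) / 2" and c: "fcoeff k 0 > 0"
  shows "pair_prob k j / (fcoeff k 0)\<^sup>2 \<le> exp ((real j / (real k - 1))\<^sup>2)"
proof -
  let ?y = "(real j / (real k - 1))\<^sup>2"
  have k1: "real k - 1 > 0" using k by simp
  have "real j + 2 \<le> real k" using j k by simp
  then have "j + 2 \<le> k" by simp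
  have "real j / (real k - 1) \<le> 1 / 2" using j k1 by (simp add: divide_le_eq)
  then have "?y \<le> (1 / 2)\<^sup>2" using k1 by (intro power_mono) auto
  then have y: "0 \<le> ?y" "?y \<le> 1 / 4" by (simp_all add: power_divide)
  have "exp (- (2 * ?y)) \<le> 1 - ?y" using y by (intro exp_minus_double_le) auto
  then have "sqrt (exp (- (2 * ?y))) \<le> sqrt (1 - ?y)" by simp
  moreover have "sqrt (exp (- (2 * ?y))) = exp (- ?y)"
  proof -
    have "exp (- (2 * ?y)) = (exp (- ?y))\<^sup>2" by (simp add: exp_double[symmetric])
    then show ?thesis by simp
  qed
  ultimately have e: "exp (- ?y) \<le> sqrt (1 - ?y)" by simp
  have "pair_prob k j / (fcoeff k 0)\<^sup>2 \<le> 1 / sqrt (1 - ?y)"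
    using pair_prob_le_invsqrt[OF \<open>j + 2 \<le> k\<close>] c by (simp add: divide_le_eq mult.commute)
  also have "\<dots> \<le> 1 / exp (- ?y)" using e y by (intro divide_left_mono mult_pos_pos) auto
  also have "\<dots> = exp ?y" by (simp add: exp_minus inverse_eq_divide)
  finally show ?thesis .
qed

text \<open>The bound \<open>1 - u^2 \<ge> 1 - u\<close> retains the dependence on
  \<open>k - 1 - j\<close>. The maximum covers \<open>j \<ge> k - 1\<close>, where the series bound
  fails and the trivial ratio \<open>1 / fcoeff k 0\<close> takes over.\<close>

lemma pair_ratio_le_sqrt:
  assumes h: "h \<ge> 1" "k = 2 * h" and j: "j \<le> k"
  shows "pair_prob k j / (fcoeff k 0)\<^sup>2 \<le> 2 * sqrt (real k / max 1 (real k - 1 - real j))"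
proof (cases "j + 2 \<le> k")
  case True
  let ?u = "real j / (real k - 1)"
  have k1: "real k - 1 > 0" and jk: "real j + 2 \<le> real k" using True h by linarith+
  have u: "0 \<le> ?u" "?u \<le> 1" using k1 jk by simp_all
  have mx: "max 1 (real k - 1 - real j) = real k - 1 - real j" using jk by simp
  have "0 < 1 / (2 * sqrt (real h))" using h by simp
  then have c: "fcoeff k 0 > 0" using fcoeff_0_lower[OF h(1)] unfolding h(2) by linarith
  have "(real k - 1 - real j) / real k \<le> (real k - 1 - real j) / (real k - 1)"
    using jk k1 by (intro divide_left_mono) auto
  also have "\<dots> = 1 - ?u" using k1 by (simp add: diff_divide_distrib)
  also have "\<dots> \<le> 1 - ?u\<^sup>2"
  proof -
    have "?u * ?u \<le> ?u * 1" using u by (intro mult_left_mono)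
    then show ?thesis unfolding power2_eq_square by linarith
  qed
  finally have low: "(real k - 1 - real j) / real k \<le> 1 - ?u\<^sup>2" .
  have low0: "0 < (real k - 1 - real j) / real k" using jk k1 by simp
  have "pair_prob k j / (fcoeff k 0)\<^sup>2 \<le> 1 / sqrt (1 - ?u\<^sup>2)"
    using pair_prob_le_invsqrt[OF True] c by (simp add: divide_le_eq mult.commute)
  also have "\<dots> \<le> 1 / sqrt ((real k - 1 - real j) / real k)"
  proof (intro divide_left_mono mult_pos_pos)
    show "sqrt ((real k - 1 - real j) / real k) \<le> sqrt (1 - ?u\<^sup>2)" using low by simp
    show "0 < sqrt ((real k - 1 - real j) / real k)" using low0 by simp
    show "0 < sqrt (1 - ?u\<^sup>2)" using low low0 by simp
  qed simp
  also have "\<dots> = sqrt (real k / (real k - 1 - real j))" by (simp add: real_sqrt_divide)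
  also have "\<dots> \<le> 2 * sqrt (real k / (real k - 1 - real j))" using jk by simp
  finally show ?thesis unfolding mx .
next
  case False
  then have mx: "max 1 (real k - 1 - real j) = 1" by simp
  have p0: "0 < 1 / (2 * sqrt (real h))" using h by simp
  then have c: "fcoeff k 0 > 0" using fcoeff_0_lower[OF h(1)] unfolding h(2) by linarith
  have "pair_prob k j / (fcoeff k 0)\<^sup>2 \<le> fcoeff k 0 / (fcoeff k 0)\<^sup>2"
    using pair_prob_le[OF j] by (intro divide_right_mono) auto
  also have "\<dots> = 1 / fcoeff k 0" using c by (simp add: power2_eq_square)
  also have "\<dots> \<le> 1 / (1 / (2 * sqrt (real h)))"
  proof (rule divide_left_mono)
    show "1 / (2 * sqrt (real h)) \<le> fcoeff k 0" using fcoeff_0_lower[OF h(1)] unfolding h(2) .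
    show "0 < fcoeff k 0 * (1 / (2 * sqrt (real h)))" using c p0 by (rule mult_pos_pos)
  qed simp
  also have "\<dots> = 2 * sqrt (real h)" by simp
  also have "\<dots> \<le> 2 * sqrt (real k)" using h by simp
  finally show ?thesis unfolding mx by simp
qed

lemma pair_ratio_nonneg: "0 \<le> pair_prob k j / (fcoeff k 0)\<^sup>2"
proof -
  have "pair_prob k j \<ge> 0" unfolding pair_prob_def by (rule avg_pow_nonneg) simp
  then show ?thesis by simp
qed

section \<open>Three ranges of the overlap \<open>j\<close>\<close>

context
  fixes n k h m :: nat and \<delta> L \<alpha> B J :: real
  assumes \<delta>: "0 < \<delta>" "\<delta> < 1" and \<alpha>: "\<alpha> = 1 / (2 - 2 * \<delta>)" and B: "B = 12 / (1 - \<delta>)"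
    and L: "L = ln (real n)" "L \<ge> 1" and J: "J = sqrt (real n) / L" "J \<le> (1 - \<delta>) * real n / 8"
    and h: "h \<ge> 1" "k = 2 * h"
    and k: "k \<ge> 4" "real k \<le> (1 - \<delta>) * real n" "(1 - \<delta>) * real n - 2 \<le> real k" "(1 - \<delta>) * real n / 4 \<le> real k - 1"
    and m: "exp (\<alpha> * L + B * ln L) / 2 \<le> real m"
    and x: "2 * exp (1 + 2 / (1 - \<delta>) + (1 - B) * ln L) \<le> 1 / 2"
begin

lemma parameter_bounds:
  shows "real n > 0" "real n = exp L" "ln L \<ge> 0" "\<alpha> \<ge> 1 / 2" "(1 - \<delta>) * \<alpha> = 1 / 2" "real m > 0" "real k \<le> real n"
    "fcoeff k 0 > 0" "real k - 1 > 0" "J > 0" "(1 - \<delta>) * real n / 8 \<le> (real k - 1) / 2"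
proof -
  have "w / 8 \<le> (real k - 1) / 2" if "w / 4 \<le> real k - 1" for w
    using divide_right_mono[OF that, of 2] by simp
  then show "(1 - \<delta>) * real n / 8 \<le> (real k - 1) / 2" using k(4) .
  show n0: "real n > 0" using L by (cases "n = 0") auto
  then show "real n = exp L" using L(1) by simp
  show "ln L \<ge> 0" using L(2) by simp
  show "(1 - \<delta>) * \<alpha> = 1 / 2" using \<delta> unfolding \<alpha> by (simp add: field_simps)
  show "\<alpha> \<ge> 1 / 2" using \<delta> unfolding \<alpha> by (simp add: field_simps)
  show "real m > 0" using m by (smt (verit) exp_gt_zero half_gt_zero)
  have "(1 - \<delta>) * real n \<le> 1 * real n" using \<delta> by (intro mult_right_mono) auto
  then show "real k \<le> real n" using k(2) by linarith
  have "0 < 1 / (2 * sqrt (real h))" using h by simp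
  then show "fcoeff k 0 > 0" using fcoeff_0_lower[OF h(1)] unfolding h(2) by linarith
  show "real k - 1 > 0" using k(1) by simp
  show "J > 0" unfolding J(1) using n0 L(2) by (intro divide_pos_pos) auto
qed

text \<open>The cut \<open>J = sqrt n / L\<close> makes \<open>n * (J / k)^2\<close> of order
  \<open>1 / L^2\<close>, so the bound tends to 1.\<close>

lemma small_overlap:
  assumes j: "real j \<le> J"
  shows "(pair_prob k j / (fcoeff k 0)\<^sup>2) ^ n \<le> exp (16 / ((1 - \<delta>)\<^sup>2 * L\<^sup>2))"
proof -
  note bf = parameter_bounds
  have "real j \<le> (real k - 1) / 2" using j J(2) bf(11) by linarith
  then have "(pair_prob k j / (fcoeff k 0)\<^sup>2) ^ n \<le> exp ((real j / (real k - 1))\<^sup>2) ^ n"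
    using pair_ratio_le_exp[OF k(1) _ bf(8)] by (intro power_mono pair_ratio_nonneg) auto
  also have "\<dots> = exp (real n * (real j / (real k - 1))\<^sup>2)" by (simp only: exp_of_nat_mult)
  also have "\<dots> \<le> exp (real n * (J / ((1 - \<delta>) * real n / 4))\<^sup>2)"
    unfolding exp_le_cancel_iff using j k(4) bf \<delta>
    by (intro mult_left_mono power_mono frac_le mult_pos_pos divide_pos_pos) auto
  also have "real n * (J / ((1 - \<delta>) * real n / 4))\<^sup>2 = 16 / ((1 - \<delta>)\<^sup>2 * L\<^sup>2)"
  proof -
    have calc: "real n * (16 * (real n / L\<^sup>2) / (q * (real n)\<^sup>2)) = 16 / (q * L\<^sup>2)" if "q > 0" for q
      using bf(1) L(2) that by (simp add: field_simps power2_eq_square)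
    have "J\<^sup>2 = real n / L\<^sup>2" unfolding J(1) by (simp add: power_divide)
    then have "(J / ((1 - \<delta>) * real n / 4))\<^sup>2 = 16 * (real n / L\<^sup>2) / ((1 - \<delta>)\<^sup>2 * (real n)\<^sup>2)"
      by (simp add: power_divide power_mult_distrib)
    moreover have "(1 - \<delta>)\<^sup>2 > 0" using \<delta> by simp
    ultimately show ?thesis using calc[of "(1 - \<delta>)\<^sup>2"] by simp
  qed
  finally show ?thesis .
qed

text \<open>Up to \<open>(k - 1) / 2\<close> the quadratic exponent is at most linear in
  \<open>j\<close>, so the whole term is bounded by a \<open>j\<close>-th power. Its base is of
  order \<open>k / (j * m)\<close>; as \<open>k / j \<le> sqrt n * L\<close>, while \<open>m\<close>
  is at least \<open>n powr \<alpha> * L powr B / 2\<close> with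
  \<open>\<alpha> \<ge> 1 / 2\<close>, the base is at most \<open>1 / 2\<close>.\<close>

lemma middle_overlap:
  assumes j: "J < real j" "real j \<le> (real k - 1) / 2"
  shows "real (k choose j) / real m ^ j * (pair_prob k j / (fcoeff k 0)\<^sup>2) ^ n \<le> exp (- (J * ln 2))"
proof -
  note bf = parameter_bounds
  have j0: "real j > 0" using j bf by linarith
  then have j1: "j \<ge> 1" by simp
  have "(pair_prob k j / (fcoeff k 0)\<^sup>2) ^ n \<le> exp ((real j / (real k - 1))\<^sup>2) ^ n"
    using pair_ratio_le_exp[OF k(1) j(2) bf(8)] by (intro power_mono pair_ratio_nonneg) auto
  also have "\<dots> = exp (real n * (real j / (real k - 1))\<^sup>2)" by (simp only: exp_of_nat_mult)
  also have "\<dots> \<le> exp (real j * (2 / (1 - \<delta>)))"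
    unfolding exp_le_cancel_iff
  proof -
    have "real n * (real j / (real k - 1))\<^sup>2 = real j * (real n * (real j / (real k - 1)) / (real k - 1))"
      by (simp add: power2_eq_square)
    also have "\<dots> \<le> real j * (2 / (1 - \<delta>))"
    proof (rule mult_left_mono)
      have "real j / (real k - 1) \<le> 1 / 2" using j(2) bf(9) by (simp add: divide_le_eq)
      have "real n * (real j / (real k - 1)) / (real k - 1) \<le> real n * (1 / 2) / ((1 - \<delta>) * real n / 4)"
      proof (intro frac_le)
        show "real n * (real j / (real k - 1)) \<le> real n * (1 / 2)"
          using \<open>real j / (real k - 1) \<le> 1 / 2\<close> by (rule mult_left_mono) simp
      qed (use k(4) bf(1) \<delta> in auto)
      also have "\<dots> = 2 / (1 - \<delta>)" using bf(1) \<delta> by (simp add: field_simps)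
      finally show "real n * (real j / (real k - 1)) / (real k - 1) \<le> 2 / (1 - \<delta>)" .
    qed simp
    finally show "real n * (real j / (real k - 1))\<^sup>2 \<le> real j * (2 / (1 - \<delta>))" .
  qed
  also have "\<dots> = exp (2 / (1 - \<delta>)) ^ j" by (simp only: exp_of_nat_mult)
  finally have R: "(pair_prob k j / (fcoeff k 0)\<^sup>2) ^ n \<le> exp (2 / (1 - \<delta>)) ^ j" .
  have nJ: "real n / J = exp (L / 2 + ln L)"
  proof -
    have "real n = (exp (L / 2))\<^sup>2" unfolding bf(2) by (simp add: exp_double[symmetric])
    then have "sqrt (real n) = exp (L / 2)" by simp
    moreover have "real n = exp (L / 2) * exp (L / 2)" unfolding bf(2) by (simp add: exp_add[symmetric])
    ultimately show ?thesis unfolding J(1) using L(2) by (simp add: exp_add)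
  qed
  have base: "exp 1 * real k / real j / real m * exp (2 / (1 - \<delta>)) \<le> 1 / 2"
  proof -
    have "exp 1 * real k / real j / real m * exp (2 / (1 - \<delta>)) \<le>
        exp 1 * real n / J / (exp (\<alpha> * L + B * ln L) / 2) * exp (2 / (1 - \<delta>))"
      using bf j m by (intro mult_right_mono frac_le mult_left_mono divide_nonneg_nonneg) auto
    also have "exp 1 * real n / J / (exp (\<alpha> * L + B * ln L) / 2) * exp (2 / (1 - \<delta>)) =
       2 * (exp 1 * (real n / J) / exp (\<alpha> * L + B * ln L) * exp (2 / (1 - \<delta>)))" by simp
    also have "\<dots> = 2 * (exp 1 * exp (L / 2 + ln L) / exp (\<alpha> * L + B * ln L) * exp (2 / (1 - \<delta>)))"
      unfolding nJ ..
    also have "exp 1 * exp (L / 2 + ln L) / exp (\<alpha> * L + B * ln L) * exp (2 / (1 - \<delta>)) =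
       exp (1 + (L / 2 + ln L) - (\<alpha> * L + B * ln L) + 2 / (1 - \<delta>))"
      by (simp only: exp_add exp_diff)
    also have "2 * \<dots> \<le> 2 * exp (1 + 2 / (1 - \<delta>) + (1 - B) * ln L)"
    proof -
      have "1 / 2 * L \<le> \<alpha> * L" using bf(4) L(2) by (intro mult_right_mono) auto
      then show ?thesis by (simp add: algebra_simps)
    qed
    finally show ?thesis using x by linarith
  qed
  have "real (k choose j) / real m ^ j * (pair_prob k j / (fcoeff k 0)\<^sup>2) ^ n \<le>
     (exp 1 * real k / real j) ^ j / real m ^ j * exp (2 / (1 - \<delta>)) ^ j"
    using R binomial_le_exp_power[OF j1, of k] pair_ratio_nonneg by (intro mult_mono divide_right_mono) auto
  also have "\<dots> = (exp 1 * real k / real j / real m * exp (2 / (1 - \<delta>))) ^ j"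
    by (simp only: power_mult_distrib power_divide)
  also have "\<dots> \<le> (1 / 2) ^ j" using base by (intro power_mono) auto
  also have "\<dots> = exp (- (real j * ln 2))" by (simp add: exp_minus exp_of_nat_mult power_one_over inverse_eq_divide)
  also have "\<dots> \<le> exp (- (J * ln 2))" using j by simp
  finally show ?thesis .
qed

text \<open>Since \<open>\<alpha> * k\<close> is about \<open>n / 2\<close>, the denominator
  \<open>m ^ j\<close> nearly cancels the \<open>n powr (n / 2)\<close> coming from the ratio. What
  remains, \<open>n powr (\<alpha> * i) / i powr (n / 2)\<close>, costs at most
  \<open>L powr (n / 2)\<close> up to a constant to the power \<open>n\<close>, by
  \<open>key\<close>. As \<open>j \<ge> (1 - \<delta>) * n / 8\<close>, the value
  \<open>12 / (1 - \<delta>)\<close> of \<open>B\<close> gains \<open>L powr (3 * n / 2)\<close>,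
  leaving a net gain \<open>L ^ n\<close>.\<close>

lemma large_overlap:
  assumes j: "(real k - 1) / 2 < real j" "j \<le> k"
  shows "real (k choose j) / real m ^ j * (pair_prob k j / (fcoeff k 0)\<^sup>2) ^ n \<le>
     exp (real n * (3 * ln 2 + \<alpha> - ln L) + 3 * \<alpha> * L)"
proof -
  note bf = parameter_bounds
  define i where "i = max 1 (real k - 1 - real j)"
  have i1: "i \<ge> 1" by (simp add: i_def)
  have two: "(2 :: real) ^ l = exp (real l * ln 2)" for l by (simp add: exp_of_nat_mult)
  have ch: "real (k choose j) \<le> exp (real n * ln 2)"
  proof -
    have "(k choose j) \<le> 2 ^ k" by (rule binomial_le_pow2)
    then have "real (k choose j) \<le> real (2 ^ k)" by (simp only: of_nat_le_iff)
    also have "\<dots> = exp (real k * ln 2)" by (simp add: two)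
    also have "\<dots> \<le> exp (real n * ln 2)" using bf(7) by simp
    finally show ?thesis .
  qed
  have jlow: "(1 - \<delta>) * real n / 8 \<le> real j" using j(1) bf(11) by linarith
  have mj: "1 / real m ^ j \<le> exp (real n * ln 2 - real n * L / 2 + 3 * \<alpha> * L + \<alpha> * i * L - 3 / 2 * real n * ln L)"
  proof -
    have "1 / real m ^ j \<le> 1 / (exp (\<alpha> * L + B * ln L) / 2) ^ j"
      using m bf by (intro divide_left_mono power_mono mult_pos_pos zero_less_power) auto
    also have "\<dots> = exp (real j * ln 2 - real j * (\<alpha> * L + B * ln L))"
      by (simp add: power_divide two exp_diff exp_of_nat_mult[symmetric])
    also have "\<dots> \<le> exp (real n * ln 2 - real n * L / 2 + 3 * \<alpha> * L + \<alpha> * i * L - 3 / 2 * real n * ln L)"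
      unfolding exp_le_cancel_iff
    proof -
      have a: "real j * ln 2 \<le> real n * ln 2" using j bf(7) by (intro mult_right_mono) auto
      have "real k - 1 - i \<le> real j" by (simp add: i_def)
      then have "(1 - \<delta>) * real n - 3 - i \<le> real j" using k(3) by linarith
      then have "((1 - \<delta>) * real n - 3 - i) * (\<alpha> * L) \<le> real j * (\<alpha> * L)"
        using bf L(2) by (intro mult_right_mono mult_nonneg_nonneg) auto
      moreover have "((1 - \<delta>) * real n - 3 - i) * (\<alpha> * L) = ((1 - \<delta>) * \<alpha>) * (real n * L) - 3 * \<alpha> * L - \<alpha> * i * L"
        by (simp add: algebra_simps)
      ultimately have b: "real n * L / 2 - 3 * \<alpha> * L - \<alpha> * i * L \<le> real j * (\<alpha> * L)"
        unfolding bf(5) by simp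
      have "(1 - \<delta>) * real n / 8 * (B * ln L) \<le> real j * (B * ln L)"
        using jlow bf(3) \<delta> by (intro mult_right_mono mult_nonneg_nonneg) (auto simp: B)
      moreover have "(1 - \<delta>) * real n / 8 * (B * ln L) = 3 / 2 * real n * ln L"
      proof -
        have "(1 - \<delta>) * B = 12" using \<delta> by (simp add: B field_simps)
        moreover have "(1 - \<delta>) * real n / 8 * (B * ln L) = ((1 - \<delta>) * B) * (real n * ln L / 8)" by simp
        ultimately show ?thesis by simp
      qed
      ultimately have c: "3 / 2 * real n * ln L \<le> real j * (B * ln L)" by (simp only:)
      show "real j * ln 2 - real j * (\<alpha> * L + B * ln L) \<le>
        real n * ln 2 - real n * L / 2 + 3 * \<alpha> * L + \<alpha> * i * L - 3 / 2 * real n * ln L"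
        unfolding distrib_left using a b c by linarith
    qed
    finally show ?thesis .
  qed
  have R: "(pair_prob k j / (fcoeff k 0)\<^sup>2) ^ n \<le> exp (real n * ln 2 + real n / 2 * (L - ln i))"
  proof -
    have "(pair_prob k j / (fcoeff k 0)\<^sup>2) ^ n \<le> (2 * sqrt (real k / i)) ^ n"
      using pair_ratio_le_sqrt[OF h j(2)] unfolding i_def by (intro power_mono pair_ratio_nonneg) auto
    also have "\<dots> \<le> (2 * sqrt (real n / i)) ^ n"
      using bf(7) i1 by (intro power_mono mult_left_mono) (auto simp: divide_right_mono)
    also have "sqrt (real n / i) = exp ((L - ln i) / 2)"
    proof -
      have "exp (L - ln i) = real n / i" unfolding bf(2) using i1 by (simp add: exp_diff)
      moreover have "2 * ((L - ln i) / 2) = L - ln i" by simp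
      ultimately have "real n / i = (exp ((L - ln i) / 2))\<^sup>2"
        using exp_double[of "(L - ln i) / 2"] by (simp only:)
      then show ?thesis by simp
    qed
    also have "(2 * exp ((L - ln i) / 2)) ^ n = exp (real n * ln 2) * exp (real n * ((L - ln i) / 2))"
      by (simp only: power_mult_distrib two exp_of_nat_mult)
    also have "\<dots> = exp (real n * ln 2 + real n / 2 * (L - ln i))" by (simp add: exp_add[symmetric])
    finally show ?thesis .
  qed
  \<comment> \<open>For \<open>i \<le> n / L\<close> one has \<open>i * L \<le> n\<close>. Beyond
    that, \<open>ln i \<ge> L - ln L\<close> and \<open>i \<le> k / 2\<close>, so the gain
    \<open>n * L / 2\<close> outweighs \<open>\<alpha> * i * L \<le> n * L / 4\<close>.\<close>
  have key: "\<alpha> * i * L - real n / 2 * ln i \<le> \<alpha> * real n + real n / 2 * ln L"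
  proof (cases "i \<le> real n / L")
    case True
    then have "i * L \<le> real n" using L(2) by (simp add: pos_le_divide_eq)
    then have "\<alpha> * (i * L) \<le> \<alpha> * real n" using bf(4) by (intro mult_left_mono) auto
    moreover have "0 \<le> real n / 2 * ln i" using i1 by simp
    moreover have "0 \<le> real n / 2 * ln L" using bf(3) by simp
    ultimately show ?thesis by (simp only: mult.assoc)
  next
    case False
    have "L \<le> real n" unfolding bf(2) using exp_ge_add_one_self[of L] by linarith
    then have "1 \<le> real n / L" using L(2) by (simp add: pos_le_divide_eq)
    then have "i > 1" using False by linarith
    then have "i = real k - 1 - real j" by (simp add: i_def max_def split: if_splits)
    then have "i \<le> real k / 2" using j(1) by (simp add: field_simps)
    then have "i \<le> (1 - \<delta>) * real n / 2" using k(2) by linarith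
    then have "i * (\<alpha> * L) \<le> (1 - \<delta>) * real n / 2 * (\<alpha> * L)" using bf(4) L(2) by (intro mult_right_mono mult_nonneg_nonneg) auto
    also have "\<dots> = ((1 - \<delta>) * \<alpha>) * (real n * L / 2)" by simp
    also have "\<dots> = real n * L / 4" unfolding bf(5) by simp
    finally have 1: "\<alpha> * i * L \<le> real n * L / 4" by (simp add: mult_ac)
    have "ln (real n / L) \<le> ln i" using False bf(1) L(2) i1 by (subst ln_le_cancel_iff) auto
    moreover have "ln (real n / L) = L - ln L" using bf(1) L by (simp add: ln_div)
    ultimately have "real n / 2 * (L - ln L) \<le> real n / 2 * ln i" by (intro mult_left_mono) auto
    then have 2: "real n * L / 2 - real n / 2 * ln L \<le> real n / 2 * ln i" by (simp add: algebra_simps)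
    have "0 \<le> real n * L / 4" "0 \<le> \<alpha> * real n" using L(2) bf(4) by simp_all
    with 1 2 show ?thesis by linarith
  qed
  have "real (k choose j) / real m ^ j * (pair_prob k j / (fcoeff k 0)\<^sup>2) ^ n =
     real (k choose j) * (1 / real m ^ j) * (pair_prob k j / (fcoeff k 0)\<^sup>2) ^ n" by simp
  also have "\<dots> \<le> exp (real n * ln 2) *
     exp (real n * ln 2 - real n * L / 2 + 3 * \<alpha> * L + \<alpha> * i * L - 3 / 2 * real n * ln L) *
     exp (real n * ln 2 + real n / 2 * (L - ln i))"
    using ch mj R pair_ratio_nonneg by (intro mult_mono) auto
  also have "\<dots> = exp (real n * ln 2 +
     (real n * ln 2 - real n * L / 2 + 3 * \<alpha> * L + \<alpha> * i * L - 3 / 2 * real n * ln L) +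
     (real n * ln 2 + real n / 2 * (L - ln i)))" by (simp only: exp_add)
  also have "\<dots> \<le> exp (real n * (3 * ln 2 + \<alpha> - ln L) + 3 * \<alpha> * L)"
    unfolding exp_le_cancel_iff using key by (simp add: algebra_simps diff_divide_distrib)
  finally show ?thesis .
qed

lemma tail_bound:
  "(\<Sum>j | j \<le> k \<and> J < real j. real (k choose j) / real m ^ j * (pair_prob k j / (fcoeff k 0)\<^sup>2) ^ n) \<le>
    real n * (exp (- (J * ln 2)) + exp (real n * (3 * ln 2 + \<alpha> - ln L) + 3 * \<alpha> * L))"
    (is "_ \<le> real n * ?t")
proof -
  note bf = parameter_bounds
  have "(\<Sum>j | j \<le> k \<and> J < real j. real (k choose j) / real m ^ j * (pair_prob k j / (fcoeff k 0)\<^sup>2) ^ n) \<le>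
     (\<Sum>j | j \<le> k \<and> J < real j. ?t)"
  proof (rule sum_mono)
    fix j assume j: "j \<in> {j. j \<le> k \<and> J < real j}"
    show "real (k choose j) / real m ^ j * (pair_prob k j / (fcoeff k 0)\<^sup>2) ^ n \<le> ?t"
    proof (cases "real j \<le> (real k - 1) / 2")
      case True
      with j show ?thesis using middle_overlap[of j] by (simp add: add_increasing2)
    next
      case False
      with j show ?thesis using large_overlap[of j] by (simp add: add_increasing)
    qed
  qed
  also have "\<dots> = real (card {j. j \<le> k \<and> J < real j}) * ?t" by simp
  also have "\<dots> \<le> real n * ?t"
  proof (intro mult_right_mono)
    have "{j. j \<le> k \<and> J < real j} \<subseteq> {1..k}" using bf(10) by (auto simp: Suc_le_eq intro: gr0I)
    from card_mono[OF _ this] have "card {j. j \<le> k \<and> J < real j} \<le> k" by simp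
    then show "real (card {j. j \<le> k \<and> J < real j}) \<le> real n" using bf(7) by linarith
  qed (simp add: add_nonneg_nonneg)
  finally show ?thesis .
qed

end

theorem not_robust_above_threshold:
  fixes \<delta> :: real and \<epsilon> :: "nat \<Rightarrow> real" and d :: "nat \<Rightarrow> nat"
  assumes \<delta>: "0 < \<delta>" "\<delta> < 1"
    and \<epsilon>: "filterlim (\<lambda>n. \<epsilon> n * ln (real n) / ln (ln (real n))) at_top sequentially"
    and d: "\<forall>\<^sub>F n in sequentially. real (d n) \<ge> real n powr (1 + 1 / (2 - 2 * \<delta>) + \<epsilon> n)"
  shows "(\<lambda>n. measure_pmf.prob (random_sign_mat n (d n)) {M. \<not> robust (nat \<lfloor>(1 - \<delta>) * real n\<rfloor>) M}) \<longlonglongrightarrow> 1"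
proof -
  define \<alpha> B where "\<alpha> = 1 / (2 - 2 * \<delta>)" and "B = 12 / (1 - \<delta>)"
  define s where "s n = nat \<lfloor>(1 - \<delta>) * real n\<rfloor>" for n
  let ?err = "\<lambda>n. (exp (16 / ((1 - \<delta>)\<^sup>2 * (ln (real n))\<^sup>2)) - 1) +
     (real n * exp (- (sqrt (real n) / ln (real n) * ln 2)) +
      real n * exp (real n * (3 * ln 2 + \<alpha> - ln (ln (real n))) + 3 * \<alpha> * ln (real n)))"
  have \<alpha>0: "\<alpha> > 0" using \<delta> by (simp add: \<alpha>_def)
  have B1: "B \<ge> 12" using \<delta> by (simp add: B_def le_divide_eq)
  have ev1: "\<forall>\<^sub>F n :: nat in sequentially. ln (real n) \<ge> 1" by real_asymp
  \<comment> \<open>Then \<open>(1 - \<delta>) * n \<ge> 16\<close>, so rounding down to an even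
    \<open>k\<close>, which loses at most 2, still leaves
    \<open>k - 1 \<ge> (1 - \<delta>) * n / 4\<close>.\<close>
  have ev_n: "\<forall>\<^sub>F n :: nat in sequentially. real n \<ge> 16 / (1 - \<delta>)"
    by (rule eventually_ge_at_top[THEN eventually_compose_filterlim[OF _ filterlim_real_sequentially]])
  have ev_J: "\<forall>\<^sub>F n :: nat in sequentially. sqrt (real n) / ln (real n) / real n < (1 - \<delta>) / 8"
  proof (rule order_tendstoD(2))
    show "(\<lambda>n. sqrt (real n) / ln (real n) / real n) \<longlonglongrightarrow> 0" by real_asymp
  qed (use \<delta> in simp)
  have ev_x: "\<forall>\<^sub>F n :: nat in sequentially. 2 * exp (1 + 2 / (1 - \<delta>) - ln (ln (real n))) < 1 / 2"
  proof (rule order_tendstoD(2))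
    have "(\<lambda>n :: nat. 2 * exp (A - ln (ln (real n)))) \<longlonglongrightarrow> 0" for A :: real by real_asymp
    then show "(\<lambda>n :: nat. 2 * exp (1 + 2 / (1 - \<delta>) - ln (ln (real n)))) \<longlonglongrightarrow> 0" .
  qed simp
  have ev: "\<forall>\<^sub>F n in sequentially. measure_pmf.prob (random_sign_mat n (d n)) {M. robust (s n) M} \<le> ?err n"
    using d eventually_eps_ge[OF \<epsilon>, of B] ev1 ev_n ev_J ev_x
  proof eventually_elim
    case (elim n)
    define L where "L = ln (real n)"
    \<comment> \<open>This makes \<open>k = 2 * h\<close> the largest even number up to
      \<open>s n\<close>.\<close>
    define h where "h = s n div 2"
    define k where "k = 2 * h"
    define m where "m = d n div k"
    define J where "J = sqrt (real n) / L"
    have L1: "L \<ge> 1" using elim by (simp add: L_def)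
    have "16 \<le> 16 / (1 - \<delta>)" using \<delta> by (simp add: le_divide_eq)
    then have n: "real n > 0" "real n \<ge> 16" using elim(4) by linarith+
    have dn16: "(1 - \<delta>) * real n \<ge> 16" using elim(4) \<delta> by (simp add: divide_le_eq mult.commute)
    have pw: "real n powr a = exp (a * L)" for a using n by (simp add: powr_def L_def)
    have nL: "real n = exp L" using n by (simp add: L_def)
    have lnL: "ln L \<ge> 0" using L1 by simp
    have s: "real (s n) \<le> (1 - \<delta>) * real n" "(1 - \<delta>) * real n - 1 \<le> real (s n)"
    proof -
      show "real (s n) \<le> (1 - \<delta>) * real n" unfolding s_def using \<delta> by (intro of_nat_floor) simp
      have "real_of_int \<lfloor>(1 - \<delta>) * real n\<rfloor> \<le> real (s n)" unfolding s_def by simp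
      then show "(1 - \<delta>) * real n - 1 \<le> real (s n)" by linarith
    qed
    have "k \<le> s n" "s n \<le> k + 1" unfolding k_def h_def by linarith+
    then have "real k \<le> real (s n)" "real (s n) \<le> real k + 1" by linarith+
    then have k2: "real k \<le> (1 - \<delta>) * real n" and k3: "(1 - \<delta>) * real n - 2 \<le> real k" using s by linarith+
    have "w / 4 \<le> real k - 1 \<and> real k \<ge> 14" if "w - 2 \<le> real k" "w \<ge> 16" for w using that by linarith
    then have k4: "(1 - \<delta>) * real n / 4 \<le> real k - 1" and k1: "real k \<ge> 14" using k3 dn16 by blast+
    then have k1': "k \<ge> 4" by simp
    then have h1: "h \<ge> 1" by (simp add: k_def)
    have "(1 - \<delta>) * real n \<le> 1 * real n" using \<delta> by (intro mult_right_mono) auto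
    then have sn: "real (s n) \<le> real n" "real k \<le> real n" using s k2 by linarith+
    have dn: "exp (L + \<alpha> * L + B * ln L) \<le> real (d n)"
    proof -
      have "exp (L + \<alpha> * L + B * ln L) \<le> exp ((1 + \<alpha> + \<epsilon> n) * L)"
        using elim(2) by (simp add: L_def algebra_simps)
      then show ?thesis using elim(1) unfolding pw \<alpha>_def by linarith
    qed
    have BL: "B * ln L \<ge> 0" "\<alpha> * L \<ge> 0" using B1 lnL \<alpha>0 L1 by simp_all
    then have "exp L \<le> exp (L + \<alpha> * L + B * ln L)" by simp
    then have nd: "real n \<le> real (d n)" using dn nL by linarith
    then have sd: "s n \<le> d n" "k \<le> d n" using sn by linarith+
    \<comment> \<open>Rounding the block length loses at most a factor 2, which becomes the
      \<open>/ 2\<close> in the lower bound for \<open>m\<close>.\<close>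
    have "d n = k * m + d n mod k" unfolding m_def by simp
    moreover have "d n mod k < k" using k1' by (intro mod_less_divisor) simp
    moreover have m1: "m \<ge> 1" unfolding m_def using sd(2) k1' by (simp add: Suc_le_eq div_greater_zero_iff)
    then have "k \<le> k * m" by simp
    ultimately have km: "k * m \<le> d n" "d n \<le> 2 * (k * m)" by linarith+
    have mlow: "exp (\<alpha> * L + B * ln L) / 2 \<le> real m"
    proof -
      have "real n * exp (\<alpha> * L + B * ln L) = exp (L + \<alpha> * L + B * ln L)"
        unfolding nL by (simp add: exp_add[symmetric] add.assoc)
      also have "\<dots> \<le> real (2 * (k * m))" using dn km(2) by (meson of_nat_le_iff order_trans)
      also have "\<dots> = 2 * (real k * real m)" by simp
      also have "\<dots> \<le> 2 * (real n * real m)" using sn(2) by (intro mult_left_mono mult_right_mono) auto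
      finally have "real n * exp (\<alpha> * L + B * ln L) \<le> real n * (2 * real m)" by simp
      then show ?thesis using n(1) by simp
    qed
    have Jle: "J \<le> (1 - \<delta>) * real n / 8"
    proof -
      have "J / real n < (1 - \<delta>) / 8" using elim(5) by (simp add: J_def L_def)
      then show ?thesis using n(1) by (simp add: field_simps)
    qed
    have x: "2 * exp (1 + 2 / (1 - \<delta>) + (1 - B) * ln L) \<le> 1 / 2"
    proof -
      have "(1 - B) * ln L \<le> (- 1) * ln L" using B1 lnL by (intro mult_right_mono) auto
      then have "exp (1 + 2 / (1 - \<delta>) + (1 - B) * ln L) \<le> exp (1 + 2 / (1 - \<delta>) - ln L)" by simp
      then show ?thesis using elim(6) unfolding L_def[symmetric] by linarith
    qed
    note args = \<delta> \<alpha>_def B_def L_def L1 J_def Jle h1 k_def k1' k2 k3 k4 mlow x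
    have "measure_pmf.prob (random_sign_mat n (d n)) {M. robust (s n) M} \<le>
      (exp (16 / ((1 - \<delta>)\<^sup>2 * L\<^sup>2)) - 1) +
      (\<Sum>j | j \<le> k \<and> J < real j. real (k choose j) / real m ^ j * (pair_prob k j / (fcoeff k 0)\<^sup>2) ^ n)"
    proof (rule prob_robust_le[OF h1 k_def \<open>k \<le> s n\<close> sd(1) km(1) m1])
      show "(pair_prob k j / (fcoeff k 0)\<^sup>2) ^ n \<le> 1 + (exp (16 / ((1 - \<delta>)\<^sup>2 * L\<^sup>2)) - 1)" if "real j \<le> J" for j
        using small_overlap[OF args that] by simp
    qed simp
    also have "\<dots> \<le> (exp (16 / ((1 - \<delta>)\<^sup>2 * L\<^sup>2)) - 1) +
      real n * (exp (- (J * ln 2)) + exp (real n * (3 * ln 2 + \<alpha> - ln L) + 3 * \<alpha> * L))"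
      by (intro add_left_mono tail_bound[OF args])
    finally show ?case unfolding J_def L_def distrib_left .
  qed
  have "?err \<longlonglongrightarrow> (exp (16 * 0) - 1) + (0 + 0)"
  proof (intro tendsto_add tendsto_diff tendsto_const tendsto_exp)
    have "(\<lambda>n. 16 / (1 - \<delta>)\<^sup>2 * (1 / (ln (real n))\<^sup>2)) \<longlonglongrightarrow> 16 / (1 - \<delta>)\<^sup>2 * 0"
      by (intro tendsto_mult tendsto_const) real_asymp
    then show "(\<lambda>n. 16 / ((1 - \<delta>)\<^sup>2 * (ln (real n))\<^sup>2)) \<longlonglongrightarrow> 16 * 0" by simp
    show "(\<lambda>n. real n * exp (- (sqrt (real n) / ln (real n) * ln 2))) \<longlonglongrightarrow> 0" by real_asymp
    show "(\<lambda>n. real n * exp (real n * (3 * ln 2 + \<alpha> - ln (ln (real n))) + 3 * \<alpha> * ln (real n))) \<longlonglongrightarrow> 0" by real_asymp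
  qed
  then have err: "?err \<longlonglongrightarrow> 0" by simp
  have "(\<lambda>n. measure_pmf.prob (random_sign_mat n (d n)) {M. robust (s n) M}) \<longlonglongrightarrow> 0"
    by (rule tendsto_sandwich[OF _ ev tendsto_const err]) simp
  then have "(\<lambda>n. 1 - measure_pmf.prob (random_sign_mat n (d n)) {M. robust (s n) M}) \<longlonglongrightarrow> 1 - 0"
    by (intro tendsto_diff tendsto_const)
  moreover have "1 - measure_pmf.prob (random_sign_mat n (d n)) {M. robust (s n) M} =
      measure_pmf.prob (random_sign_mat n (d n)) {M. \<not> robust (s n) M}" for n
    using prob_eq_1_minus[of "random_sign_mat n (d n)" "\<lambda>M. \<not> robust (s n) M"] by simp
  ultimately show ?thesis by (simp add: s_def)
qed

theorem theorem1p2: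
  fixes \<delta> :: real and \<epsilon> :: "nat \<Rightarrow> real"
  assumes "0 < \<delta>" and "\<delta> < 1"
    and "filterlim (\<lambda>n. \<epsilon> n * ln (real n) / ln (ln (real n))) at_top sequentially"
  shows "(\<forall>d :: nat \<Rightarrow> nat.
            (\<forall>\<^sub>F n in sequentially. real (d n) \<le> real n powr (1 + 1 / (2 - 2 * \<delta>) - \<epsilon> n)) \<longrightarrow>
            (\<lambda>n. measure_pmf.prob (random_sign_mat n (d n))
                   {M. robust (nat \<lfloor>(1 - \<delta>) * real n\<rfloor>) M}) \<longlonglongrightarrow> 1) \<and>
         (\<forall>d :: nat \<Rightarrow> nat.
            (\<forall>\<^sub>F n in sequentially. real (d n) \<ge> real n powr (1 + 1 / (2 - 2 * \<delta>) + \<epsilon> n)) \<longrightarrow>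
            (\<lambda>n. measure_pmf.prob (random_sign_mat n (d n))
                   {M. \<not> robust (nat \<lfloor>(1 - \<delta>) * real n\<rfloor>) M}) \<longlonglongrightarrow> 1)"
  using robust_below_threshold[OF assms] not_robust_above_threshold[OF assms] by blast

end
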